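(* For $a>1$ let $\mathcal{S}_a=\{p+\lfloor a^k\rfloor\mid p\in\mathcal{P},\ k\in\mathbb{N}\}$ and $$E_a(x)=\#\{n\in\mathbb{N}\mid n\le x,\ n\notin\mathcal{S}_a\}.$$ For almost every real number $a>1$ (with respect to Lebesgue measure) and every $\eta>0$, there exists $x_0=x_0(a,\eta)$ such that $$E_a(x)\ge x^{1-\eta}\qquad(x\ge x_0).$$ In particular, for every $\varepsilon>0$, for almost every $a\in(1,1+\varepsilon)$ there are infinitely many positive integers that cannot be written as $p+\lfloor a^m\rfloor$ with $p$ prime and $m\ge1$ an integer.
   Context: $\mathbb{N}=\{1,2,3,\ldots\}$; $\mathcal{P}$ is the set of primes; $\lfloor x\rfloor$ is the greatest integer not exceeding $x$. The set of full measure of bases $a$ does not depend on $\eta$. *)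

theory Defs
  imports "HOL-Analysis.Analysis" "HOL-Computational_Algebra.Primes"
begin

definition prime_plus_floor_power :: "real \<Rightarrow> int set" where
  "prime_plus_floor_power a = {int p + \<lfloor>a ^ k\<rfloor> | p k. prime p \<and> 1 \<le> k}"

text \<open>The positive integers outside that set which do not exceed a real bound; this set is
  finite, so \<open>card\<close> is its actual number of elements.\<close>

definition exceptional_count :: "real \<Rightarrow> real \<Rightarrow> nat" where
  "exceptional_count a x =
     card {n :: nat. 1 \<le> n \<and> real n \<le> x \<and> int n \<notin> prime_plus_floor_power a}"

end

theory Submission
  imports Defs "HOL-Number_Theory.Number_Theory" "HOL-Real_Asymp.Real_Asymp"
begin

text \<open>
  Call \<open>K\<close> covered if there are a set of primes with product \<open>M \<le> exp (\<eta> K)\<close> and a class \<open>c\<close> mod \<open>M\<close>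
  such that every \<open>c - \<lfloor>a^k\<rfloor>\<close> with \<open>k \<le> K\<close> is divisible by one of these primes.  Almost all
  \<open>n \<equiv> c (mod M)\<close> below \<open>a^K\<close> are then exceptional, so it suffices that for almost every \<open>a\<close> all large
  \<open>K = 2^i\<close> are covered; by Borel and Cantelli, it is enough that the measure of the bad \<open>a\<close> is
  \<open>O(K powr (-1/8))\<close>.

  The covering is of Erdos-Rankin type.  Putting \<open>c = 0\<close> modulo the primes up to a small power of \<open>K\<close>
  leaves a set of exponents of density \<open>V\<close> of order \<open>1 / ln K\<close>.  A prime \<open>q\<close> between \<open>sqrt K\<close> and \<open>K\<close>
  usually has classes that contain \<open>J\<close> of these survivors, for any constant \<open>J\<close>.  For every \<open>q\<close> a
  class is drawn with probability proportional to its number of \<open>J\<close>-tuples of survivors.  A second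
  moment estimate shows that nearly all survivors are hit by about the same expected number of
  primes, so \<open>\<epsilon> K / ln K\<close> primes remove all but \<open>\<epsilon> K / ln K\<close> survivors, and each of the remaining
  exponents gets a prime of its own.

  The moments are computable because \<open>\<lfloor>a^k\<rfloor>\<close> is equidistributed modulo \<open>M\<close> given all \<open>\<lfloor>a^i\<rfloor>\<close> with
  \<open>i \<le> \<kappa>\<close> once \<open>a^(k - \<kappa>)\<close> is large compared to \<open>M\<close>.  The sieve modulus \<open>P\<close> requires a gap of order
  \<open>sqrt K\<close>, a modulus polynomial in \<open>K\<close> only one of order \<open>ln K\<close>; for the few pairs at intermediate
  distance the sieve condition on the later element is dropped.
\<close>

section \<open>Prime numbers\<close>

text \<open>The budget \<open>exp (\<eta> * K)\<close> shapes the proof. One prime per exponent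
  would cost about \<open>exp (K * ln K)\<close>; the sieve leaves of order \<open>K / ln K\<close>
  exponents, whose own primes of size \<open>K\<close> would still cost \<open>exp (C * K)\<close>
  with a fixed \<open>C\<close>. A gain by an arbitrarily large constant is needed, and
  \<open>J\<close> provides it: with \<open>\<beta>\<close> survivors in each of \<open>J\<close>
  segments, a survivor is hit by about \<open>\<mu> = N / \<beta>\<close> of \<open>N\<close>
  primes, although there are \<open>J * \<beta>\<close> survivors to serve. So \<open>N\<close> may
  be a small multiple of \<open>J * \<beta>\<close> while \<open>\<mu>\<close> is large. The
  exponents are arranged so that moments factor. Within one residue class modulo \<open>L\<close>,
  of order \<open>ln K\<close>, two exponents are far enough apart for residues modulo the large
  primes; the \<open>L\<close> classes do not interact because each has its own primes. Gaps of
  length \<open>H\<close> between segments make the \<open>J\<close> factors of a tuple predictable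
  one after the other from the past, so products of \<open>J\<close> factors reduce to first and
  second moments in a single segment.\<close>

text \<open>Induction on \<open>P\<close>: splitting off the full power of the new prime maps
  \<open>S\<close> injectively into pairs of an exponent and a cofactor composed of the old primes,
  so the sum is at most a geometric series times a sum covered by the induction hypothesis.\<close>

lemma sum_inverse_le_euler_product:
  fixes P S :: "nat set"
  assumes "finite P" "finite S" "\<And>p. p \<in> P \<Longrightarrow> prime p"
    and "\<And>n. n \<in> S \<Longrightarrow> n > 0 \<and> prime_factors n \<subseteq> P"
  shows "(\<Sum>n\<in>S. 1 / real n) \<le> (\<Prod>p\<in>P. 1 / (1 - 1 / real p))"
  using assms
proof (induction P arbitrary: S rule: finite_induct)
  case empty
  have "S \<subseteq> {1}"
  proof
    fix n assume "n \<in> S"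
    with empty.prems(3)[of n] have "n > 0" "prime_factors n = {}" by auto
    thus "n \<in> {1}" by (auto simp: prime_factorization_empty_iff)
  qed
  hence "(\<Sum>n\<in>S. 1 / real n) \<le> (\<Sum>n\<in>{1::nat}. 1 / real n)"
    by (intro sum_mono2) auto
  thus ?case by simp
next
  case (insert p P)
  have p: "prime p" using insert.prems(2) by simp
  hence p1: "real p > 1" using prime_gt_1_nat by simp
  define d where "d n = (multiplicity p n, n div p ^ multiplicity p n)" for n :: nat
  have dec: "n = p ^ multiplicity p n * (n div p ^ multiplicity p n)" for n
    by (simp add: multiplicity_dvd)
  define S' where "S' = (\<lambda>n. n div p ^ multiplicity p n) ` S"
  define E where "E = Max (insert 0 (multiplicity p ` S))"
  have finS': "finite S'" unfolding S'_def using insert.prems by simp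
  have inj: "inj_on d S"
    by (intro inj_onI) (metis dec d_def prod.inject)
  have sub: "d ` S \<subseteq> {..E} \<times> S'"
    unfolding E_def S'_def d_def using insert.prems(1) by (auto intro!: Max_ge)
  have S'_prop: "n > 0 \<and> prime_factors n \<subseteq> P" if "n \<in> S'" for n
  proof -
    from that obtain m where m: "m \<in> S" and n: "n = m div p ^ multiplicity p m"
      unfolding S'_def by auto
    have mpos: "m > 0" and mp: "prime_factors m \<subseteq> insert p P" using insert.prems(3)[OF m] by auto
    have npos: "n > 0" using dec[of m] mpos n by (metis mult_0_right not_gr0)
    have "prime_factors n \<subseteq> prime_factors m"
      using dec[of m] mpos n by (intro dvd_prime_factors) (auto intro: dvdI[of _ _ "p ^ multiplicity p m"] simp: mult.commute)
    moreover have "\<not> p dvd n"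
      unfolding n using mpos p by (metis multiplicity_decompose not_prime_unit not_less_zero)
    hence "p \<notin> prime_factors n" by auto
    ultimately show ?thesis using npos mp by auto
  qed
  have "(\<Sum>n\<in>S. 1 / real n) = (\<Sum>(e, n)\<in>d ` S. 1 / real (p ^ e * n))"
  proof -
    have "1 / real n = (case d n of (e, n) \<Rightarrow> 1 / real (p ^ e * n))" for n
      using dec[of n] by (simp add: d_def flip: of_nat_power of_nat_mult)
    thus ?thesis using inj by (subst sum.reindex) (auto intro!: sum.cong)
  qed
  also have "\<dots> \<le> (\<Sum>(e, n)\<in>{..E} \<times> S'. 1 / real (p ^ e * n))"
    using sub finS' by (intro sum_mono2) auto
  also have "\<dots> = (\<Sum>e\<le>E. (1 / real p) ^ e) * (\<Sum>n\<in>S'. 1 / real n)"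
    by (simp add: sum.cartesian_product[symmetric] sum_product power_one_over)
  also have "\<dots> \<le> (1 / (1 - 1 / real p)) * (\<Prod>p\<in>P. 1 / (1 - 1 / real p))"
  proof (intro mult_mono)
    have "(\<Sum>e\<le>E. (1 / real p) ^ e) = (\<Sum>e<Suc E. (1 / real p) ^ e)"
      by (simp add: lessThan_Suc_atMost)
    also have "\<dots> \<le> (\<Sum>e. (1 / real p) ^ e)"
      using p1 by (intro sum_le_suminf summable_geometric) auto
    also have "\<dots> = 1 / (1 - 1 / real p)" using p1 by (intro suminf_geometric) auto
    finally show "(\<Sum>e\<le>E. (1 / real p) ^ e) \<le> 1 / (1 - 1 / real p)" .
    show "(\<Sum>n\<in>S'. 1 / real n) \<le> (\<Prod>p\<in>P. 1 / (1 - 1 / real p))"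
      using finS' S'_prop insert.prems(2) by (intro insert.IH) auto
  qed (use p1 in \<open>auto intro!: sum_nonneg\<close>)
  finally show ?case using insert.hyps by simp
qed

text \<open>The elementary half of Mertens' theorem: every \<open>n \<le> y\<close> has only prime
  factors up to \<open>y\<close>, so the Euler product dominates the harmonic sum.\<close>

lemma prod_primes_le_inverse_ln:
  assumes "y \<ge> 1"
  shows "(\<Prod>p | prime p \<and> p \<le> y. 1 - 1 / real p) \<le> 1 / ln (real y + 1)"
proof -
  let ?P = "{p. prime p \<and> p \<le> (y::nat)}"
  have fin: "finite ?P" by simp
  have pos: "1 - 1 / real p > 0" if "p \<in> ?P" for p
    using that prime_gt_1_nat[of p] by simp
  have "ln (real y + 1) \<le> (\<Sum>n\<in>{1..y}. 1 / real n)"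
    using ln_le_harm[of y] by (simp add: harm_def inverse_eq_divide)
  also have "\<dots> \<le> (\<Prod>p\<in>?P. 1 / (1 - 1 / real p))"
  proof (intro sum_inverse_le_euler_product)
    fix n assume n: "n \<in> {1..y}"
    thus "n > 0 \<and> prime_factors n \<subseteq> ?P"
      by (auto simp: prime_factors_dvd dest: dvd_imp_le)
  qed auto
  also have "\<dots> = 1 / (\<Prod>p\<in>?P. 1 - 1 / real p)" by (simp add: prod_dividef)
  finally show ?thesis using prod_pos[OF pos, of ?P] assms
    by (simp add: field_simps)
qed

text \<open>Takes the place of a lower bound of Mertens type: primes are multiplied in one at a time
  until the product first drops to \<open>v\<close>; a single factor is at least 1/2, so the product
  cannot fall below \<open>v / 2\<close>.\<close>

lemma ex_prime_set_sieve_density: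
  fixes v :: real
  assumes "0 < v" "v \<le> 1" "y \<ge> 1" "1 \<le> v * ln (real y + 1)"
  obtains P :: "nat set" where "finite P" "\<And>p. p \<in> P \<Longrightarrow> prime p \<and> p \<le> y"
    "v / 2 \<le> (\<Prod>p\<in>P. 1 - 1 / real p)" "(\<Prod>p\<in>P. 1 - 1 / real p) \<le> v"
proof -
  define V where "V n = (\<Prod>p | prime p \<and> p \<le> n. 1 - 1 / real p)" for n :: nat
  have lny: "ln (real y + 1) > 0" using assms by simp
  have Vy: "V y \<le> v"
    using prod_primes_le_inverse_ln[OF assms(3)] assms(4) lny unfolding V_def
    by (smt (verit, best) divide_le_eq)
  define n where "n = (LEAST n. V n \<le> v)"
  have n: "V n \<le> v" "n \<le> y" unfolding n_def using Vy by (auto intro: LeastI Least_le)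
  have "v / 2 \<le> V n"
  proof (cases n)
    case 0
    have "{p. prime p \<and> p \<le> (0::nat)} = {}" using not_prime_0 by auto
    hence "V n = 1" unfolding V_def 0 by simp
    with assms show ?thesis by simp
  next
    case (Suc k)
    have k: "V k > v" using not_less_Least[of k "\<lambda>n. V n \<le> v"] Suc n_def by force
    show ?thesis
    proof (cases "prime n")
      case True
      have "{p. prime p \<and> p \<le> n} = insert n {p. prime p \<and> p \<le> k}"
        using Suc True by (auto simp: le_Suc_eq)
      hence "V n = (1 - 1 / real n) * V k" unfolding V_def using Suc by simp
      moreover have "1 - 1 / real n \<ge> 1 / 2" using prime_ge_2_nat[OF True] by simp
      ultimately show ?thesis using k assms(1) mult_mono[of "1/2" "1 - 1/real n" v "V k"] by simp
    next
      case False
      have "{p. prime p \<and> p \<le> n} = {p. prime p \<and> p \<le> k}"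
        using Suc False by (auto simp: le_Suc_eq)
      hence "V n = V k" unfolding V_def by simp
      with k assms show ?thesis by simp
    qed
  qed
  with n show ?thesis by (intro that[of "{p. prime p \<and> p \<le> n}"]) (auto simp: V_def)
qed

text \<open>Leibniz' harmonic triangle: \<open>1 / (k * (n choose k))\<close> is the difference of two neighbouring entries
  with smaller \<open>k\<close>.\<close>

lemma mult_choose_dvd:
  fixes D :: nat
  assumes D: "\<And>i. 1 \<le> i \<Longrightarrow> i \<le> N \<Longrightarrow> i dvd D"
  shows "1 \<le> k \<Longrightarrow> k \<le> n \<Longrightarrow> n \<le> N \<Longrightarrow> real D / (real k * real (n choose k)) \<in> \<int>"
proof (induction k arbitrary: n)
  case (Suc k)
  show ?case
  proof (cases "k = 0")
    case True
    have "n dvd D" using Suc.prems True by (intro D) auto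
    then obtain c where "D = n * c" by auto
    thus ?thesis using True Suc.prems by simp
  next
    case False
    define n' where "n' = n - 1"
    have n: "n = Suc n'" and kn: "k \<le> n'" "1 \<le> k" using Suc.prems False by (auto simp: n'_def)
    have e1: "real D / (real k * real (n' choose k)) \<in> \<int>"
      using Suc.prems kn n by (intro Suc.IH) auto
    have e2: "real D / (real k * real (n choose k)) \<in> \<int>"
      using Suc.prems kn n by (intro Suc.IH) auto
    have c1: "real (Suc k) * real (Suc n' choose Suc k) = real (Suc n') * real (n' choose k)"
      by (metis Suc_times_binomial_eq of_nat_mult mult.commute)
    have c2: "(real (Suc n') - real k) * real (Suc n' choose k) = real (Suc n') * real (n' choose k)"
      using binomial_absorb_comp[of "Suc n'" k] kn
      by (metis Suc_diff_1 diff_Suc_1 le_SucI of_nat_diff of_nat_mult)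
    have pos: "real (n' choose k) > 0" "real (Suc n' choose k) > 0" using kn by auto
    have d: "real (Suc n') - real k > 0" using kn by simp
    have "real (Suc n' choose k) = real (Suc n') * real (n' choose k) / (real (Suc n') - real k)"
      using c2 d by (simp add: field_simps)
    hence "real D / (real (Suc k) * real (n choose Suc k)) =
          real D / (real k * real (n' choose k)) - real D / (real k * real (n choose k))"
      unfolding n c1 using pos d kn by (simp add: divide_simps) (simp add: algebra_simps)
    thus ?thesis using e1 e2 by simp
  qed
qed simp

section \<open>Chebyshev's lower bound for the number of primes\<close>

text \<open>Nair's argument: \<open>D\<close> is the least common multiple of \<open>1..n\<close>,
  and each prime power in it is at most \<open>n\<close>. By the harmonic triangle
  \<open>k * (n choose k)\<close> divides \<open>D\<close>.\<close>

lemma choose_le_power_prime_count: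
  assumes "1 \<le> k" "k \<le> n"
  shows "n choose k \<le> n ^ card {p. prime p \<and> p \<le> n}"
proof -
  let ?P = "{p. prime p \<and> p \<le> n}"
  define e where "e p = Max {e. p ^ e \<le> n}" for p
  define D where "D = (\<Prod>p\<in>?P. p ^ e p)"
  have n0: "n > 0" using assms by simp
  have fin: "finite {e. p ^ e \<le> n}" if "prime p" for p
  proof (rule finite_subset)
    show "{e. p ^ e \<le> n} \<subseteq> {..n}"
    proof
      fix e assume "e \<in> {e. p ^ e \<le> n}"
      thus "e \<in> {..n}" using power_gt_expt[of p e] prime_gt_1_nat[OF that] by simp
    qed
  qed simp
  have le: "p ^ e p \<le> n" if "prime p" for p
  proof -
    have "0 \<in> {e. p ^ e \<le> n}" using n0 by simp
    thus ?thesis using Max_in[OF fin[OF that]] unfolding e_def by blast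
  qed
  have dvd: "i dvd D" if i: "1 \<le> i" "i \<le> n" for i
  proof -
    have sub: "prime_factors i \<subseteq> ?P" using i by (auto simp: prime_factors_dvd dest: dvd_imp_le)
    have "i = (\<Prod>p\<in>prime_factors i. p ^ multiplicity p i)"
      using i by (simp add: prime_factorization_nat)
    also have "\<dots> dvd (\<Prod>p\<in>prime_factors i. p ^ e p)"
    proof (intro prod_dvd_prod le_imp_power_dvd)
      fix p assume p: "p \<in> prime_factors i"
      have "p ^ multiplicity p i \<le> i" using i by (intro dvd_imp_le multiplicity_dvd) auto
      thus "multiplicity p i \<le> e p" unfolding e_def using p i fin[of p]
        by (intro Max_ge) auto
    qed
    also have "\<dots> dvd D" unfolding D_def using sub by (intro prod_dvd_prod_subset) auto
    finally show ?thesis .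
  qed
  have D0: "D > 0" unfolding D_def by (auto intro!: prod_pos dest: prime_gt_0_nat)
  have "real D / (real k * real (n choose k)) \<in> \<int>"
    using assms dvd by (intro mult_choose_dvd[of n]) auto
  then obtain z where z: "real D / (real k * real (n choose k)) = of_int z" by (auto elim: Ints_cases)
  have kc: "real k * real (n choose k) > 0" using assms by simp
  hence "of_int z > (0::real)" using z D0 by (metis divide_pos_pos of_nat_0_less_iff)
  hence "z \<ge> 1" by simp
  hence "of_int z \<ge> (1::real)" by simp
  hence "real k * real (n choose k) \<le> real D" using z kc by (metis le_divide_eq_1_pos)
  moreover have "real (n choose k) \<le> real k * real (n choose k)" using assms by (simp add: mult_le_cancel_right1)
  ultimately have "n choose k \<le> D" by linarith
  also have "D \<le> (\<Prod>p\<in>?P. n)" unfolding D_def using le by (intro prod_mono) auto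
  finally show ?thesis by simp
qed

text \<open>The \<open>+ 1\<close> absorbs the denominator of the bound
  \<open>4 ^ n / (2 * n)\<close> for the central binomial coefficient.\<close>

lemma chebyshev_lower:
  assumes "n \<ge> 1"
  shows "real n * ln 4 \<le> (real (card {p. prime p \<and> p \<le> 2 * n}) + 1) * ln (2 * real n)"
proof -
  let ?c = "card {p. prime p \<and> p \<le> 2 * n}"
  have "4 ^ n / (2 * real n) \<le> real (2 * n choose n)"
    using assms by (intro central_binomial_lower_bound) auto
  also have "\<dots> \<le> real ((2 * n) ^ ?c)"
    using assms by (intro of_nat_mono choose_le_power_prime_count) auto
  finally have "4 ^ n \<le> (2 * real n) ^ (?c + 1)" using assms by (simp add: field_simps)
  hence "ln (4 ^ n) \<le> ln ((2 * real n) ^ (?c + 1))" using assms by (subst ln_le_cancel_iff) auto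
  also have "ln ((2 * real n) ^ (?c + 1)) = (real ?c + 1) * ln (2 * real n)"
    using assms by (subst ln_realpow) auto
  finally show ?thesis by (simp add: ln_realpow)
qed

text \<open>This crude bound is enough, as \<open>y\<close> will be about
  \<open>K powr (1/4)\<close> and the sieve modulus only has to stay below
  \<open>exp (sqrt K)\<close>.\<close>

lemma prod_primes_le_power:
  fixes P :: "nat set"
  assumes "\<And>p. p \<in> P \<Longrightarrow> prime p \<and> p \<le> y" "y \<ge> 1"
  shows "real (\<Prod>P) \<le> real y ^ y"
proof -
  have "real (\<Prod>P) = (\<Prod>p\<in>P. real p)" by simp
  also have "\<dots> \<le> (\<Prod>p\<in>P. real y)" using assms by (intro prod_mono) auto
  also have "\<dots> = real y ^ card P" by simp
  also have "\<dots> \<le> real y ^ y"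
  proof (intro power_increasing)
    have "P \<subseteq> {1..y}" using assms prime_ge_1_nat by auto
    thus "card P \<le> y" using card_mono[of "{1..y}" P] by simp
  qed (use assms in auto)
  finally show ?thesis .
qed

text \<open>Leaving out the primes up to \<open>sqrt K\<close> keeps the others disjoint from the
  sieve primes and large against the variance terms (\<open>Dq1\<close> below).\<close>

lemma card_primes_above_sqrt:
  assumes "even K" "K \<ge> 2"
  shows "real K * ln 2 / ln (real K) - 1 - sqrt (real K)
    \<le> real (card {p. prime p \<and> p \<le> K \<and> \<not> real p \<le> sqrt (real K)})"
proof -
  let ?\<pi> = "card {p. prime p \<and> p \<le> K}" and ?S = "{p. prime p \<and> p \<le> K \<and> \<not> real p \<le> sqrt (real K)}"
  have lnK: "ln (real K) > 0" using assms by simp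
  have "K div 2 \<ge> 1" using assms by auto
  hence "real (K div 2) * ln 4 \<le> (real (card {p. prime p \<and> p \<le> 2 * (K div 2)}) + 1) * ln (2 * real (K div 2))"
    by (rule chebyshev_lower)
  moreover have "2 * (K div 2) = K" "2 * real (K div 2) = real K" using assms by (auto simp: real_of_nat_div)
  moreover have "ln (4::real) = 2 * ln 2" using ln_realpow[of 2 2] by simp
  moreover have "real (K div 2) * (2 * ln 2) = (2 * real (K div 2)) * ln 2" by simp
  ultimately have "real K * ln 2 \<le> (real ?\<pi> + 1) * ln (real K)" by metis
  hence "real K * ln 2 / ln (real K) \<le> real ?\<pi> + 1" using lnK by (simp add: divide_le_eq)
  moreover have "real ?\<pi> \<le> real (card ?S) + sqrt (real K)"
  proof -
    have "?\<pi> \<le> card (?S \<union> {1..nat \<lfloor>sqrt (real K)\<rfloor>})"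
    proof (intro card_mono subsetI)
      fix p assume p: "p \<in> {p. prime p \<and> p \<le> K}"
      hence "p \<ge> 1" using prime_ge_1_nat by auto
      thus "p \<in> ?S \<union> {1..nat \<lfloor>sqrt (real K)\<rfloor>}" using p by (auto intro: le_nat_floor)
    qed auto
    also have "\<dots> \<le> card ?S + card {1..nat \<lfloor>sqrt (real K)\<rfloor>}" by (rule card_Un_le)
    finally have "?\<pi> \<le> card ?S + nat \<lfloor>sqrt (real K)\<rfloor>" by simp
    hence "real ?\<pi> \<le> real (card ?S) + real (nat \<lfloor>sqrt (real K)\<rfloor>)"
      by (simp only: of_nat_add[symmetric] of_nat_le_iff)
    moreover have "real (nat \<lfloor>sqrt (real K)\<rfloor>) \<le> sqrt (real K)" by simp
    ultimately show ?thesis by linarith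
  qed
  ultimately show ?thesis by linarith
qed

text \<open>Supplies a separate set of primes for each of the \<open>L\<close> residue classes of
  exponents, and a reserve \<open>R\<close> for the exponents left over.\<close>

lemma ex_disjoint_subsets:
  fixes S :: "'a set" and L N s :: nat
  assumes "finite S" "L * N + s \<le> card S"
  obtains Q R where "\<And>r. r < L \<Longrightarrow> Q r \<subseteq> S \<and> card (Q r) = N"
    "\<And>r r'. r < L \<Longrightarrow> r' < L \<Longrightarrow> r \<noteq> r' \<Longrightarrow> Q r \<inter> Q r' = {}"
    "R \<subseteq> S" "card R = s" "(\<Union>r<L. Q r) \<inter> R = {}" "card ((\<Union>r<L. Q r) \<union> R) \<le> L * N + s"
proof -
  obtain f where f: "bij_betw f {0..<card S} S" using ex_bij_betw_nat_finite[OF assms(1)] by blast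
  have inj: "inj_on f {..<L * N + s}"
    using assms by (intro inj_on_subset[OF bij_betw_imp_inj_on[OF f]]) auto
  have f_in: "f i \<in> S" if "i < L * N + s" for i using f that assms by (auto simp: bij_betw_def)
  define Q where "Q r = f ` {r * N..<r * N + N}" for r
  define R where "R = f ` {L * N..<L * N + s}"
  have rN: "r * N + N \<le> L * N" if "r < L" for r
    using that by (metis Suc_leI mult_Suc mult_le_mono1 add.commute)
  have Q_sub: "(\<Union>r<L. Q r) \<subseteq> f ` {..<L * N}" unfolding Q_def using rN by fastforce
  have 1: "Q r \<subseteq> S \<and> card (Q r) = N" if "r < L" for r
  proof
    show "Q r \<subseteq> S" using that Q_sub f_in by force
    show "card (Q r) = N"
      unfolding Q_def using rN[OF that] by (subst card_image[OF inj_on_subset[OF inj]]) auto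
  qed
  have 2: "Q r \<inter> Q r' = {}" if "r < L" "r' < L" "r \<noteq> r'" for r r'
  proof -
    have "r * N + N \<le> r' * N \<or> r' * N + N \<le> r * N"
      using that(3) by (metis Suc_leI linorder_neqE_nat mult_Suc mult_le_mono1 add.commute)
    hence "{r * N..<r * N + N} \<inter> {r' * N..<r' * N + N} = {}" by auto
    thus ?thesis unfolding Q_def using rN that
      by (subst inj_on_image_Int[OF inj, symmetric]) (auto dest: rN)
  qed
  have 3: "R \<subseteq> S" using f_in by (auto simp: R_def)
  have 4: "card R = s" unfolding R_def by (subst card_image[OF inj_on_subset[OF inj]]) auto
  have 5: "(\<Union>r<L. Q r) \<inter> R = {}"
  proof -
    have "f ` {..<L * N} \<inter> R = f ` ({..<L * N} \<inter> {L * N..<L * N + s})"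
      unfolding R_def by (rule inj_on_image_Int[OF inj, symmetric]) auto
    moreover have "{..<L * N} \<inter> {L * N..<L * N + s} = {}" by auto
    ultimately have "f ` {..<L * N} \<inter> R = {}" by simp
    thus ?thesis using Q_sub by blast
  qed
  have "(\<Union>r<L. Q r) \<union> R \<subseteq> f ` {..<L * N + s}" using Q_sub by (force simp: R_def)
  hence "card ((\<Union>r<L. Q r) \<union> R) \<le> card (f ` {..<L * N + s})" by (intro card_mono) auto
  also have "\<dots> \<le> L * N + s" using card_image_le[of "{..<L * N + s}" f] by simp
  finally show ?thesis using that[OF 1 2 3 4 5] by blast
qed

section \<open>Residue conditions and choice of classes\<close>

lemma card_residue_conditions:
  fixes a b :: nat
  assumes "coprime a b" "a > 0" "b > 0"
  shows "card {x. x < a * b \<and> S (x mod a) \<and> S' (x mod b)} =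
         card {x. x < a \<and> S x} * card {x. x < b \<and> S' x}"
proof -
  have "bij_betw (\<lambda>x. (x mod a, x mod b)) {x. x < a * b \<and> S (x mod a) \<and> S' (x mod b)}
          ({x. x < a \<and> S x} \<times> {x. x < b \<and> S' x})"
  proof (rule bij_betwI')
    fix x y assume x: "x \<in> {x. x < a * b \<and> S (x mod a) \<and> S' (x mod b)}"
      and y: "y \<in> {x. x < a * b \<and> S (x mod a) \<and> S' (x mod b)}"
    have "x = y" if "x mod a = y mod a" "x mod b = y mod b"
    proof -
      have "[x = y] (mod a * b)"
        using that assms(1) by (intro coprime_cong_mult_nat) (auto simp: cong_def)
      thus ?thesis using x y by (simp add: cong_def)
    qed
    thus "((x mod a, x mod b) = (y mod a, y mod b)) = (x = y)" by auto
  next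
    fix x assume "x \<in> {x. x < a * b \<and> S (x mod a) \<and> S' (x mod b)}"
    thus "(x mod a, x mod b) \<in> {x. x < a \<and> S x} \<times> {x. x < b \<and> S' x}"
      using assms by auto
  next
    fix z assume z: "z \<in> {x. x < a \<and> S x} \<times> {x. x < b \<and> S' x}"
    obtain u u' where uu: "z = (u, u')" by (cases z)
    obtain x where x: "[x = u] (mod a)" "[x = u'] (mod b)"
      using binary_chinese_remainder_nat[OF assms(1)] by blast
    define y where "y = x mod (a * b)"
    have "y < a * b" using assms by (simp add: y_def)
    moreover have "y mod a = u" "y mod b = u'"
      using x z uu by (auto simp: y_def cong_def mod_mult_right_eq mod_mod_cancel)
    ultimately show "\<exists>x\<in>{x. x < a * b \<and> S (x mod a) \<and> S' (x mod b)}. z = (x mod a, x mod b)"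
      using z uu by (intro bexI[of _ y]) auto
  qed
  thus ?thesis by (simp add: bij_betw_same_card card_cartesian_product)
qed

section \<open>Random choice of classes, derandomized\<close>

text \<open>First moment method: the class of largest weight does at least as well as one drawn from
  \<open>\<pi>\<close>. A total mass below 1 is harmless because hit weights are
  nonnegative.\<close>

lemma ex_class_weighted:
  fixes u :: "'i \<Rightarrow> real" and \<pi> :: "nat \<Rightarrow> real"
  assumes "finite I" "\<And>k. k \<in> I \<Longrightarrow> 0 \<le> u k" "q > 0"
    and "\<And>k. k \<in> I \<Longrightarrow> x k < q"
    and "\<And>b. b < q \<Longrightarrow> 0 \<le> \<pi> b" "(\<Sum>b<q. \<pi> b) \<le> 1"
  shows "\<exists>b<q. (\<Sum>k\<in>I. u k * of_bool (x k \<noteq> b)) \<le> (\<Sum>k\<in>I. u k * (1 - \<pi> (x k)))"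
proof -
  define s where "s b = (\<Sum>k\<in>I. u k * of_bool (x k = b))" for b
  have s0: "s b \<ge> 0" for b unfolding s_def using assms by (intro sum_nonneg) auto
  have "Max (s ` {..<q}) \<in> s ` {..<q}" using assms(3) by (intro Max_in) auto
  then obtain b where b: "b < q" "s b = Max (s ` {..<q})" by auto
  have max: "s c \<le> s b" if "c < q" for c unfolding b(2) using that by (intro Max_ge) auto
  have "(\<Sum>k\<in>I. u k * \<pi> (x k)) = (\<Sum>k\<in>I. \<Sum>c<q. \<pi> c * (u k * of_bool (x k = c)))"
  proof (intro sum.cong refl)
    fix k assume k: "k \<in> I"
    have "(\<Sum>c<q. \<pi> c * (u k * of_bool (x k = c))) = (\<Sum>c<q. if c = x k then \<pi> c * u k else 0)"
      by (intro sum.cong) auto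
    also have "\<dots> = u k * \<pi> (x k)" using assms(4)[OF k] by (subst sum.delta) auto
    finally show "u k * \<pi> (x k) = (\<Sum>c<q. \<pi> c * (u k * of_bool (x k = c)))" by simp
  qed
  also have "\<dots> = (\<Sum>c<q. \<pi> c * s c)"
    unfolding s_def by (subst sum.swap) (simp add: sum_distrib_left)
  also have "\<dots> \<le> (\<Sum>c<q. \<pi> c * s b)" using max assms by (intro sum_mono mult_left_mono) auto
  also have "\<dots> = (\<Sum>c<q. \<pi> c) * s b" by (simp add: sum_distrib_right)
  also have "\<dots> \<le> s b" using mult_right_mono[OF assms(6) s0[of b]] by simp
  finally have *: "(\<Sum>k\<in>I. u k * \<pi> (x k)) \<le> s b" .
  have "(\<Sum>k\<in>I. u k * of_bool (x k \<noteq> b)) = (\<Sum>k\<in>I. u k - u k * of_bool (x k = b))"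
    by (intro sum.cong) auto
  also have "\<dots> = (\<Sum>k\<in>I. u k) - s b" unfolding s_def by (simp add: sum_subtractf)
  also have "\<dots> \<le> (\<Sum>k\<in>I. u k) - (\<Sum>k\<in>I. u k * \<pi> (x k))" using * by simp
  also have "\<dots> = (\<Sum>k\<in>I. u k * (1 - \<pi> (x k)))" by (simp add: sum_subtractf algebra_simps)
  finally show ?thesis using b by blast
qed

text \<open>Independent draws for all \<open>q \<in> Q\<close>, derandomized one prime at a time:
  the classes for the old primes are fixed with the factor of the new \<open>q\<close> still in the
  weight, then the class for \<open>q\<close> is chosen with regard to the elements not yet
  hit.\<close>

lemma ex_classes_weighted:
  fixes u :: "'i \<Rightarrow> real" and \<pi> :: "nat \<Rightarrow> nat \<Rightarrow> real" and x :: "'i \<Rightarrow> nat"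
  assumes "finite Q" "finite I" "\<And>k. k \<in> I \<Longrightarrow> 0 \<le> u k" "\<And>q. q \<in> Q \<Longrightarrow> q > 0"
    and "\<And>q b. q \<in> Q \<Longrightarrow> b < q \<Longrightarrow> 0 \<le> \<pi> q b" "\<And>q. q \<in> Q \<Longrightarrow> (\<Sum>b<q. \<pi> q b) \<le> 1"
  shows "\<exists>b. (\<Sum>k\<in>I. u k * of_bool (\<forall>q\<in>Q. x k mod q \<noteq> b q)) \<le>
             (\<Sum>k\<in>I. u k * (\<Prod>q\<in>Q. 1 - \<pi> q (x k mod q)))"
  using assms
proof (induction Q arbitrary: u rule: finite_induct)
  case (insert q Q)
  have le1: "\<pi> q b \<le> 1" if "b < q" for b
  proof -
    have "\<pi> q b = (\<Sum>c\<in>{b}. \<pi> q c)" by simp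
    also have "\<dots> \<le> (\<Sum>c<q. \<pi> q c)" using that insert.prems by (intro sum_mono2) auto
    also have "\<dots> \<le> 1" using insert.prems by auto
    finally show ?thesis .
  qed
  have q0: "q > 0" using insert.prems by auto
  have le1': "0 \<le> 1 - \<pi> q (x k mod q)" for k using le1[of "x k mod q"] q0 by simp
  obtain b where b: "(\<Sum>k\<in>I. (u k * (1 - \<pi> q (x k mod q))) * of_bool (\<forall>q\<in>Q. x k mod q \<noteq> b q)) \<le>
             (\<Sum>k\<in>I. (u k * (1 - \<pi> q (x k mod q))) * (\<Prod>q\<in>Q. 1 - \<pi> q (x k mod q)))"
    using insert.IH[of "\<lambda>k. u k * (1 - \<pi> q (x k mod q))"] insert.prems le1' by auto
  have "\<exists>c<q. (\<Sum>k\<in>I. (u k * of_bool (\<forall>q\<in>Q. x k mod q \<noteq> b q)) * of_bool (x k mod q \<noteq> c)) \<le>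
       (\<Sum>k\<in>I. (u k * of_bool (\<forall>q\<in>Q. x k mod q \<noteq> b q)) * (1 - \<pi> q (x k mod q)))"
    using insert.prems q0 by (intro ex_class_weighted) auto
  then obtain c where c: "(\<Sum>k\<in>I. (u k * of_bool (\<forall>q\<in>Q. x k mod q \<noteq> b q)) * of_bool (x k mod q \<noteq> c)) \<le>
       (\<Sum>k\<in>I. (u k * of_bool (\<forall>q\<in>Q. x k mod q \<noteq> b q)) * (1 - \<pi> q (x k mod q)))" by blast
  have "(\<Sum>k\<in>I. u k * of_bool (\<forall>p\<in>insert q Q. x k mod p \<noteq> (b(q := c)) p)) =
        (\<Sum>k\<in>I. (u k * of_bool (\<forall>q\<in>Q. x k mod q \<noteq> b q)) * of_bool (x k mod q \<noteq> c))"
    using insert.hyps by (intro sum.cong) (auto simp: of_bool_def)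
  also note c
  also have "(\<Sum>k\<in>I. (u k * of_bool (\<forall>q\<in>Q. x k mod q \<noteq> b q)) * (1 - \<pi> q (x k mod q))) =
     (\<Sum>k\<in>I. (u k * (1 - \<pi> q (x k mod q))) * of_bool (\<forall>q\<in>Q. x k mod q \<noteq> b q))"
    by (simp add: mult_ac)
  also note b
  also have "(\<Sum>k\<in>I. (u k * (1 - \<pi> q (x k mod q))) * (\<Prod>q\<in>Q. 1 - \<pi> q (x k mod q))) =
       (\<Sum>k\<in>I. u k * (\<Prod>q\<in>insert q Q. 1 - \<pi> q (x k mod q)))"
    using insert.hyps by (simp add: mult_ac)
  finally show ?case by blast
qed auto

section \<open>Second moments\<close>

lemma sum_near_le:
  assumes "i < (m::nat)"
  shows "(\<Sum>i'<m. of_bool (i' < i + H \<and> i < i' + H)) \<le> 2 * real H"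
proof -
  have "(\<Sum>i'<m. of_bool (i' < i + H \<and> i < i' + H)) = real (card {i'. i' < m \<and> i' < i + H \<and> i < i' + H})"
    by (simp add: of_bool_def sum.If_cases Int_def)
  also have "card {i'. i' < m \<and> i' < i + H \<and> i < i' + H} \<le> card {i - H..<i + H}"
    by (intro card_mono) auto
  also have "real (card {i - H..<i + H}) \<le> 2 * real H" by simp
  finally show ?thesis by simp
qed

text \<open>If \<open>s < \<mu> / 4\<close>, then either \<open>\<Delta> \<ge> \<mu> / 8\<close> or
  \<open>\<phi>\<close> misses \<open>\<mu>\<close> by at least \<open>\<mu> / 4\<close>, and one of
  the last two terms alone is at least 1. In this form the probability of escaping can be averaged
  by means of second moments.\<close>

lemma exp_minus_le_quadratic:
  fixes s \<phi> \<mu> \<Delta> :: real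
  assumes "\<mu> > 0" "0 \<le> s" "\<phi> / 2 - \<Delta> \<le> s" "0 \<le> \<Delta>"
  shows "exp (- s) \<le> exp (- \<mu> / 4) + 16 / \<mu>\<^sup>2 * (\<phi> - \<mu>)\<^sup>2 + 8 / \<mu> * \<Delta>"
proof (cases "s \<ge> \<mu> / 4")
  case True
  hence "exp (- s) \<le> exp (- \<mu> / 4)" by simp
  moreover have "0 \<le> 16 / \<mu>\<^sup>2 * (\<phi> - \<mu>)\<^sup>2" "0 \<le> 8 / \<mu> * \<Delta>" using assms by auto
  ultimately show ?thesis by linarith
next
  case False
  have e1: "exp (- s) \<le> 1" "0 \<le> exp (- \<mu> / 4)" using assms by auto
  have nn: "0 \<le> 16 / \<mu>\<^sup>2 * (\<phi> - \<mu>)\<^sup>2" "0 \<le> 8 / \<mu> * \<Delta>" using assms by auto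
  show ?thesis
  proof (cases "\<Delta> \<ge> \<mu> / 8")
    case True
    hence "1 \<le> 8 / \<mu> * \<Delta>" using assms by (simp add: field_simps)
    thus ?thesis using e1 nn by linarith
  next
    case F2: False
    hence "\<phi> \<le> 3 * \<mu> / 4" using False assms by linarith
    hence "(\<mu> / 4)\<^sup>2 \<le> (\<mu> - \<phi>)\<^sup>2" using assms by (intro power_mono) auto
    hence "\<mu>\<^sup>2 \<le> 16 * (\<phi> - \<mu>)\<^sup>2" by (simp add: power_divide power2_commute)
    hence "1 \<le> 16 / \<mu>\<^sup>2 * (\<phi> - \<mu>)\<^sup>2" using assms by (simp add: field_simps)
    thus ?thesis using e1 nn by linarith
  qed
qed

text \<open>A finite probability space of cells \<open>v\<close> with \<open>X k v\<close> in the role of \<open>\<lfloor>a^k\<rfloor>\<close> for \<open>k \<le> T\<close>.  The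
  residue of \<open>X k\<close> is nearly uniform given the past up to \<open>\<kappa>\<close>, for moduli up to \<open>P * B\<close> after a gap of
  \<open>H\<close> and for moduli up to \<open>B\<close> already after a gap of \<open>L\<close>.\<close>

locale fresh_space =
  fixes \<Omega> :: "'a set" and w :: "'a \<Rightarrow> real" and X :: "nat \<Rightarrow> 'a \<Rightarrow> nat"
    and T H L P B :: nat and \<theta> :: real
  assumes finite_Omega: "finite \<Omega>"
    and w_nonneg: "v \<in> \<Omega> \<Longrightarrow> 0 \<le> w v"
    and w_sum: "(\<Sum>v\<in>\<Omega>. w v) = 1"
    and theta_nonneg: "0 \<le> \<theta>" and P_pos: "P > 0" and L_pos: "L > 0"
    and far: "\<lbrakk>\<kappa> + H \<le> k; k \<le> T;
        \<And>u v. u \<in> \<Omega> \<Longrightarrow> v \<in> \<Omega> \<Longrightarrow> (\<And>i. i \<le> \<kappa> \<Longrightarrow> X i u = X i v) \<Longrightarrow> g u = g v;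
        \<And>v. v \<in> \<Omega> \<Longrightarrow> 0 \<le> g v \<and> g v \<le> G; 0 < M; M \<le> P * B; R \<subseteq> {..<M}\<rbrakk> \<Longrightarrow>
      \<bar>(\<Sum>v\<in>\<Omega>. w v * (g v * of_bool (X k v mod M \<in> R))) -
        real (card R) / real M * (\<Sum>v\<in>\<Omega>. w v * g v)\<bar> \<le> G * \<theta>"
    and near: "\<lbrakk>\<kappa> + L \<le> k; k \<le> T;
        \<And>u v. u \<in> \<Omega> \<Longrightarrow> v \<in> \<Omega> \<Longrightarrow> (\<And>i. i \<le> \<kappa> \<Longrightarrow> X i u = X i v) \<Longrightarrow> g u = g v;
        \<And>v. v \<in> \<Omega> \<Longrightarrow> 0 \<le> g v \<and> g v \<le> G; 0 < M; M \<le> B; R \<subseteq> {..<M}\<rbrakk> \<Longrightarrow>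
      \<bar>(\<Sum>v\<in>\<Omega>. w v * (g v * of_bool (X k v mod M \<in> R))) -
        real (card R) / real M * (\<Sum>v\<in>\<Omega>. w v * g v)\<bar> \<le> G * \<theta>"
begin

section \<open>Expectation and conditioning on the past\<close>

definition E :: "('a \<Rightarrow> real) \<Rightarrow> real" where "E g = (\<Sum>v\<in>\<Omega>. w v * g v)"

text \<open>Measurability with respect to the values \<open>X i\<close> with
  \<open>i \<le> \<kappa>\<close>; as \<open>\<Omega>\<close> is finite, no sigma-algebra is needed
  to express it.\<close>

definition past :: "nat \<Rightarrow> ('a \<Rightarrow> real) \<Rightarrow> bool" where
  "past \<kappa> g \<longleftrightarrow> (\<forall>u\<in>\<Omega>. \<forall>v\<in>\<Omega>. (\<forall>i\<le>\<kappa>. X i u = X i v) \<longrightarrow> g u = g v)"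

definition bd :: "real \<Rightarrow> ('a \<Rightarrow> real) \<Rightarrow> bool" where
  "bd G g \<longleftrightarrow> (\<forall>v\<in>\<Omega>. 0 \<le> g v \<and> g v \<le> G)"

lemma E_add: "E (\<lambda>v. f v + g v) = E f + E g"
  and E_diff: "E (\<lambda>v. f v - g v) = E f - E g"
  and E_cmult: "E (\<lambda>v. c * f v) = c * E f"
  and E_sum: "E (\<lambda>v. \<Sum>i\<in>A. F i v) = (\<Sum>i\<in>A. E (F i))"
proof -
  show "E (\<lambda>v. f v + g v) = E f + E g" by (simp add: E_def algebra_simps sum.distrib)
  show "E (\<lambda>v. f v - g v) = E f - E g" by (simp add: E_def algebra_simps sum_subtractf)
  show "E (\<lambda>v. c * f v) = c * E f" by (simp add: E_def algebra_simps sum_distrib_left)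
  show "E (\<lambda>v. \<Sum>i\<in>A. F i v) = (\<Sum>i\<in>A. E (F i))"
    by (simp add: E_def sum_distrib_left) (rule sum.swap)
qed

lemma E_const: "E (\<lambda>v. c) = c" using w_sum by (simp add: E_def flip: sum_distrib_right)

lemma E_mono: "(\<And>v. v \<in> \<Omega> \<Longrightarrow> f v \<le> g v) \<Longrightarrow> E f \<le> E g"
  unfolding E_def by (intro sum_mono mult_left_mono w_nonneg)

lemma E_cong: "(\<And>v. v \<in> \<Omega> \<Longrightarrow> f v = g v) \<Longrightarrow> E f = E g"
  unfolding E_def by (intro sum.cong) auto

lemma E_nonneg: "(\<And>v. v \<in> \<Omega> \<Longrightarrow> 0 \<le> f v) \<Longrightarrow> 0 \<le> E f"
  unfolding E_def by (intro sum_nonneg mult_nonneg_nonneg w_nonneg)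

lemma past_const: "past \<kappa> (\<lambda>v. c)" by (simp add: past_def)
lemma past_mono: "past \<kappa> g \<Longrightarrow> \<kappa> \<le> \<kappa>' \<Longrightarrow> past \<kappa>' g"
  unfolding past_def using order.trans by blast
lemma past_mult: "past \<kappa> f \<Longrightarrow> past \<kappa> g \<Longrightarrow> past \<kappa> (\<lambda>v. f v * g v)"
  unfolding past_def by metis
lemma past_sum: "(\<And>i. i \<in> A \<Longrightarrow> past \<kappa> (F i)) \<Longrightarrow> past \<kappa> (\<lambda>v. \<Sum>i\<in>A. F i v)"
  unfolding past_def by (intro ballI impI sum.cong refl) blast
lemma past_X: "k \<le> \<kappa> \<Longrightarrow> past \<kappa> (\<lambda>v. f (X k v))"
  unfolding past_def by auto

lemma bd_mult: "bd F f \<Longrightarrow> bd G g \<Longrightarrow> bd (F * G) (\<lambda>v. f v * g v)"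
  unfolding bd_def by (auto intro!: mult_mono intro: order.trans)

lemma bd_mono: "bd G g \<Longrightarrow> G \<le> G' \<Longrightarrow> bd G' g"
  unfolding bd_def by force

lemma far': "\<lbrakk>\<kappa> + H \<le> k; k \<le> T; past \<kappa> g; bd G g; 0 < M; M \<le> P * B; R \<subseteq> {..<M}\<rbrakk> \<Longrightarrow>
   \<bar>E (\<lambda>v. g v * of_bool (X k v mod M \<in> R)) - real (card R) / real M * E g\<bar> \<le> G * \<theta>"
  unfolding E_def past_def bd_def by (rule far) blast+

lemma near': "\<lbrakk>\<kappa> + L \<le> k; k \<le> T; past \<kappa> g; bd G g; 0 < M; M \<le> B; R \<subseteq> {..<M}\<rbrakk> \<Longrightarrow>
   \<bar>E (\<lambda>v. g v * of_bool (X k v mod M \<in> R)) - real (card R) / real M * E g\<bar> \<le> G * \<theta>"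
  unfolding E_def past_def bd_def by (rule near) blast+

section \<open>Survivors of the sieve at one and two exponents\<close>

definition V :: real where "V = real (card {x. x < P \<and> coprime x P}) / real P"

definition t :: "nat \<Rightarrow> 'a \<Rightarrow> real" where "t k v = of_bool (coprime (X k v) P)"

text \<open>With \<open>q = 1\<close> and \<open>b = 0\<close> this is \<open>t k\<close> itself, a
  case used for counting all survivors.\<close>

definition h :: "nat \<Rightarrow> nat \<Rightarrow> nat \<Rightarrow> 'a \<Rightarrow> real" where
  "h q b k v = t k v * of_bool (X k v mod q = b)"

lemma V_nonneg: "0 \<le> V" by (simp add: V_def)
lemma V_le_1: "V \<le> 1"
proof -
  have "card {x. x < P \<and> coprime x P} \<le> card {..<P}" by (intro card_mono) auto
  thus ?thesis using P_pos by (simp add: V_def field_simps)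
qed

lemma h_bd: "bd 1 (h q b k)" by (auto simp: bd_def h_def t_def)
lemma h_past: "k \<le> \<kappa> \<Longrightarrow> past \<kappa> (h q b k)"
  using past_X[of k \<kappa> "\<lambda>x. of_bool (coprime x P) * of_bool (x mod q = b)"]
  by (simp add: h_def[abs_def] t_def)

lemma h_single:
  assumes "\<kappa> + H \<le> k" "k \<le> T" "past \<kappa> g" "bd G g" "q > 0" "q \<le> B" "coprime P q" "b < q"
  shows "\<bar>E (\<lambda>v. g v * h q b k v) - V / real q * E g\<bar> \<le> G * \<theta>"
proof -
  define R where "R = {x. x < P * q \<and> coprime (x mod P) P \<and> x mod q = b}"
  have card: "card R = card {x. x < P \<and> coprime x P} * card {x. x < q \<and> x = b}"
    unfolding R_def by (rule card_residue_conditions[where S' = "\<lambda>x. x = b"]) (use assms P_pos in auto)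
  have "{x. x < q \<and> x = b} = {b}" using assms by auto
  hence R: "real (card R) / real (P * q) = V / real q" using card by (simp add: V_def)
  have "X k v mod (P * q) \<in> R \<longleftrightarrow> coprime (X k v) P \<and> X k v mod q = b" for v
  proof -
    have "X k v mod (P * q) mod P = X k v mod P" "X k v mod (P * q) mod q = X k v mod q"
      "X k v mod (P * q) < P * q" using P_pos assms by (simp_all add: mod_mod_cancel)
    thus ?thesis unfolding R_def mem_Collect_eq using P_pos by (metis coprime_mod_left_iff not_gr0)
  qed
  hence h: "h q b k v = of_bool (X k v mod (P * q) \<in> R)" for v
    by (simp add: h_def t_def of_bool_conj)
  show ?thesis unfolding h R[symmetric]
    using assms P_pos by (intro far'[of \<kappa>]) (auto simp: R_def)
qed

lemma h_double:
  assumes "\<kappa> + H \<le> k" "k \<le> T" "past \<kappa> g" "bd G g" "q > 0" "q' > 0" "q * q' \<le> B"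
    "coprime P q" "coprime P q'" "coprime q q'" "b < q" "b' < q'"
  shows "\<bar>E (\<lambda>v. g v * (h q b k v * h q' b' k v)) - V / (real q * real q') * E g\<bar> \<le> G * \<theta>"
proof -
  define R where "R = {x. x < P * (q * q') \<and> coprime (x mod P) P \<and>
     ((x mod (q * q')) mod q = b \<and> (x mod (q * q')) mod q' = b')}"
  have "{x. x < q \<and> x = b} = {b}" "{x. x < q' \<and> x = b'} = {b'}" using assms by auto
  hence c1: "card {x. x < q * q' \<and> x mod q = b \<and> x mod q' = b'} = 1"
    using card_residue_conditions[of q q' "\<lambda>x. x = b" "\<lambda>x. x = b'"] assms by simp
  have "card R = card {x. x < P \<and> coprime x P} * card {x. x < q * q' \<and> x mod q = b \<and> x mod q' = b'}"
    unfolding R_def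
    by (rule card_residue_conditions[where S' = "\<lambda>x. x mod q = b \<and> x mod q' = b'"]) (use assms P_pos in auto)
  hence R: "real (card R) / real (P * (q * q')) = V / (real q * real q')" using c1 by (simp add: V_def)
  have "X k v mod (P * (q * q')) \<in> R \<longleftrightarrow> coprime (X k v) P \<and> X k v mod q = b \<and> X k v mod q' = b'" for v
  proof -
    have "X k v mod (P * (q * q')) mod P = X k v mod P"
      "X k v mod (P * (q * q')) mod (q * q') mod q = X k v mod q"
      "X k v mod (P * (q * q')) mod (q * q') mod q' = X k v mod q'"
      "X k v mod (P * (q * q')) < P * (q * q')" using P_pos assms by (simp_all add: mod_mod_cancel)
    thus ?thesis unfolding R_def mem_Collect_eq using P_pos by (metis coprime_mod_left_iff not_gr0)
  qed
  hence h: "h q b k v * h q' b' k v = of_bool (X k v mod (P * (q * q')) \<in> R)" for v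
    by (simp add: h_def t_def of_bool_conj)
  show ?thesis unfolding h R[symmetric]
    using assms P_pos by (intro far'[of \<kappa>]) (auto simp: R_def)
qed

text \<open>Two conditionings in a row: \<open>g * h q b k\<close> is determined by the past up to
  \<open>k\<close>, so the estimate at \<open>k'\<close> applies to it, and then the estimate at
  \<open>k\<close> applies to \<open>g\<close>. As \<open>c \<le> 1\<close>, the two errors simply
  add up.\<close>

lemma h_pair:
  assumes "\<kappa> + H \<le> k" "k + L \<le> k'" "k' \<le> T" "past \<kappa> g" "bd G g" "q > 0" "q' > 0" "q \<le> B" "q' \<le> B"
    "coprime P q" "coprime P q'" "b < q" "b' < q'"
  shows "E (\<lambda>v. g v * (h q b k v * h q' b' k' v)) \<le>
    V * (if k + H \<le> k' then V else 1) / (real q * real q') * E g + 2 * G * \<theta>"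
proof -
  have G: "G \<ge> 0"
  proof -
    obtain v where "v \<in> \<Omega>" using w_sum by (metis ex_in_conv sum.empty zero_neq_one)
    thus ?thesis using assms(5) unfolding bd_def by force
  qed
  let ?gh = "\<lambda>v. g v * h q b k v"
  define c where "c = (if k + H \<le> k' then V else 1) / real q'"
  have c: "0 \<le> c" "c \<le> 1" using V_nonneg V_le_1 assms by (auto simp: c_def divide_le_eq)
  have gh: "past k ?gh" "bd G ?gh"
    using assms bd_mult[OF assms(5) h_bd] by (auto intro!: past_mult h_past intro: past_mono)
  have "E ?gh \<le> V / real q * E g + G * \<theta>" using h_single[of \<kappa> k g G q b] assms by simp
  hence "c * E ?gh \<le> c * (V / real q * E g + G * \<theta>)" using c by (intro mult_left_mono)
  also have "\<dots> \<le> c * (V / real q * E g) + G * \<theta>"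
    using mult_right_mono[OF c(2), of "G * \<theta>"] G theta_nonneg by (simp add: algebra_simps)
  finally have 1: "c * E ?gh \<le> c * (V / real q * E g) + G * \<theta>" .
  have 2: "E (\<lambda>v. ?gh v * h q' b' k' v) \<le> c * E ?gh + G * \<theta>"
  proof (cases "k + H \<le> k'")
    case True
    thus ?thesis using h_single[OF True _ gh, of q' b'] assms by (simp add: c_def)
  next
    case False
    have "E (\<lambda>v. ?gh v * h q' b' k' v) \<le> E (\<lambda>v. ?gh v * of_bool (X k' v mod q' \<in> {b'}))"
      using gh(2) by (intro E_mono mult_left_mono) (auto simp: h_def t_def bd_def)
    also have "\<dots> \<le> real (card {b'}) / real q' * E ?gh + G * \<theta>"
      using near'[of k k' ?gh G q' "{b'}"] assms gh by simp
    finally show ?thesis using False by (simp add: c_def)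
  qed
  have "E (\<lambda>v. g v * (h q b k v * h q' b' k' v)) \<le> c * (V / real q * E g) + G * \<theta> + G * \<theta>"
    using 1 2 by (simp add: mult.assoc)
  thus ?thesis by (simp add: c_def mult_ac)
qed

text \<open>The last factor is replaced by its conditional mean, since the product of the earlier
  ones lies in its past and is bounded; this is why \<open>past\<close> and \<open>bd\<close> of the
  product are carried through the induction.\<close>

lemma E_prod_upper:
  assumes "\<And>j. j < n \<Longrightarrow> past (Suc j * S) (f j)" "\<And>j. j < n \<Longrightarrow> bd Bd (f j)"
    "\<And>j. j < n \<Longrightarrow> 0 \<le> s j \<and> s j \<le> Bd" "1 \<le> Bd" "0 \<le> \<theta>'"
    "\<And>j g G. j < n \<Longrightarrow> past (j * S) g \<Longrightarrow> bd G g \<Longrightarrow> E (\<lambda>v. g v * f j v) \<le> s j * E g + G * \<theta>'"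
  shows "E (\<lambda>v. \<Prod>j<n. f j v) \<le> (\<Prod>j<n. s j) + real n * Bd ^ n * \<theta>' \<and>
         past (n * S) (\<lambda>v. \<Prod>j<n. f j v) \<and> bd (Bd ^ n) (\<lambda>v. \<Prod>j<n. f j v)"
  using assms
proof (induction n)
  case 0
  show ?case by (simp add: E_const past_const bd_def)
next
  case (Suc n)
  let ?g = "\<lambda>v. \<Prod>j<n. f j v"
  have IH: "E ?g \<le> (\<Prod>j<n. s j) + real n * Bd ^ n * \<theta>'" "past (n * S) ?g" "bd (Bd ^ n) ?g"
    using Suc by auto
  have sn: "0 \<le> s n" "s n \<le> Bd" using Suc.prems(3)[of n] by auto
  have "E (\<lambda>v. ?g v * f n v) \<le> s n * E ?g + Bd ^ n * \<theta>'"
    using Suc.prems(6)[of n] IH by simp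
  also have "s n * E ?g \<le> s n * ((\<Prod>j<n. s j) + real n * Bd ^ n * \<theta>')"
    using IH sn by (intro mult_left_mono) auto
  also have "s n * (real n * Bd ^ n * \<theta>') \<le> Bd * (real n * Bd ^ n * \<theta>')"
    using sn Suc.prems by (intro mult_right_mono) auto
  hence "s n * ((\<Prod>j<n. s j) + real n * Bd ^ n * \<theta>') + Bd ^ n * \<theta>' \<le>
      (\<Prod>j<Suc n. s j) + real n * Bd ^ Suc n * \<theta>' + Bd ^ n * \<theta>'" by (simp add: algebra_simps)
  also have "Bd ^ n * \<theta>' \<le> Bd ^ Suc n * \<theta>'"
    using Suc.prems(4,5) by (intro mult_right_mono power_increasing) auto
  finally have "E (\<lambda>v. \<Prod>j<Suc n. f j v) \<le> (\<Prod>j<Suc n. s j) + real (Suc n) * Bd ^ Suc n * \<theta>'"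
    by (simp add: algebra_simps)
  moreover have "past (Suc n * S) (\<lambda>v. \<Prod>j<Suc n. f j v)"
    using IH(2) Suc.prems(1)[of n] by (auto intro!: past_mult intro: past_mono)
  moreover have "bd (Bd ^ Suc n) (\<lambda>v. \<Prod>j<Suc n. f j v)"
    using bd_mult[OF IH(3) Suc.prems(2)[of n]] by (simp add: mult.commute)
  ultimately show ?case by blast
qed

lemma E_prod_lower:
  assumes "\<And>j. j < n \<Longrightarrow> past (Suc j * S) (f j)" "\<And>j. j < n \<Longrightarrow> bd Bd (f j)"
    "\<And>j. j < n \<Longrightarrow> 0 \<le> s j \<and> s j \<le> Bd" "1 \<le> Bd" "0 \<le> \<theta>'"
    "\<And>j g G. j < n \<Longrightarrow> past (j * S) g \<Longrightarrow> bd G g \<Longrightarrow> E (\<lambda>v. g v * f j v) \<ge> s j * E g - G * \<theta>'"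
  shows "E (\<lambda>v. \<Prod>j<n. f j v) \<ge> (\<Prod>j<n. s j) - real n * Bd ^ n * \<theta>' \<and>
         past (n * S) (\<lambda>v. \<Prod>j<n. f j v) \<and> bd (Bd ^ n) (\<lambda>v. \<Prod>j<n. f j v)"
  using assms
proof (induction n)
  case 0
  show ?case by (simp add: E_const past_const bd_def)
next
  case (Suc n)
  let ?g = "\<lambda>v. \<Prod>j<n. f j v"
  have IH: "E ?g \<ge> (\<Prod>j<n. s j) - real n * Bd ^ n * \<theta>'" "past (n * S) ?g" "bd (Bd ^ n) ?g"
    using Suc by auto
  have sn: "0 \<le> s n" "s n \<le> Bd" using Suc.prems(3)[of n] by auto
  have 1: "E (\<lambda>v. ?g v * f n v) \<ge> s n * E ?g - Bd ^ n * \<theta>'"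
    using Suc.prems(6)[of n] IH by simp
  have 2: "s n * E ?g \<ge> s n * ((\<Prod>j<n. s j) - real n * Bd ^ n * \<theta>')"
    using IH sn by (intro mult_left_mono) auto
  have 3: "s n * (real n * Bd ^ n * \<theta>') \<le> Bd * (real n * Bd ^ n * \<theta>')"
    using sn Suc.prems by (intro mult_right_mono) auto
  have 4: "Bd ^ n * \<theta>' \<le> Bd ^ Suc n * \<theta>'"
    using Suc.prems(4,5) by (intro mult_right_mono power_increasing) auto
  have "E (\<lambda>v. \<Prod>j<Suc n. f j v) \<ge> (\<Prod>j<Suc n. s j) - real (Suc n) * Bd ^ Suc n * \<theta>'"
    using 1 2 3 4 by (simp add: algebra_simps)
  moreover have "past (Suc n * S) (\<lambda>v. \<Prod>j<Suc n. f j v)"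
    using IH(2) Suc.prems(1)[of n] by (auto intro!: past_mult intro: past_mono)
  moreover have "bd (Bd ^ Suc n) (\<lambda>v. \<Prod>j<Suc n. f j v)"
    using bd_mult[OF IH(3) Suc.prems(2)[of n]] by (simp add: mult.commute)
  ultimately show ?case by blast
qed

end

text \<open>The exponents in one residue class modulo \<open>L\<close> are arranged in \<open>J\<close> segments of \<open>m\<close> elements each,
  separated by gaps of length \<open>H\<close>; a \<open>J\<close>-tuple takes one exponent from every segment.\<close>

locale fresh_segments = fresh_space +
  fixes S J m r :: nat
  assumes fits: "H + L * m \<le> S" "r < L" "J * S \<le> T"
    and m_pos: "m > 0" and V_pos: "V > 0"
begin

section \<open>Moments of one segment\<close>

definition e :: "nat \<Rightarrow> nat \<Rightarrow> nat" where "e j i = j * S + H + r + L * i"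

text \<open>Mean number of survivors in one segment, up to the equidistribution error.\<close>

definition \<beta> :: real where "\<beta> = real m * V"

lemma beta_pos: "\<beta> > 0" using m_pos V_pos by (simp add: \<beta>_def)

lemma e_lower: "j * S + H \<le> e j i" by (simp add: e_def)

lemma e_upper: assumes "i < m" shows "e j i \<le> Suc j * S"
proof -
  have "L * i + L \<le> L * m" using assms by (metis Suc_leI mult_Suc_right mult_le_mono2 add.commute)
  thus ?thesis using fits by (simp add: e_def)
qed

lemma e_le_T: assumes "i < m" "j < J" shows "e j i \<le> T"
proof -
  have "Suc j * S \<le> J * S" using assms by (intro mult_right_mono) auto
  thus ?thesis using e_upper[OF assms(1), of j] fits by linarith
qed

lemma e_step: assumes "i < i'" shows "e j i + L \<le> e j i'"
proof -
  have "L * i + L \<le> L * i'" using assms by (metis Suc_leI mult_Suc_right mult_le_mono2 add.commute)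
  thus ?thesis by (simp add: e_def)
qed

lemma e_far: assumes "i + H \<le> i'" shows "e j i + H \<le> e j i'"
proof -
  have "L * (i + H) \<le> L * i'" using assms by (intro mult_le_mono2)
  hence "L * i + L * H \<le> L * i'" by (simp add: distrib_left)
  moreover have "1 * H \<le> L * H" using L_pos by (intro mult_right_mono) auto
  ultimately show ?thesis unfolding e_def by linarith
qed

definition n :: "nat \<Rightarrow> nat \<Rightarrow> nat \<Rightarrow> 'a \<Rightarrow> real" where
  "n j q b v = (\<Sum>i<m. h q b (e j i) v)"

lemma n_bd: "bd (real m) (n j q b)"
proof -
  have "n j q b v \<le> (\<Sum>i<m. 1)" if "v \<in> \<Omega>" for v
    unfolding n_def using h_bd that by (intro sum_mono) (auto simp: bd_def)
  thus ?thesis using h_bd by (auto simp: bd_def n_def intro!: sum_nonneg)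
qed

lemma n_past: "past (Suc j * S) (n j q b)"
proof -
  have "past (Suc j * S) (\<lambda>v. \<Sum>i<m. h q b (e j i) v)"
    by (intro past_sum h_past e_upper) auto
  thus ?thesis by (simp add: n_def[abs_def])
qed

lemma bd_nonneg: assumes "bd G g" shows "G \<ge> 0"
proof -
  obtain v where "v \<in> \<Omega>" using w_sum by (metis ex_in_conv sum.empty zero_neq_one)
  thus ?thesis using assms unfolding bd_def by force
qed

lemma n_single:
  assumes "j < J" "past (j * S) g" "bd G g" "q > 0" "q \<le> B" "coprime P q" "b < q"
  shows "\<bar>E (\<lambda>v. g v * n j q b v) - \<beta> / real q * E g\<bar> \<le> G * (real m * \<theta>)"
proof -
  have "\<bar>E (\<lambda>v. g v * n j q b v) - \<beta> / real q * E g\<bar> =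
     \<bar>\<Sum>i<m. E (\<lambda>v. g v * h q b (e j i) v) - V / real q * E g\<bar>"
    by (simp add: n_def sum_distrib_left E_sum sum_subtractf \<beta>_def)
  also have "\<dots> \<le> (\<Sum>i<m. \<bar>E (\<lambda>v. g v * h q b (e j i) v) - V / real q * E g\<bar>)"
    by (rule sum_abs)
  also have "\<dots> \<le> (\<Sum>i<m. G * \<theta>)"
    using assms by (intro sum_mono h_single[of "j * S"] e_lower e_le_T) auto
  finally show ?thesis by (simp add: mult_ac)
qed

text \<open>\<open>coll q b q' b' / (q * q')\<close> is the probability of \<open>X k mod q = b \<and> X k mod q' = b'\<close> for a single \<open>k\<close>
  if \<open>q\<close> and \<open>q'\<close> are equal or coprime.\<close>

definition coll :: "nat \<Rightarrow> nat \<Rightarrow> nat \<Rightarrow> nat \<Rightarrow> real" where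
  "coll q b q' b' = (if q = q' then (if b = b' then real q else 0) else 1)"

lemma coll_nonneg: "0 \<le> coll q b q' b'" by (simp add: coll_def)

lemma h_same:
  assumes "\<kappa> + H \<le> k" "k \<le> T" "past \<kappa> g" "bd G g" "q > 0" "q' > 0" "q \<le> B" "q * q' \<le> B \<or> q = q'"
    "coprime P q" "coprime P q'" "coprime q q' \<or> q = q'" "b < q" "b' < q'"
  shows "E (\<lambda>v. g v * (h q b k v * h q' b' k v)) \<le> V * coll q b q' b' / (real q * real q') * E g + G * \<theta>"
proof (cases "q = q'")
  case False
  thus ?thesis using h_double[of \<kappa> k g G q q' b b'] assms by (simp add: coll_def)
next
  case True
  have G: "0 \<le> G * \<theta>" using bd_nonneg[OF assms(4)] theta_nonneg by simp
  show ?thesis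
  proof (cases "b = b'")
    case bT: True
    have "h q b k v * h q' b' k v = h q b k v" for v using True bT by (auto simp: h_def t_def)
    hence "E (\<lambda>v. g v * (h q b k v * h q' b' k v)) = E (\<lambda>v. g v * h q b k v)" by presburger
    thus ?thesis using h_single[of \<kappa> k g G q b] assms True bT by (simp add: coll_def)
  next
    case False
    have "h q b k v * h q' b' k v = 0" for v using True False by (auto simp: h_def)
    hence "E (\<lambda>v. g v * (h q b k v * h q' b' k v)) = E (\<lambda>v. 0)" by (simp only: mult_zero_right)
    thus ?thesis using G True False by (simp add: coll_def E_const)
  qed
qed

text \<open>Main term \<open>\<beta>\<^sup>2 / (q * q')\<close> of the mixed second moment with its
  relative corrections: \<open>2 * H / \<beta>\<close> from pairs of exponents too close for the
  sieve condition, \<open>coll / \<beta>\<close> from the diagonal.\<close>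

definition Sb :: "nat \<Rightarrow> nat \<Rightarrow> nat \<Rightarrow> nat \<Rightarrow> real" where
  "Sb q b q' b' = \<beta>\<^sup>2 / (real q * real q') * (1 + (2 * real H + coll q b q' b') / \<beta>)"

lemma Sb_nonneg: "0 \<le> Sb q b q' b'"
  unfolding Sb_def using beta_pos coll_nonneg by (intro mult_nonneg_nonneg divide_nonneg_nonneg add_nonneg_nonneg) auto

lemma n_double:
  assumes "j < J" "past (j * S) g" "bd G g" "q > 0" "q' > 0" "q \<le> B" "q' \<le> B" "q * q' \<le> B \<or> q = q'"
    "coprime P q" "coprime P q'" "coprime q q' \<or> q = q'" "b < q" "b' < q'"
  shows "E (\<lambda>v. g v * (n j q b v * n j q' b' v)) \<le> Sb q b q' b' * E g + G * (2 * (real m)\<^sup>2 * \<theta>)"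
proof -
  define D where "D = real q * real q'"
  have D: "D > 0" using assms by (simp add: D_def)
  have G: "0 \<le> G * \<theta>" using bd_nonneg[OF assms(3)] theta_nonneg by simp
  have Eg: "0 \<le> E g" using assms(3) by (intro E_nonneg) (auto simp: bd_def)
  \<comment> \<open>Three layers: all pairs, pairs at index distance below \<open>H\<close>, where
    one factor \<open>V\<close> is lost, and the diagonal.\<close>
  define c where "c i i' = V\<^sup>2 / D + of_bool (i' < i + H \<and> i < i' + H) * (V / D) + of_bool (i = i') * (V * coll q b q' b' / D)" for i i' :: nat
  have off: "E (\<lambda>v. g v * (h q b (e j i) v * h q' b' (e j i') v)) \<le> c i i' * E g + 2 * G * \<theta>"
    if i: "i < m" "i' < m" for i i'
  proof -
    have "E (\<lambda>v. g v * (h q b (e j i) v * h q' b' (e j i') v)) \<le> 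
       V * (if i + H \<le> i' \<or> i' + H \<le> i then V else 1) / D * E g + 2 * G * \<theta>" if "i < i'"
    proof -
      have "E (\<lambda>v. g v * (h q b (e j i) v * h q' b' (e j i') v)) \<le>
        V * (if e j i + H \<le> e j i' then V else 1) / D * E g + 2 * G * \<theta>"
        unfolding D_def using assms i e_step[OF that]
        by (intro h_pair[of "j * S"] e_lower e_le_T) auto
      also have "\<dots> \<le> V * (if i + H \<le> i' \<or> i' + H \<le> i then V else 1) / D * E g + 2 * G * \<theta>"
        using V_nonneg V_le_1 e_far[of i i' j] D Eg that
        by (intro add_right_mono mult_right_mono divide_right_mono mult_left_mono) auto
      finally show ?thesis .
    qed
    moreover have "E (\<lambda>v. g v * (h q b (e j i) v * h q' b' (e j i') v)) \<le> 
       V * (if i + H \<le> i' \<or> i' + H \<le> i then V else 1) / D * E g + 2 * G * \<theta>" if "i' < i"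
    proof -
      have "E (\<lambda>v. g v * (h q b (e j i) v * h q' b' (e j i') v)) =
            E (\<lambda>v. g v * (h q' b' (e j i') v * h q b (e j i) v))" by (simp add: mult_ac)
      also have "\<dots> \<le> V * (if e j i' + H \<le> e j i then V else 1) / (real q' * real q) * E g + 2 * G * \<theta>"
        using assms i e_step[OF that] by (intro h_pair[of "j * S"] e_lower e_le_T) auto
      also have "\<dots> = V * (if e j i' + H \<le> e j i then V else 1) / D * E g + 2 * G * \<theta>"
        by (simp add: D_def mult.commute)
      also have "\<dots> \<le> V * (if i + H \<le> i' \<or> i' + H \<le> i then V else 1) / D * E g + 2 * G * \<theta>"
        using V_nonneg V_le_1 e_far[of i' i j] D Eg that
        by (intro add_right_mono mult_right_mono divide_right_mono mult_left_mono) auto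
      finally show ?thesis .
    qed
    moreover have "V * (if i + H \<le> i' \<or> i' + H \<le> i then V else 1) / D * E g \<le> c i i' * E g" if "i \<noteq> i'"
    proof (intro mult_right_mono Eg)
      show "V * (if i + H \<le> i' \<or> i' + H \<le> i then V else 1) / D \<le> c i i'"
        unfolding c_def using V_nonneg D coll_nonneg that by (auto simp: power2_eq_square)
    qed
    moreover have "E (\<lambda>v. g v * (h q b (e j i) v * h q' b' (e j i') v)) \<le> c i i' * E g + 2 * G * \<theta>" if "i = i'"
    proof -
      have "E (\<lambda>v. g v * (h q b (e j i) v * h q' b' (e j i) v)) \<le> V * coll q b q' b' / D * E g + G * \<theta>"
        unfolding D_def using assms i by (intro h_same[of "j * S"] e_lower e_le_T) auto
      also have "V * coll q b q' b' / D * E g \<le> c i i' * E g"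
        unfolding c_def using V_nonneg D coll_nonneg that by (intro mult_right_mono Eg) auto
      finally show ?thesis using G that by simp
    qed
    ultimately show ?thesis by (cases i i' rule: linorder_cases) auto
  qed
  have "E (\<lambda>v. g v * (n j q b v * n j q' b' v)) =
     (\<Sum>i<m. \<Sum>i'<m. E (\<lambda>v. g v * (h q b (e j i) v * h q' b' (e j i') v)))"
  proof -
    have "g v * (n j q b v * n j q' b' v) =
       (\<Sum>i<m. \<Sum>i'<m. g v * (h q b (e j i) v * h q' b' (e j i') v))" for v
      unfolding n_def sum_product by (simp only: sum_distrib_left)
    thus ?thesis by (simp add: E_sum)
  qed
  also have "\<dots> \<le> (\<Sum>i<m. \<Sum>i'<m. c i i' * E g + 2 * G * \<theta>)"
    using off by (intro sum_mono) auto
  also have "\<dots> = (\<Sum>i<m. \<Sum>i'<m. c i i') * E g + G * (2 * (real m)\<^sup>2 * \<theta>)"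
    by (simp add: sum.distrib sum_distrib_right power2_eq_square)
  also have "(\<Sum>i<m. \<Sum>i'<m. c i i') \<le> (\<Sum>i<m. real m * (V\<^sup>2 / D) + 2 * real H * (V / D) + V * coll q b q' b' / D)"
  proof (intro sum_mono)
    fix i assume i: "i \<in> {..<m}"
    have "(\<Sum>i'<m. c i i') = real m * (V\<^sup>2 / D) + (\<Sum>i'<m. of_bool (i' < i + H \<and> i < i' + H)) * (V / D) + V * coll q b q' b' / D"
    proof -
      have "(\<Sum>i'<m. of_bool (i = i') * (V * coll q b q' b' / D)) =
          (\<Sum>i'<m. if i' = i then V * coll q b q' b' / D else 0)" by (intro sum.cong) auto
      also have "\<dots> = V * coll q b q' b' / D" using i by (subst sum.delta) auto
      finally have d: "(\<Sum>i'<m. of_bool (i = i') * (V * coll q b q' b' / D)) = V * coll q b q' b' / D" .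
      show ?thesis unfolding c_def sum.distrib d sum_distrib_right by simp
    qed
    also have "\<dots> \<le> real m * (V\<^sup>2 / D) + 2 * real H * (V / D) + V * coll q b q' b' / D"
      using i D V_nonneg by (intro add_right_mono add_left_mono mult_right_mono sum_near_le) auto
    finally show "(\<Sum>i'<m. c i i') \<le> \<dots>" .
  qed
  also have "\<dots> = Sb q b q' b'"
    using m_pos V_pos D unfolding Sb_def D_def[symmetric] \<beta>_def
    by (simp add: field_simps power2_eq_square)
  finally show ?thesis using Eg by (simp add: mult_right_mono)
qed

end

section \<open>Moments for a set of primes\<close>

text \<open>All relative variances are controlled by \<open>\<xi>\<close>: \<open>gam\<close> serves
  pairs with different classes or primes, \<open>Dq1\<close> equal classes (a share
  \<open>1 / q\<close> of the pairs), \<open>Dq2\<close> equal primes (a share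
  \<open>1 / card Q\<close>). \<open>Bd\<close> bounds the single factors of moment products,
  \<open>\<Lambda>\<close> the ratio of \<open>q\<close> to the mean number of tuples, and
  \<open>err\<close> makes the equidistribution error negligible.\<close>

locale fresh_primes = fresh_segments +
  fixes Q :: "nat set" and \<Lambda> \<xi> Bd :: real
  assumes Q_fin: "finite Q" and Q_nonempty: "Q \<noteq> {}" and J_pos: "J > 0"
    and Q_pos: "q \<in> Q \<Longrightarrow> q > 0"
    and Q_le: "q \<in> Q \<Longrightarrow> q' \<in> Q \<Longrightarrow> q * q' \<le> B"
    and Q_coprime_P: "q \<in> Q \<Longrightarrow> coprime P q"
    and Q_coprime: "q \<in> Q \<Longrightarrow> q' \<in> Q \<Longrightarrow> q \<noteq> q' \<Longrightarrow> coprime q q'"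
    and Bd1: "(real m)\<^sup>2 \<le> Bd"
    and Bd2: "q \<in> Q \<Longrightarrow> \<beta>\<^sup>2 * (1 + (2 * real H + real q) / \<beta>) \<le> Bd"
    and gam: "(1 + (2 * real H + 1) / \<beta>) ^ J \<le> 1 + \<xi>"
    and Dq1: "q \<in> Q \<Longrightarrow> (1 + (2 * real H + real q) / \<beta>) ^ J \<le> \<xi> * real q"
    and Dq2: "q \<in> Q \<Longrightarrow> (1 + (2 * real H + real q) / \<beta>) ^ J \<le> \<xi> * real (card Q)"
    and Lam: "q \<in> Q \<Longrightarrow> (real q / \<beta>) ^ J \<le> \<Lambda>" and Lam1: "1 \<le> \<Lambda>"
    and beta1: "1 \<le> \<beta>"
    and err: "4 * (real J * Bd ^ J * (2 * (real m)\<^sup>2 * \<theta>)) * (\<beta>\<^sup>2 * \<Lambda>\<^sup>2) \<le> \<xi> * V"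
begin

definition \<theta>' :: real where "\<theta>' = 2 * (real m)\<^sup>2 * \<theta>"
definition \<eta> :: real where "\<eta> = real J * Bd ^ J * \<theta>'"
definition G :: "nat \<Rightarrow> real" where "G q = real q * (\<beta> / real q) ^ J"
definition N :: real where "N = real (card Q)"
text \<open>Expected value of \<open>\<Phi>\<close> for a survivor: the other \<open>J - 1\<close>
  segments have mean \<open>(\<beta> / q) ^ (J - 1)\<close>, so every prime contributes
  \<open>(\<beta> / q) ^ (J - 1) / G q = 1 / \<beta>\<close>.\<close>

definition \<mu> :: real where "\<mu> = N / \<beta>"

lemma q_le_B: "q \<in> Q \<Longrightarrow> q \<le> B" using Q_le[of q q] Q_pos[of q] by (metis le_trans le_square)
lemma one_le_B: "1 \<le> B" using Q_nonempty q_le_B Q_pos by fastforce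
lemma m1: "1 \<le> real m" using m_pos by simp
lemma m_le_msq: "real m \<le> (real m)\<^sup>2" using m1 by (simp add: power2_eq_square)
lemma Bd_ge1: "1 \<le> Bd" using m1 Bd1 m_le_msq by linarith
lemma theta'_nonneg: "0 \<le> \<theta>'" using theta_nonneg by (simp add: \<theta>'_def)
lemma theta_le: "real m * \<theta> \<le> \<theta>'" "\<theta> \<le> \<theta>'"
proof -
  have "real m * \<theta> \<le> (real m)\<^sup>2 * \<theta>" using m_le_msq theta_nonneg by (intro mult_right_mono)
  moreover have "1 * \<theta> \<le> real m * \<theta>" using m1 theta_nonneg by (intro mult_right_mono)
  moreover have "0 \<le> (real m)\<^sup>2 * \<theta>" using theta_nonneg by simp
  ultimately show "real m * \<theta> \<le> \<theta>'" "\<theta> \<le> \<theta>'" unfolding \<theta>'_def by linarith+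
qed
lemma theta'_le_eta: "\<theta>' \<le> \<eta>"
proof -
  have "1 * 1 \<le> real J * Bd ^ J" using J_pos Bd_ge1 by (intro mult_mono one_le_power) auto
  thus ?thesis using theta'_nonneg mult_right_mono[of 1 "real J * Bd ^ J" \<theta>'] by (simp add: \<eta>_def)
qed
lemma eta_nonneg: "0 \<le> \<eta>" using theta'_nonneg theta'_le_eta by linarith
lemma G_pos: "q \<in> Q \<Longrightarrow> G q > 0" using Q_pos beta_pos by (simp add: G_def)
lemma N_pos: "N > 0" using Q_fin Q_nonempty by (simp add: N_def card_gt_0_iff)
lemma mu_pos: "\<mu> > 0" using N_pos beta_pos by (simp add: \<mu>_def)
lemma q_le_G: assumes "q \<in> Q" shows "real q \<le> \<Lambda> * G q"
proof -
  have "(real q / \<beta>) ^ J * (\<beta> / real q) ^ J = 1" using Q_pos[OF assms] beta_pos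
    by (simp flip: power_mult_distrib)
  hence "real q = (real q / \<beta>) ^ J * G q" by (simp add: G_def)
  also have "\<dots> \<le> \<Lambda> * G q" using Lam[OF assms] G_pos[OF assms] by (intro mult_right_mono) auto
  finally show ?thesis .
qed
lemma xi_nonneg: "0 \<le> \<xi>"
proof -
  have "1 \<le> (1 + (2 * real H + 1) / \<beta>) ^ J" using beta_pos by (intro one_le_power) auto
  thus ?thesis using gam by linarith
qed
lemma err': "4 * \<eta> * (\<beta>\<^sup>2 * \<Lambda>\<^sup>2) \<le> \<xi> * V" using err by (simp add: \<eta>_def \<theta>'_def)
lemma err'': "4 * \<eta> * \<Lambda>\<^sup>2 \<le> \<xi>" "4 * \<eta> \<le> \<xi>"
proof -
  have b: "1 \<le> \<beta>\<^sup>2" "1 \<le> \<Lambda>\<^sup>2" using beta1 Lam1 by (simp_all add: one_le_power)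
  have "1 * \<Lambda>\<^sup>2 \<le> \<beta>\<^sup>2 * \<Lambda>\<^sup>2" using b by (intro mult_right_mono) auto
  hence "4 * \<eta> * \<Lambda>\<^sup>2 \<le> 4 * \<eta> * (\<beta>\<^sup>2 * \<Lambda>\<^sup>2)" using eta_nonneg by (intro mult_left_mono) auto
  moreover have "\<xi> * V \<le> \<xi> * 1" using xi_nonneg V_le_1 by (intro mult_left_mono)
  ultimately show *: "4 * \<eta> * \<Lambda>\<^sup>2 \<le> \<xi>" using err' by linarith
  have "4 * \<eta> * 1 \<le> 4 * \<eta> * \<Lambda>\<^sup>2" using eta_nonneg b by (intro mult_left_mono) auto
  thus "4 * \<eta> \<le> \<xi>" using * by linarith
qed

lemma pow_J1: assumes "1 \<le> (x::real)" "x ^ J \<le> c" shows "x ^ (J - 1) \<le> c" "x \<le> c"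
proof -
  show "x ^ (J - 1) \<le> c" using power_increasing[of "J - 1" J x] assms by simp
  show "x \<le> c" using power_increasing[of 1 J x] assms J_pos by simp
qed

lemma beta_le_m: "\<beta> \<le> real m" using V_le_1 m1 by (simp add: \<beta>_def mult_left_le)

lemma beta_div_le: assumes "q \<in> Q" shows "\<beta> / real q \<le> Bd"
proof -
  have "\<beta> / real q \<le> \<beta> / 1" using Q_pos[OF assms] beta_pos by (intro divide_left_mono) auto
  thus ?thesis using beta_le_m m_le_msq Bd1 by linarith
qed

lemma Sb_le: assumes "q \<in> Q" "q' \<in> Q" shows "Sb q b q' b' \<le> Bd"
proof -
  have q: "1 \<le> real q" "1 \<le> real q'" using Q_pos assms by (simp_all add: Suc_leI)
  have "coll q b q' b' \<le> real q" using q by (simp add: coll_def)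
  hence "1 + (2 * real H + coll q b q' b') / \<beta> \<le> 1 + (2 * real H + real q) / \<beta>"
    using beta_pos by (intro add_left_mono divide_right_mono) auto
  moreover have "\<beta>\<^sup>2 / (real q * real q') \<le> \<beta>\<^sup>2 / 1"
  proof (intro divide_left_mono)
    show "1 \<le> real q * real q'" using mult_mono[of 1 "real q" 1 "real q'"] q by simp
  qed (use q in auto)
  ultimately have "Sb q b q' b' \<le> \<beta>\<^sup>2 * (1 + (2 * real H + real q) / \<beta>)"
    unfolding Sb_def using beta_pos coll_nonneg[of q b q' b'] by (intro mult_mono) auto
  thus ?thesis using Bd2[OF assms(1)] by linarith
qed

text \<open>The number of \<open>J\<close>-tuples of survivors that agree modulo \<open>q\<close>; its mean is close to \<open>G q\<close>.\<close>

definition W :: "nat \<Rightarrow> 'a \<Rightarrow> real" where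
  "W q v = (\<Sum>b<q. \<Prod>j<J. n j q b v)"

lemma n_nonneg: "v \<in> \<Omega> \<Longrightarrow> 0 \<le> n j q b v" using n_bd[of j q b] by (simp add: bd_def)
lemma bd_nn: "bd Bd (\<lambda>v. n j q b v * n j' q' b' v)"
  using bd_mono[OF bd_mult[OF n_bd n_bd]] Bd1 by (simp add: power2_eq_square)

lemma bd_n: "bd Bd (n j q b)"
  using bd_mono[OF n_bd] Bd1 m_le_msq by (meson order.trans)

lemma n_double':
  assumes "q \<in> Q" "q' \<in> Q" "b < q" "b' < q'" "j < J" "past (j * S) g" "bd C g"
  shows "E (\<lambda>v. g v * (n j q b v * n j q' b' v)) \<le> Sb q b q' b' * E g + C * \<theta>'"
  unfolding \<theta>'_def using assms Q_pos Q_coprime_P Q_coprime q_le_B Q_le by (intro n_double) auto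

lemma n_single':
  assumes "q \<in> Q" "b < q" "j < J" "past (j * S) g" "bd C g"
  shows "E (\<lambda>v. g v * n j q b v) \<ge> \<beta> / real q * E g - C * \<theta>'"
proof -
  have "E (\<lambda>v. g v * n j q b v) \<ge> \<beta> / real q * E g - C * (real m * \<theta>)"
    using n_single[of j g C q b] assms Q_pos Q_coprime_P q_le_B by (simp add: abs_le_iff)
  moreover have "C * (real m * \<theta>) \<le> C * \<theta>'"
    using bd_nonneg[OF assms(5)] theta_le by (intro mult_left_mono)
  ultimately show ?thesis by linarith
qed

lemma Sb_pow_le:
  assumes "q \<in> Q" "b < q" "b' < q"
  shows "Sb q b q b' ^ J \<le> (\<beta>\<^sup>2 / (real q * real q)) ^ J * ((1 + \<xi>) + of_bool (b = b') * (\<xi> * real q))"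
proof -
  have "(1 + (2 * real H + coll q b q b') / \<beta>) ^ J \<le> (1 + \<xi>) + of_bool (b = b') * (\<xi> * real q)"
  proof (cases "b = b'")
    case True
    thus ?thesis using Dq1[OF assms(1)] xi_nonneg by (simp add: coll_def)
  next
    case False
    have "(1 + (2 * real H + coll q b q b') / \<beta>) ^ J \<le> (1 + (2 * real H + 1) / \<beta>) ^ J"
      using False beta_pos by (intro power_mono add_left_mono divide_right_mono) (auto simp: coll_def)
    thus ?thesis using gam False by simp
  qed
  thus ?thesis unfolding Sb_def power_mult_distrib by (intro mult_left_mono) auto
qed

text \<open>The diagonal \<open>b = b'\<close> consists of only \<open>q\<close> of the
  \<open>q\<^sup>2\<close> pairs, and its terms exceed the main term by a factor of at most about
  \<open>\<xi> * q\<close>; so it adds another \<open>\<xi>\<close> to the one from the remaining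
  pairs.\<close>

lemma W_sq:
  assumes q: "q \<in> Q"
  shows "E (\<lambda>v. (W q v)\<^sup>2) \<le> (G q)\<^sup>2 * (1 + 2 * \<xi>) + (real q)\<^sup>2 * \<eta>"
proof -
  have "(W q v)\<^sup>2 = (\<Sum>b<q. \<Sum>b'<q. \<Prod>j<J. (n j q b v * n j q b' v))" for v
    unfolding W_def power2_eq_square sum_product by (simp only: prod.distrib)
  hence "E (\<lambda>v. (W q v)\<^sup>2) = (\<Sum>b<q. \<Sum>b'<q. E (\<lambda>v. \<Prod>j<J. (n j q b v * n j q b' v)))"
    by (simp add: E_sum)
  also have "\<dots> \<le> (\<Sum>b<q. \<Sum>b'<q. (\<beta>\<^sup>2 / (real q * real q)) ^ J * ((1 + \<xi>) + of_bool (b = b') * (\<xi> * real q)) + \<eta>)"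
  proof (intro sum_mono)
    fix b b' assume b: "b \<in> {..<q}" "b' \<in> {..<q}"
    have "E (\<lambda>v. \<Prod>j<J. (n j q b v * n j q b' v)) \<le> (\<Prod>j<J. Sb q b q b') + \<eta>"
      unfolding \<eta>_def
    proof (rule conjunct1[OF E_prod_upper])
      fix j assume "j < J"
      show "past (Suc j * S) (\<lambda>v. n j q b v * n j q b' v)" by (intro past_mult n_past)
      show "0 \<le> Sb q b q b' \<and> Sb q b q b' \<le> Bd" using Sb_le[OF q q] Sb_nonneg by blast
    qed (use q b n_double' bd_nn Bd_ge1 theta'_nonneg in auto)
    thus "E (\<lambda>v. \<Prod>j<J. (n j q b v * n j q b' v)) \<le>
       (\<beta>\<^sup>2 / (real q * real q)) ^ J * ((1 + \<xi>) + of_bool (b = b') * (\<xi> * real q)) + \<eta>"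
      using Sb_pow_le[OF q, of b b'] b by simp
  qed
  also have "\<dots> = (\<beta>\<^sup>2 / (real q * real q)) ^ J * ((real q)\<^sup>2 * (1 + \<xi>) + real q * (\<xi> * real q)) + (real q)\<^sup>2 * \<eta>"
  proof -
    have "(\<Sum>b'<q. of_bool (b = b') * (\<xi> * real q)) = \<xi> * real q" if "b < q" for b
    proof -
      have "(\<Sum>b'<q. of_bool (b = b') * (\<xi> * real q)) = (\<Sum>b'<q. if b' = b then \<xi> * real q else 0)"
        by (intro sum.cong) auto
      thus ?thesis using that by simp
    qed
    hence "(\<Sum>b<q. \<Sum>b'<q. (1 + \<xi>) + of_bool (b = b') * (\<xi> * real q)) =
      (real q)\<^sup>2 * (1 + \<xi>) + real q * (\<xi> * real q)"
      unfolding sum.distrib by (simp add: power2_eq_square algebra_simps)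
    thus ?thesis unfolding sum.distrib sum_distrib_left[symmetric] by (simp add: power2_eq_square)
  qed
  also have "(\<beta>\<^sup>2 / (real q * real q)) ^ J = ((\<beta> / real q) ^ J)\<^sup>2"
    by (simp add: power_divide power2_eq_square flip: power_mult_distrib)
  finally show ?thesis by (simp add: G_def power2_eq_square algebra_simps)
qed

lemma W_lower:
  assumes q: "q \<in> Q"
  shows "E (W q) \<ge> G q - real q * \<eta>"
proof -
  have "E (W q) = (\<Sum>b<q. E (\<lambda>v. \<Prod>j<J. n j q b v))"
    unfolding W_def[abs_def] by (simp add: E_sum)
  also have "\<dots> \<ge> (\<Sum>b<q. (\<Prod>j<J. \<beta> / real q) - \<eta>)"
  proof (intro sum_mono)
    fix b assume b: "b \<in> {..<q}"
    show "E (\<lambda>v. \<Prod>j<J. n j q b v) \<ge> (\<Prod>j<J. \<beta> / real q) - \<eta>"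
      unfolding \<eta>_def
    proof (rule conjunct1[OF E_prod_lower])
      fix j assume "j < J"
      show "0 \<le> \<beta> / real q \<and> \<beta> / real q \<le> Bd" using beta_div_le[OF q] beta_pos by simp
    qed (use q b n_single' bd_n n_past Bd_ge1 theta'_nonneg in auto)
  qed
  finally show ?thesis by (simp add: G_def algebra_simps)
qed

lemma W_var:
  assumes q: "q \<in> Q"
  shows "E (\<lambda>v. (W q v - G q)\<^sup>2) \<le> 3 * \<xi> * (G q)\<^sup>2"
proof -
  have "(W q v - G q)\<^sup>2 = (W q v)\<^sup>2 + (G q)\<^sup>2 - 2 * G q * W q v" for v
    by (simp add: power2_diff)
  hence "E (\<lambda>v. (W q v - G q)\<^sup>2) = E (\<lambda>v. (W q v)\<^sup>2) + (G q)\<^sup>2 - 2 * G q * E (W q)"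
    by (simp add: E_diff E_add E_const E_cmult)
  also have "\<dots> \<le> (G q)\<^sup>2 * (1 + 2 * \<xi>) + (real q)\<^sup>2 * \<eta> + (G q)\<^sup>2 - 2 * G q * (G q - real q * \<eta>)"
    using W_sq[OF q] W_lower[OF q] G_pos[OF q] by (intro diff_mono add_mono mult_left_mono) auto
  also have "\<dots> = 2 * \<xi> * (G q)\<^sup>2 + \<eta> * ((real q)\<^sup>2 + 2 * G q * real q)"
    by (simp add: power2_eq_square algebra_simps)
  also have "\<eta> * ((real q)\<^sup>2 + 2 * G q * real q) \<le> \<eta> * (3 * \<Lambda>\<^sup>2 * (G q)\<^sup>2)"
  proof (intro mult_left_mono eta_nonneg)
    have "(real q)\<^sup>2 \<le> (\<Lambda> * G q)\<^sup>2" using q_le_G[OF q] by (intro power_mono) auto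
    moreover have "2 * G q * real q \<le> 2 * G q * (\<Lambda> * G q)"
      using q_le_G[OF q] G_pos[OF q] by (intro mult_left_mono) auto
    moreover have "2 * G q * (\<Lambda> * G q) \<le> 2 * G q * (\<Lambda>\<^sup>2 * G q)" using Lam1 G_pos[OF q]
      by (intro mult_left_mono mult_right_mono) (auto simp: power2_eq_square)
    ultimately show "(real q)\<^sup>2 + 2 * G q * real q \<le> 3 * \<Lambda>\<^sup>2 * (G q)\<^sup>2"
      by (simp add: power2_eq_square algebra_simps)
  qed
  also have "\<eta> * (3 * \<Lambda>\<^sup>2 * (G q)\<^sup>2) = (3 * \<eta> * \<Lambda>\<^sup>2) * (G q)\<^sup>2" by simp
  also have "2 * \<xi> * (G q)\<^sup>2 + (3 * \<eta> * \<Lambda>\<^sup>2) * (G q)\<^sup>2 \<le> 2 * \<xi> * (G q)\<^sup>2 + \<xi> * (G q)\<^sup>2"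
  proof (intro add_left_mono mult_right_mono)
    have "0 \<le> \<eta> * \<Lambda>\<^sup>2" using eta_nonneg by simp
    thus "3 * \<eta> * \<Lambda>\<^sup>2 \<le> \<xi>" using err''(1) by simp
  qed auto
  finally show ?thesis by simp
qed

text \<open>The case \<open>q = 1\<close>, \<open>b = 0\<close> of the moment bounds, where
  \<open>n j 1 0\<close> counts all survivors of segment \<open>j\<close>.\<close>

lemma count_var:
  assumes j: "j < J"
  shows "E (\<lambda>v. (n j 1 0 v - \<beta>)\<^sup>2) \<le> 2 * \<xi> * \<beta>\<^sup>2"
proof -
  have one: "past (j * S) (\<lambda>v. 1)" "bd 1 (\<lambda>v. 1)" by (auto simp: past_const bd_def)
  have "E (\<lambda>v. 1 * (n j 1 0 v * n j 1 0 v)) \<le> Sb 1 0 1 0 * E (\<lambda>v. 1) + 1 * (2 * (real m)\<^sup>2 * \<theta>)"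
    using one j one_le_B by (intro n_double) auto
  hence 1: "E (\<lambda>v. n j 1 0 v * n j 1 0 v) \<le> Sb 1 0 1 0 + \<theta>'" by (simp add: E_const \<theta>'_def)
  have "1 + (2 * real H + 1) / \<beta> \<le> 1 + \<xi>" using beta_pos by (intro pow_J1(2)[OF _ gam]) simp
  hence 2: "Sb 1 0 1 0 \<le> \<beta>\<^sup>2 * (1 + \<xi>)" unfolding Sb_def coll_def
    by (simp add: mult_left_mono)
  have "\<bar>E (\<lambda>v. 1 * n j 1 0 v) - \<beta> / real 1 * E (\<lambda>v. 1)\<bar> \<le> 1 * (real m * \<theta>)"
    using one j one_le_B by (intro n_single) auto
  hence 3: "E (n j 1 0) \<ge> \<beta> - \<theta>'" using theta_le(1) by (simp add: E_const abs_le_iff)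
  have "(n j 1 0 v - \<beta>)\<^sup>2 = n j 1 0 v * n j 1 0 v + \<beta>\<^sup>2 - 2 * \<beta> * n j 1 0 v" for v
    by (simp add: power2_eq_square algebra_simps)
  hence "E (\<lambda>v. (n j 1 0 v - \<beta>)\<^sup>2) = E (\<lambda>v. n j 1 0 v * n j 1 0 v) + \<beta>\<^sup>2 - 2 * \<beta> * E (n j 1 0)"
    by (simp add: E_diff E_add E_const E_cmult)
  also have "\<dots> \<le> (\<beta>\<^sup>2 * (1 + \<xi>) + \<theta>') + \<beta>\<^sup>2 - 2 * \<beta> * (\<beta> - \<theta>')"
    using 1 2 3 beta_pos by (intro diff_mono add_mono mult_left_mono) auto
  also have "\<dots> = \<xi> * \<beta>\<^sup>2 + \<theta>' * (1 + 2 * \<beta>)" by (simp add: power2_eq_square algebra_simps)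
  also have "\<theta>' * (1 + 2 * \<beta>) \<le> \<eta> * (3 * \<beta>\<^sup>2)"
  proof (intro mult_mono)
    have "\<beta> * 1 \<le> \<beta> * \<beta>" using beta1 by (intro mult_left_mono) auto
    thus "1 + 2 * \<beta> \<le> 3 * \<beta>\<^sup>2" using beta1 unfolding power2_eq_square by linarith
  qed (use theta'_le_eta eta_nonneg beta1 in auto)
  also have "\<eta> * (3 * \<beta>\<^sup>2) = (3 * \<eta>) * \<beta>\<^sup>2" by simp
  also have "\<dots> \<le> \<xi> * \<beta>\<^sup>2" using err''(2) eta_nonneg by (intro mult_right_mono) auto
  finally show ?thesis by simp
qed

text \<open>For a survivor with index \<open>(j0, i0)\<close> this is the expected number of primes that hit it when the
  classes are drawn proportionally to their numbers of tuples, with \<open>W q\<close> replaced by its mean.\<close>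

definition \<Phi> :: "nat \<Rightarrow> nat \<Rightarrow> 'a \<Rightarrow> real" where
  "\<Phi> j0 i0 v = (\<Sum>q\<in>Q. (1 / G q) * (\<Prod>j\<in>{..<J} - {j0}. n j q (X (e j0 i0) v mod q) v))"

section \<open>Expected number of primes hitting a survivor\<close>

definition f :: "nat \<Rightarrow> nat \<Rightarrow> nat \<Rightarrow> nat \<Rightarrow> nat \<Rightarrow> 'a \<Rightarrow> real" where
  "f j0 i0 q b j = (if j = j0 then h q b (e j0 i0) else n j q b)"

definition A :: "nat \<Rightarrow> nat \<Rightarrow> nat \<Rightarrow> 'a \<Rightarrow> real" where
  "A j0 i0 q v = (1 / G q) * (\<Sum>b<q. \<Prod>j<J. f j0 i0 q b j v)"

text \<open>The class in \<open>\<Phi>\<close> depends on \<open>v\<close>. Summing over all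
  \<open>b\<close> with the factor of segment \<open>j0\<close> pinned to \<open>e j0 i0\<close>
  turns it into fixed classes, to which the product estimates apply.\<close>

lemma t_Phi:
  assumes j0: "j0 < J"
  shows "t (e j0 i0) v * \<Phi> j0 i0 v = (\<Sum>q\<in>Q. A j0 i0 q v)"
  unfolding \<Phi>_def sum_distrib_left
proof (rule sum.cong[OF refl])
  fix q assume q: "q \<in> Q"
  let ?k = "e j0 i0"
  let ?r = "\<lambda>b. \<Prod>j\<in>{..<J} - {j0}. n j q b v"
  have "(\<Prod>j<J. f j0 i0 q b j v) = (if b = X ?k v mod q then t ?k v * ?r b else 0)" for b
  proof -
    have "(\<Prod>j<J. f j0 i0 q b j v) = f j0 i0 q b j0 v * (\<Prod>j\<in>{..<J} - {j0}. f j0 i0 q b j v)"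
      using j0 by (intro prod.remove) auto
    also have "(\<Prod>j\<in>{..<J} - {j0}. f j0 i0 q b j v) = ?r b"
      by (intro prod.cong) (auto simp: f_def)
    finally show ?thesis by (auto simp: f_def h_def)
  qed
  hence "(\<Sum>b<q. \<Prod>j<J. f j0 i0 q b j v) = t ?k v * ?r (X ?k v mod q)"
    using Q_pos[OF q] by simp
  thus "t ?k v * (1 / G q * ?r (X ?k v mod q)) = A j0 i0 q v" by (simp add: A_def)
qed

lemma bd_h_Bd: "bd Bd (h q b k)" using bd_mono[OF h_bd Bd_ge1] .

lemma f_props:
  assumes "j < J" "i0 < m"
  shows "past (Suc j * S) (f j0 i0 q b j)" "bd Bd (f j0 i0 q b j)"
    "bd Bd (\<lambda>v. f j0 i0 q b j v * f j0 i0 q' b' j v)"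
proof -
  show "past (Suc j * S) (f j0 i0 q b j)"
    using assms n_past h_past[OF e_upper] by (auto simp: f_def)
  show "bd Bd (f j0 i0 q b j)" using bd_n bd_h_Bd by (auto simp: f_def)
  show "bd Bd (\<lambda>v. f j0 i0 q b j v * f j0 i0 q' b' j v)"
    using bd_nn bd_mono[OF bd_mult[OF h_bd h_bd]] Bd_ge1 by (auto simp: f_def)
qed

lemma f_double:
  assumes "q \<in> Q" "q' \<in> Q" "b < q" "b' < q'" "j < J" "j0 < J" "i0 < m" "past (j * S) g" "bd C g"
  shows "E (\<lambda>v. g v * (f j0 i0 q b j v * f j0 i0 q' b' j v)) \<le>
    (if j = j0 then V * coll q b q' b' / (real q * real q') else Sb q b q' b') * E g + C * \<theta>'"
proof (cases "j = j0")
  case False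
  thus ?thesis using n_double' assms by (simp add: f_def)
next
  case True
  have "E (\<lambda>v. g v * (h q b (e j0 i0) v * h q' b' (e j0 i0) v)) \<le>
      V * coll q b q' b' / (real q * real q') * E g + C * \<theta>"
    using True assms Q_pos Q_le q_le_B Q_coprime Q_coprime_P
    by (intro h_same[of "j0 * S"] e_lower e_le_T) auto
  also have "C * \<theta> \<le> C * \<theta>'" using bd_nonneg[OF assms(9)] theta_le by (intro mult_left_mono)
  finally show ?thesis using True by (simp add: f_def)
qed

lemma f_single:
  assumes "q \<in> Q" "b < q" "j < J" "j0 < J" "i0 < m" "past (j * S) g" "bd C g"
  shows "E (\<lambda>v. g v * f j0 i0 q b j v) \<ge>
    (if j = j0 then V / real q else \<beta> / real q) * E g - C * \<theta>'"
proof (cases "j = j0")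
  case False
  thus ?thesis using n_single' assms by (simp add: f_def)
next
  case True
  have "\<bar>E (\<lambda>v. g v * h q b (e j0 i0) v) - V / real q * E g\<bar> \<le> C * \<theta>"
    using True assms Q_pos q_le_B Q_coprime_P
    by (intro h_single[of "j0 * S"] e_lower e_le_T) auto
  moreover have "C * \<theta> \<le> C * \<theta>'" using bd_nonneg[OF assms(7)] theta_le by (intro mult_left_mono)
  ultimately show ?thesis using True by (simp add: f_def abs_le_iff)
qed

lemma prod_if_remove:
  fixes x y :: real
  assumes "j0 < J"
  shows "(\<Prod>j<J. if j = j0 then x else y) = x * y ^ (J - 1)"
proof -
  have "(\<Prod>j<J. if j = j0 then x else y) = x * (\<Prod>j\<in>{..<J} - {j0}. if j = j0 then x else y)"
    using assms by (subst prod.remove[of _ j0]) auto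
  also have "(\<Prod>j\<in>{..<J} - {j0}. if j = j0 then x else y) = (\<Prod>j\<in>{..<J} - {j0}. y)"
    by (intro prod.cong) auto
  finally show ?thesis using assms by (simp add: card_Diff_singleton)
qed

definition \<tau> :: "nat \<Rightarrow> nat \<Rightarrow> real" where "\<tau> q q' = (if q = q' then \<xi> * N else 1 + \<xi>)"

text \<open>The scheme of \<open>W_sq\<close>, except that segment \<open>j0\<close> contributes a
  single exponent and hence \<open>V\<close>. For \<open>q = q'\<close> only \<open>b = b'\<close>
  remains, and \<open>Dq2\<close> bounds the excess by \<open>\<xi> * N\<close>, so the
  \<open>N\<close> pairs of equal primes weigh at most \<open>\<xi>\<close> times all
  \<open>N\<^sup>2\<close> pairs.\<close>

lemma E_A_A:
  assumes q: "q \<in> Q" "q' \<in> Q" and j0: "j0 < J" "i0 < m"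
  shows "E (\<lambda>v. A j0 i0 q v * A j0 i0 q' v) \<le> V / \<beta>\<^sup>2 * \<tau> q q' + \<Lambda>\<^sup>2 * \<eta>"
proof -
  define D where "D = real q * real q'"
  have qp: "real q > 0" "real q' > 0" using Q_pos q by auto
  have D: "D > 0" using qp by (simp add: D_def)
  define c where "c b b' = (if q = q' then of_bool (b = b') * (real q * (\<xi> * N)) else 1 + \<xi>)" for b b' :: nat
  have bound: "E (\<lambda>v. \<Prod>j<J. f j0 i0 q b j v * f j0 i0 q' b' j v) \<le> V / D * (\<beta>\<^sup>2 / D) ^ (J - 1) * c b b' + \<eta>"
    if b: "b < q" "b' < q'" for b b'
  proof -
    let ?s = "\<lambda>j. if j = j0 then V * coll q b q' b' / (real q * real q') else Sb q b q' b'"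
    have "E (\<lambda>v. \<Prod>j<J. f j0 i0 q b j v * f j0 i0 q' b' j v) \<le> (\<Prod>j<J. ?s j) + \<eta>"
      unfolding \<eta>_def
    proof (rule conjunct1[OF E_prod_upper])
      fix j assume j: "j < J"
      show "past (Suc j * S) (\<lambda>v. f j0 i0 q b j v * f j0 i0 q' b' j v)"
        using j j0 by (intro past_mult f_props)
      have q1: "1 \<le> real q" "1 \<le> real q'" using Q_pos q by (simp_all add: Suc_leI)
      have qq: "real q \<le> real q * real q'" using mult_left_mono[OF q1(2), of "real q"] by simp
      moreover have "1 \<le> real q * real q'" using q1 qq by linarith
      ultimately have "coll q b q' b' \<le> real q * real q'" unfolding coll_def by auto
      hence "V * (coll q b q' b' / (real q * real q')) \<le> 1 * 1"
        using V_nonneg V_le_1 qp coll_nonneg by (intro mult_mono) auto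
      hence "V * coll q b q' b' / (real q * real q') \<le> Bd" using Bd_ge1 unfolding times_divide_eq_right by linarith
      thus "0 \<le> ?s j \<and> ?s j \<le> Bd"
        using V_nonneg coll_nonneg[of q b q' b'] Sb_le[OF q, of b b'] Sb_nonneg[of q b q' b'] qp by auto
    qed (use q b j0 f_props f_double Bd_ge1 theta'_nonneg in auto)
    also have "(\<Prod>j<J. ?s j) = V * coll q b q' b' / D * Sb q b q' b' ^ (J - 1)"
      using j0(1) by (subst prod_if_remove) (auto simp: D_def)
    also have "\<dots> = V / D * (\<beta>\<^sup>2 / D) ^ (J - 1) * (coll q b q' b' * (1 + (2 * real H + coll q b q' b') / \<beta>) ^ (J - 1))"
      unfolding Sb_def D_def[symmetric] power_mult_distrib by simp
    also have "\<dots> \<le> V / D * (\<beta>\<^sup>2 / D) ^ (J - 1) * c b b'"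
    proof (intro mult_left_mono)
      show "coll q b q' b' * (1 + (2 * real H + coll q b q' b') / \<beta>) ^ (J - 1) \<le> c b b'"
      proof (cases "q = q'")
        case True
        show ?thesis
        proof (cases "b = b'")
          case bT: True
          have "(1 + (2 * real H + real q) / \<beta>) ^ (J - 1) \<le> \<xi> * N"
            unfolding N_def using beta_pos by (intro pow_J1(1)[OF _ Dq2[OF q(1)]]) simp
          thus ?thesis using True bT qp by (auto simp: c_def coll_def intro!: mult_left_mono)
        qed (use True in \<open>simp add: coll_def c_def\<close>)
      next
        case False
        have "(1 + (2 * real H + 1) / \<beta>) ^ (J - 1) \<le> 1 + \<xi>"
          using beta_pos by (intro pow_J1(1)[OF _ gam]) simp
        thus ?thesis using False by (simp add: c_def coll_def)
      qed
    qed (use V_nonneg D in auto)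
    finally show ?thesis by simp
  qed
  have GG: "G q * G q' = D * (\<beta>\<^sup>2 / D) ^ J"
    unfolding G_def D_def by (simp add: power2_eq_square mult_ac power_divide power_mult_distrib)
  have Gp: "G q > 0" "G q' > 0" using G_pos q by auto
  have "A j0 i0 q v * A j0 i0 q' v = (1 / (G q * G q')) * (\<Sum>b<q. \<Sum>b'<q'. \<Prod>j<J. f j0 i0 q b j v * f j0 i0 q' b' j v)" for v
  proof -
    have "A j0 i0 q v * A j0 i0 q' v = (1 / (G q * G q')) *
       ((\<Sum>b<q. \<Prod>j<J. f j0 i0 q b j v) * (\<Sum>b<q'. \<Prod>j<J. f j0 i0 q' b j v))"
      by (simp add: A_def)
    thus ?thesis unfolding sum_product by (simp only: prod.distrib)
  qed
  hence "E (\<lambda>v. A j0 i0 q v * A j0 i0 q' v) = (1 / (G q * G q')) * (\<Sum>b<q. \<Sum>b'<q'. E (\<lambda>v. \<Prod>j<J. f j0 i0 q b j v * f j0 i0 q' b' j v))"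
    by (simp only: E_cmult E_sum)
  also have "\<dots> \<le> (1 / (G q * G q')) * (\<Sum>b<q. \<Sum>b'<q'. V / D * (\<beta>\<^sup>2 / D) ^ (J - 1) * c b b' + \<eta>)"
    using Gp bound by (intro mult_left_mono sum_mono) auto
  also have "(\<Sum>b<q. \<Sum>b'<q'. V / D * (\<beta>\<^sup>2 / D) ^ (J - 1) * c b b' + \<eta>) =
      V / D * (\<beta>\<^sup>2 / D) ^ (J - 1) * (\<Sum>b<q. \<Sum>b'<q'. c b b') + D * \<eta>"
    unfolding sum.distrib sum_distrib_left[symmetric] by (simp add: D_def)
  also have "(\<Sum>b<q. \<Sum>b'<q'. c b b') = D * \<tau> q q'"
  proof (cases "q = q'")
    case True
    have "(\<Sum>b'<q. of_bool (b = b') * (real q * (\<xi> * N))) = real q * (\<xi> * N)" if "b < q" for b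
    proof -
      have "(\<Sum>b'<q. of_bool (b = b') * (real q * (\<xi> * N))) = (\<Sum>b'<q. if b' = b then real q * (\<xi> * N) else 0)"
        by (intro sum.cong) auto
      thus ?thesis using that by simp
    qed
    thus ?thesis using True by (simp add: c_def \<tau>_def D_def)
  next
    case False
    thus ?thesis by (simp add: c_def \<tau>_def D_def)
  qed
  also have "(1 / (G q * G q')) * (V / D * (\<beta>\<^sup>2 / D) ^ (J - 1) * (D * \<tau> q q') + D * \<eta>) =
      V / \<beta>\<^sup>2 * \<tau> q q' + D / (G q * G q') * \<eta>"
  proof -
    have "(\<beta>\<^sup>2 / D) ^ J = \<beta>\<^sup>2 / D * (\<beta>\<^sup>2 / D) ^ (J - 1)"
      using J_pos by (metis Suc_diff_1 power_Suc)
    moreover have "(\<beta>\<^sup>2 / D) ^ (J - 1) > 0" using beta_pos D by simp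
    ultimately have "(1 / (G q * G q')) * (V / D * (\<beta>\<^sup>2 / D) ^ (J - 1) * (D * \<tau> q q')) = V / \<beta>\<^sup>2 * \<tau> q q'"
      unfolding GG using D beta_pos by (simp add: field_simps)
    thus ?thesis by (simp add: distrib_left)
  qed
  also have "D / (G q * G q') * \<eta> \<le> \<Lambda>\<^sup>2 * \<eta>"
  proof (intro mult_right_mono eta_nonneg)
    have "D \<le> (\<Lambda> * G q) * (\<Lambda> * G q')" unfolding D_def using q_le_G q qp Gp Lam1
      by (intro mult_mono) auto
    thus "D / (G q * G q') \<le> \<Lambda>\<^sup>2" using Gp by (simp add: field_simps power2_eq_square)
  qed
  finally show ?thesis by simp
qed

lemma E_A_lower:
  assumes q: "q \<in> Q" and j0: "j0 < J" "i0 < m"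
  shows "E (A j0 i0 q) \<ge> V / \<beta> - \<Lambda> * \<eta>"
proof -
  have qp: "real q > 0" using Q_pos q by auto
  have Gp: "G q > 0" using G_pos q by auto
  have bound: "E (\<lambda>v. \<Prod>j<J. f j0 i0 q b j v) \<ge> V / real q * (\<beta> / real q) ^ (J - 1) - \<eta>" if b: "b < q" for b
  proof -
    let ?s = "\<lambda>j. if j = j0 then V / real q else \<beta> / real q"
    have "E (\<lambda>v. \<Prod>j<J. f j0 i0 q b j v) \<ge> (\<Prod>j<J. ?s j) - \<eta>"
      unfolding \<eta>_def
    proof (rule conjunct1[OF E_prod_lower])
      fix j assume j: "j < J"
      have "V / real q \<le> 1" using V_le_1 Q_pos[OF q] by (simp add: divide_le_eq)
      thus "0 \<le> ?s j \<and> ?s j \<le> Bd" using V_nonneg beta_div_le[OF q] Bd_ge1 beta_pos by auto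
      fix g C assume "past (j * S) g" "bd C g"
      thus "E (\<lambda>v. g v * f j0 i0 q b j v) \<ge> ?s j * E g - C * \<theta>'"
        using q b j j0 by (intro f_single)
    qed (use q b j0 f_props Bd_ge1 theta'_nonneg in auto)
    also have "(\<Prod>j<J. ?s j) = V / real q * (\<beta> / real q) ^ (J - 1)"
      using j0(1) by (rule prod_if_remove)
    finally show ?thesis .
  qed
  have "V / \<beta> - \<Lambda> * \<eta> \<le> V / \<beta> - real q / G q * \<eta>"
    using q_le_G[OF q] Gp by (intro diff_left_mono mult_right_mono eta_nonneg) (simp add: field_simps)
  also have "\<dots> = (1 / G q) * (\<Sum>b<q. V / real q * (\<beta> / real q) ^ (J - 1) - \<eta>)"
  proof -
    have "(\<beta> / real q) ^ J = \<beta> / real q * (\<beta> / real q) ^ (J - 1)"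
      using J_pos by (metis Suc_diff_1 power_Suc)
    moreover have "(\<beta> / real q) ^ (J - 1) > 0" using beta_pos qp by simp
    ultimately have "(1 / G q) * (real q * (V / real q * (\<beta> / real q) ^ (J - 1))) = V / \<beta>"
      unfolding G_def using qp beta_pos by (simp add: field_simps)
    thus ?thesis by (simp add: algebra_simps)
  qed
  also have "\<dots> \<le> (1 / G q) * (\<Sum>b<q. E (\<lambda>v. \<Prod>j<J. f j0 i0 q b j v))"
    using Gp bound by (intro mult_left_mono sum_mono) auto
  also have "\<dots> = E (A j0 i0 q)" unfolding A_def[abs_def] by (simp only: E_cmult E_sum)
  finally show ?thesis .
qed

text \<open>On expanding the square, every term has as main part a multiple of
  \<open>V * \<mu>\<^sup>2\<close>, and these cancel. The factor \<open>V\<close> in the bound, due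
  to \<open>t\<close>, makes its sum over the \<open>m\<close> exponents of a segment proportional
  to \<open>\<beta>\<close>.\<close>

lemma Phi_var:
  assumes j0: "j0 < J" "i0 < m"
  shows "E (\<lambda>v. t (e j0 i0) v * (\<Phi> j0 i0 v - \<mu>)\<^sup>2) \<le> 3 * \<xi> * V * \<mu>\<^sup>2"
proof -
  let ?t = "t (e j0 i0)" and ?A = "A j0 i0"
  have NQ: "real (card Q) = N" by (simp add: N_def)
  have sq: "?t v * (\<Phi> j0 i0 v - \<mu>)\<^sup>2 = (\<Sum>q\<in>Q. \<Sum>q'\<in>Q. ?A q v * ?A q' v) - 2 * \<mu> * (\<Sum>q\<in>Q. ?A q v) + \<mu>\<^sup>2 * ?t v" for v
  proof -
    have tt: "?t v * ?t v = ?t v" by (simp add: t_def)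
    have "(\<Sum>q\<in>Q. \<Sum>q'\<in>Q. ?A q v * ?A q' v) = (?t v * \<Phi> j0 i0 v) * (?t v * \<Phi> j0 i0 v)"
      unfolding t_Phi[OF j0(1)] sum_product ..
    also have "\<dots> = (?t v * ?t v) * (\<Phi> j0 i0 v)\<^sup>2" by (simp add: power2_eq_square)
    also have "\<dots> = ?t v * (\<Phi> j0 i0 v)\<^sup>2" by (simp only: tt)
    finally show ?thesis unfolding t_Phi[OF j0(1), symmetric] by (simp add: power2_eq_square algebra_simps)
  qed
  have 1: "(\<Sum>q\<in>Q. \<Sum>q'\<in>Q. E (\<lambda>v. ?A q v * ?A q' v)) \<le> V / \<beta>\<^sup>2 * (N\<^sup>2 * (1 + 2 * \<xi>)) + N\<^sup>2 * (\<Lambda>\<^sup>2 * \<eta>)"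
  proof -
    have "(\<Sum>q\<in>Q. \<Sum>q'\<in>Q. E (\<lambda>v. ?A q v * ?A q' v)) \<le> (\<Sum>q\<in>Q. \<Sum>q'\<in>Q. V / \<beta>\<^sup>2 * \<tau> q q' + \<Lambda>\<^sup>2 * \<eta>)"
      using E_A_A j0 by (intro sum_mono) auto
    also have "\<dots> = V / \<beta>\<^sup>2 * (\<Sum>q\<in>Q. \<Sum>q'\<in>Q. \<tau> q q') + N\<^sup>2 * (\<Lambda>\<^sup>2 * \<eta>)"
      unfolding sum.distrib sum_distrib_left[symmetric] by (simp add: NQ power2_eq_square)
    also have "(\<Sum>q\<in>Q. \<Sum>q'\<in>Q. \<tau> q q') \<le> (\<Sum>q\<in>Q. \<Sum>q'\<in>Q. (if q' = q then \<xi> * N else 0) + (1 + \<xi>))"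
      using xi_nonneg N_pos by (intro sum_mono) (auto simp: \<tau>_def)
    also have "\<dots> = N * (\<xi> * N) + N * (N * (1 + \<xi>))"
      unfolding sum.distrib using Q_fin by (simp add: NQ algebra_simps)
    also have "\<dots> = N\<^sup>2 * (1 + 2 * \<xi>)" by (simp add: power2_eq_square algebra_simps)
    finally show ?thesis using V_nonneg by (simp add: divide_right_mono mult_left_mono)
  qed
  have 2: "(\<Sum>q\<in>Q. E (?A q)) \<ge> N * (V / \<beta> - \<Lambda> * \<eta>)"
  proof -
    have "(\<Sum>q\<in>Q. E (?A q)) \<ge> (\<Sum>q\<in>Q. V / \<beta> - \<Lambda> * \<eta>)" using E_A_lower j0 by (intro sum_mono) auto
    thus ?thesis by (simp add: NQ)
  qed
  have 3: "E ?t \<le> V + \<eta>"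
  proof -
    have h1: "h 1 0 (e j0 i0) v = ?t v" for v by (simp add: h_def)
    have "\<bar>E (\<lambda>v. 1 * h 1 0 (e j0 i0) v) - V / real 1 * E (\<lambda>v. 1)\<bar> \<le> 1 * \<theta>"
      using j0 one_le_B by (intro h_single[of "j0 * S"] e_lower e_le_T past_const) (auto simp: bd_def)
    thus ?thesis unfolding h1 using theta_le theta'_le_eta by (simp add: E_const abs_le_iff)
  qed
  have Nm: "N = \<mu> * \<beta>" using beta_pos by (simp add: \<mu>_def)
  have "E (\<lambda>v. ?t v * (\<Phi> j0 i0 v - \<mu>)\<^sup>2) =
     (\<Sum>q\<in>Q. \<Sum>q'\<in>Q. E (\<lambda>v. ?A q v * ?A q' v)) - 2 * \<mu> * (\<Sum>q\<in>Q. E (?A q)) + \<mu>\<^sup>2 * E ?t"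
    unfolding sq by (simp add: E_add E_diff E_cmult E_sum)
  also have "\<dots> \<le> (V / \<beta>\<^sup>2 * (N\<^sup>2 * (1 + 2 * \<xi>)) + N\<^sup>2 * (\<Lambda>\<^sup>2 * \<eta>)) - 2 * \<mu> * (N * (V / \<beta> - \<Lambda> * \<eta>)) + \<mu>\<^sup>2 * (V + \<eta>)"
    using 1 2 3 mu_pos by (intro add_mono diff_mono mult_left_mono) auto
  also have "\<dots> = \<mu>\<^sup>2 * (2 * \<xi> * V + \<eta> * (\<beta>\<^sup>2 * \<Lambda>\<^sup>2 + 2 * (\<beta> * \<Lambda>) + 1))"
    unfolding Nm using beta_pos by (simp add: field_simps power2_eq_square)
  also have "\<dots> \<le> \<mu>\<^sup>2 * (2 * \<xi> * V + \<xi> * V)"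
  proof (intro mult_left_mono add_left_mono)
    have x: "1 \<le> \<beta> * \<Lambda>" using mult_mono[of 1 \<beta> 1 \<Lambda>] beta1 Lam1 by simp
    have "1 * (\<beta> * \<Lambda>) \<le> (\<beta> * \<Lambda>) * (\<beta> * \<Lambda>)" using x by (intro mult_right_mono) auto
    hence "\<beta> * \<Lambda> \<le> \<beta>\<^sup>2 * \<Lambda>\<^sup>2" by (simp add: power2_eq_square mult_ac)
    hence "\<beta>\<^sup>2 * \<Lambda>\<^sup>2 + 2 * (\<beta> * \<Lambda>) + 1 \<le> 4 * (\<beta>\<^sup>2 * \<Lambda>\<^sup>2)" using x by linarith
    hence "\<eta> * (\<beta>\<^sup>2 * \<Lambda>\<^sup>2 + 2 * (\<beta> * \<Lambda>) + 1) \<le> \<eta> * (4 * (\<beta>\<^sup>2 * \<Lambda>\<^sup>2))"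
      by (intro mult_left_mono eta_nonneg)
    thus "\<eta> * (\<beta>\<^sup>2 * \<Lambda>\<^sup>2 + 2 * (\<beta> * \<Lambda>) + 1) \<le> \<xi> * V" using err' by linarith
  qed auto
  finally show ?thesis by (simp add: algebra_simps)
qed

section \<open>Total error and choice of classes\<close>

text \<open>All that may go wrong in one residue class of exponents, measured in exponents left
  over: too many survivors, survivors with untypical \<open>\<Phi>\<close>, primes with untypical
  \<open>W\<close>. The coefficients 16 and 8 are those of
  \<open>exp_minus_le_quadratic\<close>.\<close>

definition Y :: "'a \<Rightarrow> real" where
  "Y v = (\<Sum>j<J. (n j 1 0 v - \<beta>)\<^sup>2 / \<beta>)
       + 16 / \<mu>\<^sup>2 * (\<Sum>j<J. \<Sum>i<m. t (e j i) v * (\<Phi> j i v - \<mu>)\<^sup>2)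
       + 8 * real J / \<mu> * (\<Sum>q\<in>Q. (W q v - G q)\<^sup>2 / (G q)\<^sup>2)"

lemma Y_nonneg: "0 \<le> Y v"
  unfolding Y_def using beta_pos mu_pos
  by (intro add_nonneg_nonneg mult_nonneg_nonneg sum_nonneg) (auto simp: t_def)

text \<open>\<open>74 = 2 + 48 + 24\<close>, from \<open>count_var\<close>, \<open>Phi_var\<close>
  and \<open>W_var\<close>.\<close>

lemma E_Y: "E Y \<le> 74 * real J * \<beta> * \<xi>"
proof -
  have "E Y = (\<Sum>j<J. (1 / \<beta>) * E (\<lambda>v. (n j 1 0 v - \<beta>)\<^sup>2))
       + 16 / \<mu>\<^sup>2 * (\<Sum>j<J. \<Sum>i<m. E (\<lambda>v. t (e j i) v * (\<Phi> j i v - \<mu>)\<^sup>2))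
       + 8 * real J / \<mu> * (\<Sum>q\<in>Q. (1 / (G q)\<^sup>2) * E (\<lambda>v. (W q v - G q)\<^sup>2))"
  proof -
    have "Y v = (\<Sum>j<J. (1 / \<beta>) * (n j 1 0 v - \<beta>)\<^sup>2)
       + 16 / \<mu>\<^sup>2 * (\<Sum>j<J. \<Sum>i<m. t (e j i) v * (\<Phi> j i v - \<mu>)\<^sup>2)
       + 8 * real J / \<mu> * (\<Sum>q\<in>Q. (1 / (G q)\<^sup>2) * (W q v - G q)\<^sup>2)" for v
      unfolding Y_def by simp
    hence "E Y = E (\<lambda>v. (\<Sum>j<J. (1 / \<beta>) * (n j 1 0 v - \<beta>)\<^sup>2)
       + 16 / \<mu>\<^sup>2 * (\<Sum>j<J. \<Sum>i<m. t (e j i) v * (\<Phi> j i v - \<mu>)\<^sup>2)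
       + 8 * real J / \<mu> * (\<Sum>q\<in>Q. (1 / (G q)\<^sup>2) * (W q v - G q)\<^sup>2))" by (intro E_cong)
    thus ?thesis by (simp only: E_add E_cmult E_sum)
  qed
  also have "\<dots> \<le> (\<Sum>j<J. (1 / \<beta>) * (2 * \<xi> * \<beta>\<^sup>2))
       + 16 / \<mu>\<^sup>2 * (\<Sum>j<J. \<Sum>i<m. 3 * \<xi> * V * \<mu>\<^sup>2)
       + 8 * real J / \<mu> * (\<Sum>q\<in>Q. (1 / (G q)\<^sup>2) * (3 * \<xi> * (G q)\<^sup>2))"
    using beta_pos mu_pos count_var Phi_var W_var
    by (intro add_mono mult_left_mono sum_mono) auto
  also have "(\<Sum>q\<in>Q. (1 / (G q)\<^sup>2) * (3 * \<xi> * (G q)\<^sup>2)) = (\<Sum>q\<in>Q. 3 * \<xi>)"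
    using G_pos by (intro sum.cong) force+
  also have "\<dots> = \<mu> * \<beta> * (3 * \<xi>)" using beta_pos by (simp add: \<mu>_def N_def)
  also have "(\<Sum>j<J. (1 / \<beta>) * (2 * \<xi> * \<beta>\<^sup>2)) + 16 / \<mu>\<^sup>2 * (\<Sum>j<J. \<Sum>i<m. 3 * \<xi> * V * \<mu>\<^sup>2)
       + 8 * real J / \<mu> * (\<mu> * \<beta> * (3 * \<xi>)) = 74 * real J * \<beta> * \<xi>"
    using beta_pos mu_pos by (simp add: \<beta>_def power2_eq_square field_simps)
  finally show ?thesis .
qed

text \<open>The maximum makes the denominator independent of \<open>v\<close> in the typical case \<open>W q v \<le> 2 * G q\<close>; the
  term \<open>loss\<close> accounts for the exceptional \<open>q\<close>.\<close>

definition \<pi> :: "'a \<Rightarrow> nat \<Rightarrow> nat \<Rightarrow> real" where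
  "\<pi> v q b = (\<Prod>j<J. n j q b v) / max (W q v) (2 * G q)"

definition loss :: "nat \<Rightarrow> nat \<Rightarrow> 'a \<Rightarrow> real" where
  "loss j0 i0 v = (\<Sum>q\<in>Q. of_bool (W q v > 2 * G q) / (2 * G q) *
      (\<Prod>j\<in>{..<J} - {j0}. n j q (X (e j0 i0) v mod q) v))"

text \<open>For a fixed prime and segment, summing the tuples through each survivor counts every
  \<open>J\<close>-tuple once and so gives \<open>W q\<close>. If \<open>W q > 2 * G q\<close>, then
  \<open>W q / (2 * G q)\<close> is at most the squared relative deviation of
  \<open>W q\<close>.\<close>

lemma sum_t_loss:
  assumes v: "v \<in> \<Omega>"
  shows "(\<Sum>j<J. \<Sum>i<m. t (e j i) v * loss j i v) \<le> real J * (\<Sum>q\<in>Q. (W q v - G q)\<^sup>2 / (G q)\<^sup>2)"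
proof -
  have inner: "(\<Sum>i<m. t (e j0 i) v * (\<Prod>j\<in>{..<J} - {j0}. n j q (X (e j0 i) v mod q) v)) = W q v"
    if j0: "j0 < J" and q: "q \<in> Q" for j0 q
  proof -
    let ?r = "\<lambda>b. \<Prod>j\<in>{..<J} - {j0}. n j q b v"
    have "W q v = (\<Sum>b<q. n j0 q b v * ?r b)"
      unfolding W_def using j0 by (intro sum.cong refl prod.remove) auto
    also have "\<dots> = (\<Sum>i<m. \<Sum>b<q. h q b (e j0 i) v * ?r b)"
      unfolding n_def[of j0] sum_distrib_right by (rule sum.swap)
    also have "\<dots> = (\<Sum>i<m. t (e j0 i) v * ?r (X (e j0 i) v mod q))"
    proof (intro sum.cong refl)
      fix i
      have "(\<Sum>b<q. h q b (e j0 i) v * ?r b) = (\<Sum>b<q. if b = X (e j0 i) v mod q then t (e j0 i) v * ?r b else 0)"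
        by (intro sum.cong) (auto simp: h_def)
      thus "(\<Sum>b<q. h q b (e j0 i) v * ?r b) = t (e j0 i) v * ?r (X (e j0 i) v mod q)"
        using Q_pos[OF q] by simp
    qed
    finally show ?thesis by simp
  qed
  have "(\<Sum>j<J. \<Sum>i<m. t (e j i) v * loss j i v) =
    (\<Sum>j<J. \<Sum>i<m. \<Sum>q\<in>Q. of_bool (W q v > 2 * G q) / (2 * G q) *
       (t (e j i) v * (\<Prod>j'\<in>{..<J} - {j}. n j' q (X (e j i) v mod q) v)))"
    unfolding loss_def sum_distrib_left by (simp add: mult_ac)
  also have "\<dots> = (\<Sum>j<J. \<Sum>q\<in>Q. of_bool (W q v > 2 * G q) / (2 * G q) *
       (\<Sum>i<m. t (e j i) v * (\<Prod>j'\<in>{..<J} - {j}. n j' q (X (e j i) v mod q) v)))"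
    unfolding sum_distrib_left by (intro sum.cong refl sum.swap)
  also have "\<dots> = (\<Sum>j<J. \<Sum>q\<in>Q. of_bool (W q v > 2 * G q) / (2 * G q) * W q v)"
    by (intro sum.cong refl) (simp add: inner)
  also have "\<dots> \<le> (\<Sum>j<J. \<Sum>q\<in>Q. (W q v - G q)\<^sup>2 / (G q)\<^sup>2)"
  proof (intro sum_mono)
    fix q assume q: "q \<in> Q"
    have Gp: "G q > 0" using G_pos[OF q] .
    show "of_bool (W q v > 2 * G q) / (2 * G q) * W q v \<le> (W q v - G q)\<^sup>2 / (G q)\<^sup>2"
    proof (cases "W q v > 2 * G q")
      case True
      define x where "x = W q v / G q - 1"
      have x: "x \<ge> 1" using True Gp by (simp add: x_def field_simps)
      have "x * x - (x + 1) / 2 = (x - 1) * (x - 1) + 3 / 2 * (x - 1)" by (simp add: field_simps)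
      also have "0 \<le> \<dots>" using x by simp
      finally have "(x + 1) / 2 \<le> x * x" by simp
      moreover have "(W q v - G q)\<^sup>2 / (G q)\<^sup>2 = x * x"
        unfolding x_def using Gp by (simp add: power2_eq_square field_simps)
      moreover have "of_bool (W q v > 2 * G q) / (2 * G q) * W q v = (x + 1) / 2"
        using True by (simp add: x_def)
      ultimately show ?thesis by simp
    qed simp
  qed
  finally show ?thesis by simp
qed

text \<open>With classes drawn from \<open>\<pi>\<close>, a survivor escapes with probability at
  most \<open>exp (- s)\<close>, where \<open>s \<ge> \<Phi> / 2 - loss\<close>; the 1/2 comes from
  the denominator \<open>2 * G q\<close>.\<close>

lemma ex_classes:
  assumes v: "v \<in> \<Omega>"
  shows "\<exists>b. real (card {(j, i). j < J \<and> i < m \<and> coprime (X (e j i) v) P \<and>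
               (\<forall>q\<in>Q. X (e j i) v mod q \<noteq> b q)}) \<le> 2 * real J * \<beta> * exp (- \<mu> / 4) + Y v"
proof -
  define I where "I = {..<J} \<times> {..<m}"
  define u where "u = (\<lambda>(j, i). t (e j i) v)"
  define x where "x = (\<lambda>(j, i). X (e j i) v)"
  have pn: "0 \<le> (\<Prod>j\<in>D. n j q b v)" for D q b using v by (intro prod_nonneg) (auto intro: n_nonneg)
  have mx: "max (W q v) (2 * G q) > 0" if "q \<in> Q" for q using G_pos[OF that] by (simp add: less_max_iff_disj)
  have pi0: "0 \<le> \<pi> v q b" if "q \<in> Q" for q b
    unfolding \<pi>_def using mx[OF that] pn by (intro divide_nonneg_nonneg) auto
  have pi1: "(\<Sum>b<q. \<pi> v q b) \<le> 1" if q: "q \<in> Q" for q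
  proof -
    have "(\<Sum>b<q. \<pi> v q b) = W q v / max (W q v) (2 * G q)"
      unfolding \<pi>_def W_def by (simp add: sum_divide_distrib)
    also have "\<dots> \<le> 1" using mx[OF q] by (simp add: divide_le_eq)
    finally show ?thesis .
  qed
  have pi_le1: "\<pi> v q b \<le> 1" if q: "q \<in> Q" "b < q" for q b
  proof -
    have "\<pi> v q b \<le> (\<Sum>b<q. \<pi> v q b)" using q pi0 by (intro member_le_sum) auto
    thus ?thesis using pi1[OF q(1)] by linarith
  qed
  obtain b where b: "(\<Sum>k\<in>I. u k * of_bool (\<forall>q\<in>Q. x k mod q \<noteq> b q)) \<le>
             (\<Sum>k\<in>I. u k * (\<Prod>q\<in>Q. 1 - \<pi> v q (x k mod q)))"
    using ex_classes_weighted[of Q I u "\<pi> v" x] Q_fin pi0 pi1 Q_pos by (auto simp: I_def u_def t_def)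
  have "real (card {(j, i). j < J \<and> i < m \<and> coprime (X (e j i) v) P \<and> (\<forall>q\<in>Q. X (e j i) v mod q \<noteq> b q)}) =
     (\<Sum>k\<in>I. u k * of_bool (\<forall>q\<in>Q. x k mod q \<noteq> b q))"
  proof -
    have "(\<Sum>k\<in>I. u k * of_bool (\<forall>q\<in>Q. x k mod q \<noteq> b q)) =
      (\<Sum>k\<in>I. if k \<in> {k \<in> I. (case k of (j, i) \<Rightarrow> coprime (X (e j i) v) P \<and> (\<forall>q\<in>Q. X (e j i) v mod q \<noteq> b q))} then 1 else 0)"
      by (intro sum.cong) (auto simp: u_def x_def t_def)
    also have "\<dots> = real (card {k \<in> I. (case k of (j, i) \<Rightarrow> coprime (X (e j i) v) P \<and> (\<forall>q\<in>Q. X (e j i) v mod q \<noteq> b q))})"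
      by (subst sum.inter_restrict[symmetric]) (auto simp: I_def Int_def)
    also have "{k \<in> I. (case k of (j, i) \<Rightarrow> coprime (X (e j i) v) P \<and> (\<forall>q\<in>Q. X (e j i) v mod q \<noteq> b q))} =
       {(j, i). j < J \<and> i < m \<and> coprime (X (e j i) v) P \<and> (\<forall>q\<in>Q. X (e j i) v mod q \<noteq> b q)}"
      by (auto simp: I_def)
    finally show ?thesis by simp
  qed
  also note b
  also have "(\<Sum>k\<in>I. u k * (\<Prod>q\<in>Q. 1 - \<pi> v q (x k mod q))) \<le>
     (\<Sum>(j, i)\<in>I. t (e j i) v * (exp (- \<mu> / 4) + 16 / \<mu>\<^sup>2 * (\<Phi> j i v - \<mu>)\<^sup>2 + 8 / \<mu> * loss j i v))"
  proof (intro sum_mono)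
    fix k assume k: "k \<in> I"
    obtain j0 i0 where ji: "k = (j0, i0)" by (cases k)
    have j0: "j0 < J" "i0 < m" using k by (auto simp: I_def ji)
    define s where "s = (\<Sum>q\<in>Q. \<pi> v q (x k mod q))"
    show "u k * (\<Prod>q\<in>Q. 1 - \<pi> v q (x k mod q)) \<le>
      (case k of (j, i) \<Rightarrow> t (e j i) v * (exp (- \<mu> / 4) + 16 / \<mu>\<^sup>2 * (\<Phi> j i v - \<mu>)\<^sup>2 + 8 / \<mu> * loss j i v))"
    proof (cases "coprime (X (e j0 i0) v) P")
      case False
      thus ?thesis by (simp add: u_def ji t_def)
    next
      case True
      hence t1: "t (e j0 i0) v = 1" by (simp add: t_def)
      have "(\<Prod>q\<in>Q. 1 - \<pi> v q (x k mod q)) \<le> (\<Prod>q\<in>Q. exp (- \<pi> v q (x k mod q)))"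
      proof (intro prod_mono conjI)
        fix q assume q: "q \<in> Q"
        show "0 \<le> 1 - \<pi> v q (x k mod q)" using pi_le1[OF q, of "x k mod q"] Q_pos[OF q] by simp
        show "1 - \<pi> v q (x k mod q) \<le> exp (- \<pi> v q (x k mod q))"
          using exp_ge_add_one_self[of "- \<pi> v q (x k mod q)"] by simp
      qed
      also have "\<dots> = exp (- s)" unfolding s_def using Q_fin by (simp add: exp_sum sum_negf[symmetric])
      also have "\<dots> \<le> exp (- \<mu> / 4) + 16 / \<mu>\<^sup>2 * (\<Phi> j0 i0 v - \<mu>)\<^sup>2 + 8 / \<mu> * loss j0 i0 v"
      proof (rule exp_minus_le_quadratic[OF mu_pos])
        show "0 \<le> s" unfolding s_def using pi0 by (intro sum_nonneg)
        show "0 \<le> loss j0 i0 v" unfolding loss_def using G_pos pn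
          by (intro sum_nonneg mult_nonneg_nonneg divide_nonneg_nonneg) (auto intro: less_imp_le)
        have "\<Phi> j0 i0 v / 2 - loss j0 i0 v = (\<Sum>q\<in>Q. (1 / (2 * G q) - of_bool (W q v > 2 * G q) / (2 * G q)) *
            (\<Prod>j\<in>{..<J} - {j0}. n j q (X (e j0 i0) v mod q) v))"
          unfolding \<Phi>_def loss_def by (simp add: sum_divide_distrib sum_subtractf algebra_simps)
        also have "\<dots> \<le> s" unfolding s_def
        proof (intro sum_mono)
          fix q assume q: "q \<in> Q"
          let ?b = "X (e j0 i0) v mod q"
          let ?r = "\<Prod>j\<in>{..<J} - {j0}. n j q ?b v"
          have xk: "x k mod q = ?b" by (simp add: x_def ji)
          show "(1 / (2 * G q) - of_bool (W q v > 2 * G q) / (2 * G q)) * ?r \<le> \<pi> v q (x k mod q)"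
          proof (cases "W q v > 2 * G q")
            case True
            thus ?thesis using pi0[OF q, of "x k mod q"] by simp
          next
            case False
            \<comment> \<open>The survivor itself lies in its class, so its own segment contributes
              a factor of at least 1.\<close>
            have "h q ?b (e j0 i0) v \<le> n j0 q ?b v" unfolding n_def
              using j0 h_bd v by (intro member_le_sum) (auto simp: bd_def)
            hence n1: "1 \<le> n j0 q ?b v" using t1 by (simp add: h_def)
            have "(\<Prod>j<J. n j q ?b v) = n j0 q ?b v * ?r" using j0 by (intro prod.remove) auto
            hence "?r \<le> (\<Prod>j<J. n j q ?b v)" using mult_right_mono[OF n1 pn[of q ?b "{..<J} - {j0}"]] by simp
            hence "?r / (2 * G q) \<le> (\<Prod>j<J. n j q ?b v) / (2 * G q)"
              using G_pos[OF q] by (intro divide_right_mono) auto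
            thus ?thesis using False by (simp add: xk \<pi>_def max_def)
          qed
        qed
        finally show "\<Phi> j0 i0 v / 2 - loss j0 i0 v \<le> s" .
      qed
      finally show ?thesis by (simp add: u_def ji t1)
    qed
  qed
  also have "\<dots> = exp (- \<mu> / 4) * (\<Sum>j<J. n j 1 0 v)
      + 16 / \<mu>\<^sup>2 * (\<Sum>j<J. \<Sum>i<m. t (e j i) v * (\<Phi> j i v - \<mu>)\<^sup>2)
      + 8 / \<mu> * (\<Sum>j<J. \<Sum>i<m. t (e j i) v * loss j i v)"
  proof -
    have "n j 1 0 v = (\<Sum>i<m. t (e j i) v)" for j by (simp add: n_def h_def)
    thus ?thesis unfolding I_def sum.cartesian_product[symmetric]
      by (simp add: distrib_left sum.distrib sum_distrib_left mult_ac)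
  qed
  also have "(\<Sum>j<J. n j 1 0 v) \<le> (\<Sum>j<J. 2 * \<beta> + (n j 1 0 v - \<beta>)\<^sup>2 / \<beta>)"
  proof (intro sum_mono)
    fix j
    have "2 * \<beta> * \<beta> + (n j 1 0 v - \<beta>)\<^sup>2 - n j 1 0 v * \<beta> = (n j 1 0 v - 3 / 2 * \<beta>)\<^sup>2 + 3 / 4 * \<beta>\<^sup>2"
      by (simp add: power2_eq_square algebra_simps)
    moreover have "0 \<le> (n j 1 0 v - 3 / 2 * \<beta>)\<^sup>2 + 3 / 4 * \<beta>\<^sup>2" by simp
    ultimately have "n j 1 0 v * \<beta> \<le> 2 * \<beta> * \<beta> + (n j 1 0 v - \<beta>)\<^sup>2" by linarith
    thus "n j 1 0 v \<le> 2 * \<beta> + (n j 1 0 v - \<beta>)\<^sup>2 / \<beta>"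
      using beta_pos by (simp add: field_simps)
  qed
  also have "exp (- \<mu> / 4) * (\<Sum>j<J. 2 * \<beta> + (n j 1 0 v - \<beta>)\<^sup>2 / \<beta>) \<le>
      2 * real J * \<beta> * exp (- \<mu> / 4) + 1 * (\<Sum>j<J. (n j 1 0 v - \<beta>)\<^sup>2 / \<beta>)"
  proof -
    have "exp (- \<mu> / 4) * (\<Sum>j<J. (n j 1 0 v - \<beta>)\<^sup>2 / \<beta>) \<le> 1 * (\<Sum>j<J. (n j 1 0 v - \<beta>)\<^sup>2 / \<beta>)"
      using mu_pos beta_pos by (intro mult_right_mono sum_nonneg) auto
    thus ?thesis by (simp add: sum.distrib algebra_simps)
  qed
  also have "8 / \<mu> * (\<Sum>j<J. \<Sum>i<m. t (e j i) v * loss j i v) \<le>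
     8 / \<mu> * (real J * (\<Sum>q\<in>Q. (W q v - G q)\<^sup>2 / (G q)\<^sup>2))"
    using mu_pos sum_t_loss[OF v] by (intro mult_left_mono) auto
  finally have "real (card {(j, i). j < J \<and> i < m \<and> coprime (X (e j i) v) P \<and>
      (\<forall>q\<in>Q. X (e j i) v mod q \<noteq> b q)}) \<le> 2 * real J * \<beta> * exp (- \<mu> / 4) + Y v"
    by (simp add: Y_def)
  thus ?thesis by blast
qed

end

section \<open>Equidistribution of the integer parts of powers\<close>

abbreviation fpow :: "real \<Rightarrow> nat \<Rightarrow> nat" where "fpow a k \<equiv> nat \<lfloor>a ^ k\<rfloor>"

section \<open>One exponent on an interval\<close>

text \<open>Except for the least element \<open>c\<close> of the class, each \<open>n\<close> is
  compared with the average of \<open>lf\<close> over the \<open>M\<close> indices ending at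
  \<open>n\<close>; these windows are disjoint and lie beyond \<open>m0\<close>. The term at
  \<open>c\<close> costs \<open>e1\<close>. Monotonicity is asked only beyond \<open>m0\<close>,
  since the interval belonging to \<open>m0\<close> will be cut off on the left.\<close>

lemma sum_residue_class_le:
  fixes lf :: "nat \<Rightarrow> real"
  assumes nn: "\<And>n. 0 \<le> lf n" and dec: "\<And>n n'. m0 < n \<Longrightarrow> n \<le> n' \<Longrightarrow> lf n' \<le> lf n"
    and le: "\<And>n. lf n \<le> e1" and M: "M > 0"
  shows "(\<Sum>n | n \<in> {m0..m1} \<and> n mod M = u. lf n) \<le> (\<Sum>n\<in>{m0..m1}. lf n) / real M + e1"
proof -
  define A where "A = {n. n \<in> {m0..m1} \<and> n mod M = u}"
  have e1: "0 \<le> e1" using nn[of 0] le[of 0] by linarith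
  have fin: "finite A" unfolding A_def by simp
  show ?thesis
  proof (cases "A = {}")
    case True
    have "0 \<le> (\<Sum>n\<in>{m0..m1}. lf n) / real M" using nn by (intro divide_nonneg_nonneg sum_nonneg) auto
    thus ?thesis using True e1 unfolding A_def[symmetric] by simp
  next
    case False
    define c where "c = Min A"
    have c: "c \<in> A" "\<And>n. n \<in> A \<Longrightarrow> c \<le> n" using False fin by (auto simp: c_def)
    have gap: "n + M \<le> n'" if "n \<in> A" "n' \<in> A" "n < n'" for n n'
    proof -
      have "M dvd n' - n" using that by (intro mod_eq_dvd_iff_nat[THEN iffD1]) (auto simp: A_def)
      hence "M \<le> n' - n" using that by (intro dvd_imp_le) auto
      thus ?thesis using that by simp
    qed
    have big: "c + M \<le> n" if "n \<in> A - {c}" for n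
      using that c gap[of c n] by force
    have "real M * (\<Sum>n\<in>A - {c}. lf n) = (\<Sum>n\<in>A - {c}. \<Sum>k\<in>{n + 1 - M..n}. lf n)"
      using big by (auto simp: sum_distrib_left intro!: sum.cong dest!: big)
    also have "\<dots> \<le> (\<Sum>n\<in>A - {c}. \<Sum>k\<in>{n + 1 - M..n}. lf k)"
    proof (intro sum_mono)
      fix n k assume n: "n \<in> A - {c}" and k: "k \<in> {n + 1 - M..n}"
      have "m0 < k" using big[OF n] k c(1) M by (auto simp: A_def)
      thus "lf n \<le> lf k" using k by (intro dec) auto
    qed
    also have "\<dots> = (\<Sum>k\<in>(\<Union>n\<in>A - {c}. {n + 1 - M..n}). lf k)"
    proof (rule sum.UNION_disjoint[symmetric])
      show "\<forall>i\<in>A - {c}. \<forall>j\<in>A - {c}. i \<noteq> j \<longrightarrow> {i + 1 - M..i} \<inter> {j + 1 - M..j} = {}"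
      proof (intro ballI impI)
        fix i j assume ij: "i \<in> A - {c}" "j \<in> A - {c}" "i \<noteq> j"
        hence "i + M \<le> j \<or> j + M \<le> i" using gap[of i j] gap[of j i] by (cases i j rule: linorder_cases) auto
        thus "{i + 1 - M..i} \<inter> {j + 1 - M..j} = {}" using M by auto
      qed
    qed (use fin in auto)
    also have "\<dots> \<le> (\<Sum>k\<in>{m0..m1}. lf k)"
    proof (rule sum_mono2)
      show "(\<Union>n\<in>A - {c}. {n + 1 - M..n}) \<subseteq> {m0..m1}"
      proof
        fix k assume "k \<in> (\<Union>n\<in>A - {c}. {n + 1 - M..n})"
        then obtain n where n: "n \<in> A - {c}" "k \<in> {n + 1 - M..n}" by blast
        thus "k \<in> {m0..m1}" using big[OF n(1)] c(1) M by (auto simp: A_def)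
      qed
    qed (use nn in auto)
    finally have "(\<Sum>n\<in>A - {c}. lf n) \<le> (\<Sum>n\<in>{m0..m1}. lf n) / real M"
      using M by (simp add: field_simps)
    moreover have "(\<Sum>n\<in>A. lf n) = lf c + (\<Sum>n\<in>A - {c}. lf n)" using fin c(1) by (intro sum.remove)
    ultimately show ?thesis unfolding A_def[symmetric] using le[of c] by linarith
  qed
qed

lemma root_concave_step:
  assumes "k > 0"
  shows "root k (real n) + root k (real (n + 2)) \<le> 2 * root k (real (n + 1))"
proof -
  define x z where "x = root k (real n)" and "z = root k (real (n + 2))"
  have xz: "0 \<le> x" "0 \<le> z" "x ^ k = real n" "z ^ k = real (n + 2)"
    using assms by (auto simp: x_def z_def real_root_ge_zero)
  have "((1/2) *\<^sub>R x + (1/2) *\<^sub>R z) ^ k \<le> (1/2) * x ^ k + (1/2) * z ^ k"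
  proof -
    have "convex_on {0..} (\<lambda>x::real. x ^ k)"
      by (cases "even k") (auto intro: convex_power_odd convex_on_subset[OF convex_power_even])
    from convex_onD[OF this, of "1/2" x z] xz show ?thesis by simp
  qed
  hence "((x + z) / 2) ^ k \<le> real (n + 1)" using xz by (simp add: add_divide_distrib)
  hence "root k (((x + z) / 2) ^ k) \<le> root k (real (n + 1))" using assms by (intro real_root_le_mono)
  moreover have "root k (((x + z) / 2) ^ k) = (x + z) / 2" using assms xz by (intro real_root_power_cancel) auto
  ultimately show ?thesis by (simp add: x_def z_def)
qed

text \<open>The lengths of the intervals on which \<open>\<lfloor>a^k\<rfloor>\<close> is constant decrease, by concavity of the root;
  hence each residue class has at most its share, up to the length of one interval.\<close>

lemma measure_residue_halfopen:
  fixes \<alpha> \<beta> :: real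
  assumes "1 \<le> A" "A \<le> \<alpha>" "\<alpha> \<le> \<beta>" "k > 0" "M > 0"
  shows "measure lborel {a\<in>{\<alpha>..<\<beta>}. fpow a k mod M = u} \<le> (\<beta> - \<alpha>) / real M + 1 / A ^ (k - 1)"
proof -
  define r where "r n = root k (real n)" for n :: nat
  \<comment> \<open>Clamping to \<open>\<alpha>\<close> and \<open>\<beta>\<close> gives length 0 to
    the cells outside and cuts those at the two ends.\<close>
  define cl where "cl n = max \<alpha> (min \<beta> (r n))" for n :: nat
  define lf where "lf n = cl (Suc n) - cl n" for n
  define m0 where "m0 = fpow \<alpha> k"
  define m1 where "m1 = nat \<lceil>\<beta> ^ k\<rceil>"
  have pos: "0 < \<alpha>" using assms by simp
  have r_mono: "n \<le> n' \<Longrightarrow> r n \<le> r n'" for n n' using assms by (simp add: r_def)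
  have cl_mono: "n \<le> n' \<Longrightarrow> cl n \<le> cl n'" for n n' unfolding cl_def using r_mono[of n n'] by (intro max.mono min.mono) auto
  have rpow: "r n ^ k = real n" "0 \<le> r n" for n using assms by (auto simp: r_def real_root_ge_zero)
  have r_le_iff: "r n \<le> a \<longleftrightarrow> real n \<le> a ^ k" if "0 \<le> a" for a n
    using rpow[of n] power_mono_iff[of "r n" a k] that assms by simp
  have cell: "{a\<in>{\<alpha>..<\<beta>}. fpow a k = n} = {cl n..<cl (Suc n)}" for n
  proof (intro Set.set_eqI)
    fix a
    show "a \<in> {a\<in>{\<alpha>..<\<beta>}. fpow a k = n} \<longleftrightarrow> a \<in> {cl n..<cl (Suc n)}"
    proof (cases "\<alpha> \<le> a \<and> a < \<beta>")
      case True
      hence a0: "0 \<le> a" using pos by simp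
      have "fpow a k = n \<longleftrightarrow> real n \<le> a ^ k \<and> a ^ k < real (Suc n)"
        using a0 zero_le_power[OF a0, of k] by (auto simp: nat_eq_iff floor_eq_iff)
      also have "\<dots> \<longleftrightarrow> r n \<le> a \<and> a < r (Suc n)" using r_le_iff[OF a0, of n] r_le_iff[OF a0, of "Suc n"] by linarith
      finally show ?thesis using True by (auto simp: cl_def)
    next
      case False
      thus ?thesis by (auto simp: cl_def)
    qed
  qed
  have l_nn: "0 \<le> lf n" for n unfolding lf_def using cl_mono[of n "Suc n"] by simp
  have after: "\<alpha> \<le> r n" if "m0 < n" for n
  proof -
    have "\<alpha> ^ k \<le> real n" using that unfolding m0_def by linarith
    hence "root k (\<alpha> ^ k) \<le> r n" unfolding r_def using assms by (intro real_root_le_mono)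
    thus ?thesis using assms pos by (simp add: real_root_power_cancel)
  qed
  \<comment> \<open>Beyond \<open>m0\<close> no cell is cut at \<open>\<alpha>\<close>, and cutting
    at \<open>\<beta>\<close> can only shorten the later cell of a pair more.\<close>
  have step: "lf (Suc n) \<le> lf n" if "m0 < n" for n
  proof -
    have "r n + r (Suc (Suc n)) \<le> 2 * r (Suc n)"
      using root_concave_step[of k n] assms by (simp add: r_def add.commute)
    moreover have "r n \<le> r (Suc n)" "r (Suc n) \<le> r (Suc (Suc n))" by (auto intro: r_mono)
    moreover have "\<alpha> \<le> r n" using after that .
    ultimately show ?thesis unfolding lf_def cl_def using assms(3) by (auto simp: max_def min_def)
  qed
  have dec: "lf n' \<le> lf n" if "m0 < n" "n \<le> n'" for n n'
    using that(2)
  proof (induction n' rule: dec_induct)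
    case (step l)
    have "lf (Suc l) \<le> lf l" using step.hyps that(1) by (intro \<open>\<And>n. m0 < n \<Longrightarrow> lf (Suc n) \<le> lf n\<close>) auto
    thus ?case using step.IH by linarith
  qed simp
  have le: "lf n \<le> 1 / A ^ (k - 1)" for n
  proof (cases "cl n < cl (Suc n)")
    case False
    have "A ^ (k - 1) > 0" using assms by simp
    thus ?thesis using False by (simp add: lf_def le_divide_eq) (smt (verit) mult_nonneg_nonneg mult_le_0_iff)
  next
    case True
    define p p' where "p = cl n" and "p' = cl (Suc n)"
    have pp: "p < p'" "\<alpha> \<le> p" using True by (auto simp: p_def p'_def cl_def)
    have "p' \<le> r (Suc n)" using pp by (auto simp: p'_def p_def cl_def max_def min_def split: if_splits)
    hence "p' ^ k \<le> r (Suc n) ^ k" using pp pos by (intro power_mono) auto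
    hence 1: "p' ^ k \<le> real n + 1" using rpow by simp
    have "p < \<beta>" using pp by (auto simp: p'_def p_def cl_def max_def min_def split: if_splits)
    hence "r n \<le> p" by (auto simp: p_def cl_def max_def min_def split: if_splits)
    hence "r n ^ k \<le> p ^ k" using rpow by (intro power_mono) auto
    hence 2: "real n \<le> p ^ k" using rpow by simp
    have "(p' - p) * A ^ (k - 1) \<le> (p' - p) * p' ^ (k - 1)"
      using pp assms by (intro mult_left_mono power_mono) auto
    also have "\<dots> = p' ^ k - p * p' ^ (k - 1)"
      using assms(4) by (metis Suc_diff_1 left_diff_distrib power_Suc)
    also have "p * p ^ (k - 1) \<le> p * p' ^ (k - 1)" using pp pos by (intro mult_left_mono power_mono) auto
    hence "p' ^ k - p * p' ^ (k - 1) \<le> p' ^ k - p ^ k"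
      using assms(4) by (metis Suc_diff_1 diff_left_mono power_Suc)
    finally have "(p' - p) * A ^ (k - 1) \<le> 1" using 1 2 by linarith
    thus ?thesis using assms by (simp add: lf_def p_def p'_def field_simps)
  qed
  have cl0: "cl m0 = \<alpha>"
  proof -
    have "real m0 \<le> \<alpha> ^ k" unfolding m0_def using pos by simp
    hence "r m0 \<le> \<alpha>" using r_le_iff pos by simp
    thus ?thesis by (auto simp: cl_def)
  qed
  have m01: "m0 \<le> m1" unfolding m0_def m1_def using power_mono[OF assms(3), of k] pos by linarith
  have cl1: "cl (Suc m1) = \<beta>"
  proof -
    have "\<beta> ^ k \<le> real (Suc m1)" unfolding m1_def by linarith
    hence "root k (\<beta> ^ k) \<le> r (Suc m1)" unfolding r_def using assms by (intro real_root_le_mono)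
    hence "\<beta> \<le> r (Suc m1)" using assms pos by (simp add: real_root_power_cancel)
    thus ?thesis using assms by (auto simp: cl_def)
  qed
  have tot: "(\<Sum>n\<in>{m0..m1}. lf n) = \<beta> - \<alpha>"
    using sum_Suc_diff[of m0 "m1" cl] m01 cl0 cl1 by (simp add: lf_def)
  have eq: "{a\<in>{\<alpha>..<\<beta>}. fpow a k mod M = u} = (\<Union>n\<in>{n. n \<in> {m0..m1} \<and> n mod M = u}. {cl n..<cl (Suc n)})"
  proof (intro Set.set_eqI iffI)
    fix a assume a: "a \<in> {a\<in>{\<alpha>..<\<beta>}. fpow a k mod M = u}"
    define n where "n = fpow a k"
    have "\<alpha> ^ k \<le> a ^ k" "a ^ k \<le> \<beta> ^ k" using a pos by (auto intro!: power_mono)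
    hence "m0 \<le> n" "n \<le> m1" unfolding n_def m0_def m1_def by (auto intro: nat_mono floor_mono) linarith
    moreover have "a \<in> {cl n..<cl (Suc n)}" using a unfolding cell[symmetric] n_def by auto
    ultimately show "a \<in> (\<Union>n\<in>{n. n \<in> {m0..m1} \<and> n mod M = u}. {cl n..<cl (Suc n)})"
      using a n_def by auto
  next
    fix a assume "a \<in> (\<Union>n\<in>{n. n \<in> {m0..m1} \<and> n mod M = u}. {cl n..<cl (Suc n)})"
    thus "a \<in> {a\<in>{\<alpha>..<\<beta>}. fpow a k mod M = u}" unfolding cell[symmetric] by auto
  qed
  have "measure lborel {a\<in>{\<alpha>..<\<beta>}. fpow a k mod M = u} =
     (\<Sum>n | n \<in> {m0..m1} \<and> n mod M = u. measure lborel {cl n..<cl (Suc n)})"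
    unfolding eq
  proof (rule measure_finite_Union)
    show "disjoint_family_on (\<lambda>n. {cl n..<cl (Suc n)}) {n. n \<in> {m0..m1} \<and> n mod M = u}"
      unfolding disjoint_family_on_def cell[symmetric] by auto
    show "emeasure lborel {cl n..<cl (Suc n)} \<noteq> \<infinity>" for n using cl_mono[of n "Suc n"] by simp
  qed auto
  also have "\<dots> = (\<Sum>n | n \<in> {m0..m1} \<and> n mod M = u. lf n)"
    using cl_mono by (intro sum.cong) (auto simp: lf_def)
  also have "\<dots> \<le> (\<Sum>n\<in>{m0..m1}. lf n) / real M + 1 / A ^ (k - 1)"
    by (rule sum_residue_class_le) (use l_nn dec le assms in auto)
  finally show ?thesis unfolding tot .
qed

lemma bounded_interval_borel:
  fixes C :: "real set"
  assumes C: "C \<subseteq> {A..b}" "is_interval C" and ne: "C \<noteq> {}"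
  shows "C \<subseteq> {Inf C..Sup C}" "{Inf C<..<Sup C} \<subseteq> C" "C \<in> sets borel"
proof -
  have bdd: "bdd_below C" "bdd_above C" using C(1) by (auto intro!: bdd_belowI[of _ A] bdd_aboveI[of _ b])
  show sub: "C \<subseteq> {Inf C..Sup C}" using bdd by (auto simp: cInf_lower cSup_upper)
  show sup: "{Inf C<..<Sup C} \<subseteq> C"
  proof
    fix x assume x: "x \<in> {Inf C<..<Sup C}"
    obtain c where c: "c \<in> C" "c < x" using x ne bdd by (auto simp: cInf_less_iff)
    obtain d where d: "d \<in> C" "x < d" using x ne bdd by (auto simp: less_cSup_iff)
    show "x \<in> C" using C(2) c d by (meson mem_is_interval_1_I less_imp_le)
  qed
  have "C = {Inf C<..<Sup C} \<union> (C \<inter> {Inf C, Sup C})" using sub sup by force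
  moreover have "C \<inter> {Inf C, Sup C} \<in> sets borel" by (intro borel_closed finite_imp_closed) auto
  ultimately show "C \<in> sets borel" by (metis borel_open open_greaterThanLessThan sets.Un)
qed

lemma bounded_interval_borel':
  fixes C :: "real set"
  assumes "C \<subseteq> {A..b}" "is_interval C"
  shows "C \<in> sets borel"
  using bounded_interval_borel(3)[OF assms] by (cases "C = {}") auto

lemma measure_residue_interval:
  fixes C :: "real set"
  assumes "1 \<le> A" "C \<subseteq> {A..b}" "is_interval C" "k > 0" "M > 0"
  shows "measure lborel {a\<in>C. fpow a k mod M = u} \<le> measure lborel C / real M + 1 / A ^ (k - 1)"
proof (cases "C = {}")
  case False
  define \<alpha> \<beta> where "\<alpha> = Inf C" and "\<beta> = Sup C"
  note C = bounded_interval_borel[OF assms(2,3) False, folded \<alpha>_def \<beta>_def]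
  note sub = C(1) and sup = C(2) and Cm = C(3)
  have ab: "\<alpha> \<le> \<beta>" "A \<le> \<alpha>"
    using sub False assms(2) by (fastforce, auto simp: \<alpha>_def intro!: cInf_greatest)
  have fm: "{\<alpha>..\<beta>} \<in> fmeasurable lborel" by (simp add: fmeasurable_compact)
  have "\<beta> - \<alpha> = measure lborel {\<alpha><..<\<beta>}" using ab by simp
  also have "\<dots> \<le> measure lborel C"
    using fm sub Cm sup by (intro measure_mono_fmeasurable fmeasurableI2[OF fm]) auto
  finally have m: "\<beta> - \<alpha> \<le> measure lborel C" .
  have ms: "{a\<in>{\<alpha>..<\<beta>}. fpow a k mod M = u} \<in> sets lborel" by measurable
  have fm1: "{a\<in>{\<alpha>..<\<beta>}. fpow a k mod M = u} \<in> fmeasurable lborel" by (rule fmeasurableI2[OF fm]) (use ms in auto)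
  have "measure lborel {a\<in>C. fpow a k mod M = u} \<le>
     measure lborel ({a\<in>{\<alpha>..<\<beta>}. fpow a k mod M = u} \<union> {\<beta>})"
  proof (rule measure_mono_fmeasurable)
    show "{a\<in>C. fpow a k mod M = u} \<in> sets lborel" using Cm by measurable
    show "{a\<in>{\<alpha>..<\<beta>}. fpow a k mod M = u} \<union> {\<beta>} \<in> fmeasurable lborel"
      using fm1 by (intro fmeasurable.Un) (auto simp: fmeasurable_compact)
  qed (use sub in force)
  also have "\<dots> \<le> measure lborel {a\<in>{\<alpha>..<\<beta>}. fpow a k mod M = u} + measure lborel {\<beta>}"
    using ms by (intro measure_Un_le) auto
  also have "\<dots> \<le> (\<beta> - \<alpha>) / real M + 1 / A ^ (k - 1)"
    using measure_residue_halfopen[of A \<alpha> \<beta> k M u] assms ab by simp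
  also have "\<dots> \<le> measure lborel C / real M + 1 / A ^ (k - 1)"
    using m assms by (intro add_right_mono divide_right_mono) auto
  finally show ?thesis .
qed (use assms in auto)

text \<open>As all summands are monotone in \<open>a\<close>, the number \<open>\<sigma> \<kappa> a\<close> encodes all \<open>\<lfloor>a^i\<rfloor>\<close> with \<open>i \<le> \<kappa>\<close>.\<close>

definition \<sigma> :: "nat \<Rightarrow> real \<Rightarrow> nat" where "\<sigma> \<kappa> a = (\<Sum>i\<le>\<kappa>. fpow a i)"

lemma nat_floor_power_mono: "0 \<le> a \<Longrightarrow> a \<le> b \<Longrightarrow> fpow a i \<le> fpow b i"
  by (intro nat_mono floor_mono power_mono)

lemma sigma_mono: "0 \<le> a \<Longrightarrow> a \<le> b \<Longrightarrow> \<sigma> \<kappa> a \<le> \<sigma> \<kappa> b"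
  unfolding \<sigma>_def by (intro sum_mono nat_floor_power_mono)

lemma sigma_eqD_aux:
  assumes "0 \<le> a" "a \<le> b" "\<sigma> \<kappa> a = \<sigma> \<kappa> b" "i \<le> \<kappa>"
  shows "fpow a i = fpow b i"
  using sum_mono_inv[of "\<lambda>i. fpow a i" "{..\<kappa>}" "\<lambda>i. fpow b i" i] assms nat_floor_power_mono
  by (auto simp: \<sigma>_def)

lemma sigma_eqD:
  assumes "0 \<le> a" "0 \<le> b" "\<sigma> \<kappa> a = \<sigma> \<kappa> b" "i \<le> \<kappa>"
  shows "fpow a i = fpow b i"
proof (cases "a \<le> b")
  case True
  show ?thesis by (rule sigma_eqD_aux[OF assms(1) True assms(3,4)])
next
  case False
  hence "b \<le> a" by simp
  thus ?thesis by (rule sigma_eqD_aux[OF assms(2) _ assms(3)[symmetric] assms(4), symmetric])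
qed

lemma sigma_cong: "(\<And>i. i \<le> \<kappa> \<Longrightarrow> fpow a i = fpow b i) \<Longrightarrow> \<sigma> \<kappa> a = \<sigma> \<kappa> b"
  by (simp add: \<sigma>_def)

text \<open>Summing the upper bound for single classes over \<open>R\<close> gives one direction;
  summing it over the complement of \<open>R\<close> gives the other.\<close>

lemma measure_residue_set_interval:
  fixes C :: "real set"
  assumes "1 \<le> A" "C \<subseteq> {A..b}" "is_interval C" "k > 0" "M > 0" "R \<subseteq> {..<M}"
  shows "\<bar>measure lborel {a\<in>C. fpow a k mod M \<in> R} - real (card R) / real M * measure lborel C\<bar> \<le> real M / A ^ (k - 1)"
proof -
  let ?e = "1 / A ^ (k - 1)"
  have Cm: "C \<in> sets borel" using bounded_interval_borel'[OF assms(2,3)] .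
  have fm: "{A..b} \<in> fmeasurable lborel" by (simp add: fmeasurable_compact)
  have sm: "{a\<in>C. fpow a k mod M \<in> D} \<in> sets lborel" for D using Cm by measurable
  have fmD: "{a\<in>C. fpow a k mod M \<in> D} \<in> fmeasurable lborel" for D
    by (rule fmeasurableI2[OF fm _ sm]) (use assms in auto)
  have up: "measure lborel {a\<in>C. fpow a k mod M \<in> D} \<le> real (card D) * (measure lborel C / real M + ?e)"
    if "D \<subseteq> {..<M}" for D
  proof -
    have fin: "finite D" using that finite_subset by auto
    have "{a\<in>C. fpow a k mod M \<in> D} = (\<Union>r\<in>D. {a\<in>C. fpow a k mod M \<in> {r}})" by auto
    hence "measure lborel {a\<in>C. fpow a k mod M \<in> D} = measure lborel (\<Union>r\<in>D. {a\<in>C. fpow a k mod M \<in> {r}})"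
      by (rule arg_cong)
    also have "\<dots> \<le> (\<Sum>r\<in>D. measure lborel {a\<in>C. fpow a k mod M \<in> {r}})"
      using sm by (intro measure_UNION_le[OF fin])
    also have "\<dots> \<le> (\<Sum>r\<in>D. measure lborel C / real M + ?e)"
      using measure_residue_interval[of A C b k M] assms by (intro sum_mono) simp
    finally show ?thesis by simp
  qed
  have cR: "card R \<le> M" using card_mono[OF _ assms(6)] by simp
  have cRc: "card ({..<M} - R) = M - card R" using assms(6) by (simp add: card_Diff_subset finite_subset)
  have e0: "0 \<le> ?e" using assms by simp
  have "measure lborel C = measure lborel ({a\<in>C. fpow a k mod M \<in> R} \<union> {a\<in>C. fpow a k mod M \<in> {..<M} - R})"
    using assms(5) by (intro arg_cong[of _ _ "measure lborel"]) auto
  also have "\<dots> \<le> measure lborel {a\<in>C. fpow a k mod M \<in> R} + measure lborel {a\<in>C. fpow a k mod M \<in> {..<M} - R}"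
    using sm by (intro measure_Un_le)
  also have "measure lborel {a\<in>C. fpow a k mod M \<in> {..<M} - R} \<le> real (M - card R) * (measure lborel C / real M + ?e)"
    using up[of "{..<M} - R"] cRc by simp
  finally have 1: "measure lborel C \<le> measure lborel {a\<in>C. fpow a k mod M \<in> R} + (real M - real (card R)) * (measure lborel C / real M + ?e)"
    using cR by (simp add: of_nat_diff)
  have 2: "measure lborel {a\<in>C. fpow a k mod M \<in> R} \<le> real (card R) * (measure lborel C / real M + ?e)"
    using up[OF assms(6)] .
  have 3: "real (card R) * ?e \<le> real M * ?e" using cR e0 by (intro mult_right_mono) auto
  have 7: "(real M - real (card R)) * ?e \<le> real M * ?e" using cR e0 by (intro mult_right_mono) auto
  have 4: "(real M - real (card R)) * (measure lborel C / real M + ?e) =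
     measure lborel C - real (card R) / real M * measure lborel C + (real M - real (card R)) * ?e"
    using assms(5) by (simp add: field_simps)
  have 5: "real (card R) * (measure lborel C / real M + ?e) = real (card R) / real M * measure lborel C + real (card R) * ?e"
    by (simp add: algebra_simps)
  have 6: "real M / A ^ (k - 1) = real M * ?e" by simp
  show ?thesis unfolding abs_le_iff 6 using 1 2 3 7 unfolding 4 5 by linarith
qed

section \<open>The probability space of cells\<close>

context
  fixes A :: real and T :: nat
begin

text \<open>Length \<open>1 / T\<close> keeps \<open>a ^ \<kappa>\<close> within a factor 3 of
  \<open>A ^ \<kappa>\<close> for \<open>\<kappa> < T\<close>, so the number of values of
  \<open>\<sigma> \<kappa>\<close> can be bounded in terms of \<open>A\<close>.\<close>

definition Iv :: "real set" where "Iv = {A..<A + 1 / real T}"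
definition rep :: "nat \<Rightarrow> real" where "rep v = (SOME a. a \<in> Iv \<and> \<sigma> T a = v)"
definition wt :: "nat \<Rightarrow> real" where "wt v = real T * measure lborel {a\<in>Iv. \<sigma> T a = v}"

context
  assumes A: "1 \<le> A" and T: "T \<ge> 1"
begin

lemma Iv_pos: "a \<in> Iv \<Longrightarrow> 0 \<le> a" using A by (auto simp: Iv_def)

lemma rep: assumes "v \<in> \<sigma> T ` Iv" shows "rep v \<in> Iv" "\<sigma> T (rep v) = v"
  using someI_ex[of "\<lambda>a. a \<in> Iv \<and> \<sigma> T a = v"] assms unfolding rep_def[symmetric] by auto

lemma sigma_upper: assumes "a \<in> Iv" "\<kappa> < T" shows "real (\<sigma> \<kappa> a) + 1 \<le> 4 * real T * A ^ \<kappa>"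
proof -
  have T1: "real T \<ge> 1" using T by simp
  have b: "a ^ i \<le> 3 * A ^ \<kappa>" if "i \<le> \<kappa>" for i
  proof -
    have "a ^ i \<le> a ^ \<kappa>" using assms(1) A that by (intro power_increasing) (auto simp: Iv_def)
    also have "\<dots> \<le> (A * (1 + 1 / real T)) ^ \<kappa>"
    proof (intro power_mono)
      have "a \<le> A + 1 * (1 / real T)" using assms(1) by (simp add: Iv_def)
      also have "1 * (1 / real T) \<le> A * (1 / real T)" using A by (intro mult_right_mono) auto
      finally show "a \<le> A * (1 + 1 / real T)" by (simp add: algebra_simps)
    qed (use assms(1) Iv_pos in auto)
    also have "\<dots> = A ^ \<kappa> * (1 + 1 / real T) ^ \<kappa>" by (simp add: power_mult_distrib)
    also have "(1 + 1 / real T) ^ \<kappa> \<le> (1 + 1 / real T) ^ T" using assms(2) by (intro power_increasing) auto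
    also have "\<dots> \<le> exp 1" using exp_ge_one_plus_x_over_n_power_n[of T 1] T by simp
    also have "\<dots> \<le> 3" by (rule exp_le)
    finally show ?thesis using A by (simp add: mult.commute)
  qed
  have "real (\<sigma> \<kappa> a) = (\<Sum>i\<le>\<kappa>. real (fpow a i))" by (simp add: \<sigma>_def)
  also have "\<dots> \<le> (\<Sum>i\<le>\<kappa>. 3 * A ^ \<kappa>)"
  proof (intro sum_mono)
    fix i assume i: "i \<in> {..\<kappa>}"
    have "real (fpow a i) \<le> a ^ i" using Iv_pos[OF assms(1)] by simp
    thus "real (fpow a i) \<le> 3 * A ^ \<kappa>" using b[of i] i by simp
  qed
  also have "\<dots> = 3 * (real \<kappa> + 1) * A ^ \<kappa>" by simp
  also have "\<dots> \<le> 3 * real T * A ^ \<kappa>" using assms(2) A by (intro mult_right_mono) auto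
  finally have "real (\<sigma> \<kappa> a) \<le> 3 * real T * A ^ \<kappa>" .
  moreover have "1 * 1 \<le> real T * A ^ \<kappa>" using T1 A by (intro mult_mono one_le_power) auto
  ultimately show ?thesis by simp
qed

lemma finite_sigma_image: "finite (\<sigma> \<kappa> ` Iv)"
proof (rule finite_subset)
  show "\<sigma> \<kappa> ` Iv \<subseteq> {..\<sigma> \<kappa> (A + 1 / real T)}"
    using Iv_pos by (auto intro!: sigma_mono simp: Iv_def)
qed simp

lemma card_sigma_image:
  assumes "\<kappa> < T" shows "real (card (\<sigma> \<kappa> ` Iv)) \<le> 4 * real T * A ^ \<kappa>"
proof -
  have ne: "Iv \<noteq> {}" using T by (auto simp: Iv_def)
  let ?m = "Max (\<sigma> \<kappa> ` Iv)"
  have "?m \<in> \<sigma> \<kappa> ` Iv" using ne finite_sigma_image by (intro Max_in) auto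
  then obtain a where a: "a \<in> Iv" "?m = \<sigma> \<kappa> a" by auto
  have "\<sigma> \<kappa> ` Iv \<subseteq> {..?m}" using finite_sigma_image by (auto intro: Max_ge)
  hence "card (\<sigma> \<kappa> ` Iv) \<le> card {..?m}" by (intro card_mono) auto
  thus ?thesis using sigma_upper[OF a(1) assms] a(2) by simp
qed

lemma fibre: "{a\<in>Iv. \<sigma> \<kappa> a = u} \<subseteq> {A..A + 1 / real T}" "is_interval {a\<in>Iv. \<sigma> \<kappa> a = u}"
proof -
  show "{a\<in>Iv. \<sigma> \<kappa> a = u} \<subseteq> {A..A + 1 / real T}" by (auto simp: Iv_def)
  show "is_interval {a\<in>Iv. \<sigma> \<kappa> a = u}" unfolding is_interval_1
  proof safe
    fix a b x assume "a \<in> Iv" "b \<in> Iv" "a \<le> x" "x \<le> b" "\<sigma> \<kappa> b = \<sigma> \<kappa> a" "u = \<sigma> \<kappa> a"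
    thus "x \<in> Iv" "\<sigma> \<kappa> x = \<sigma> \<kappa> a"
      using sigma_mono[of a x \<kappa>] sigma_mono[of x b \<kappa>] Iv_pos[of a] by (auto simp: Iv_def)
  qed
qed

text \<open>A property depending only on the value of \<open>\<sigma> T\<close> defines a finite
  union of fibres, and these are intervals. This leads from weighted sums over cells back to
  Lebesgue measure.\<close>

lemma saturated:
  assumes "\<And>a b. a \<in> Iv \<Longrightarrow> b \<in> Iv \<Longrightarrow> \<sigma> T a = \<sigma> T b \<Longrightarrow> R a = R b"
  shows "{a\<in>Iv. R a} \<in> sets borel"
    "(\<Sum>v | v \<in> \<sigma> T ` Iv \<and> R (rep v). wt v) = real T * measure lborel {a\<in>Iv. R a}"
proof -
  let ?F = "\<lambda>v. {a\<in>Iv. \<sigma> T a = v}"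
  let ?V = "{v. v \<in> \<sigma> T ` Iv \<and> R (rep v)}"
  have eq: "{a\<in>Iv. R a} = (\<Union>v\<in>?V. ?F v)"
  proof (intro Set.set_eqI iffI)
    fix a assume a: "a \<in> {a\<in>Iv. R a}"
    hence v: "\<sigma> T a \<in> \<sigma> T ` Iv" "a \<in> Iv" "R a" by auto
    have "R (rep (\<sigma> T a)) = R a" by (rule assms[OF rep(1)[OF v(1)] v(2) rep(2)[OF v(1)]])
    thus "a \<in> (\<Union>v\<in>?V. ?F v)" using v by blast
  next
    fix a assume "a \<in> (\<Union>v\<in>?V. ?F v)"
    then obtain v where v: "v \<in> \<sigma> T ` Iv" "R (rep v)" "a \<in> Iv" "\<sigma> T a = v" by blast
    have "R (rep v) = R a"
      by (rule assms[OF rep(1)[OF v(1)] v(3)]) (simp only: rep(2)[OF v(1)] v(4))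
    thus "a \<in> {a\<in>Iv. R a}" using v by blast
  qed
  have m: "?F v \<in> sets lborel" for v using bounded_interval_borel'[OF fibre] by simp
  have fin: "finite ?V" using finite_sigma_image by simp
  show "{a\<in>Iv. R a} \<in> sets borel" unfolding eq using m fin by auto
  have "measure lborel {a\<in>Iv. R a} = (\<Sum>v\<in>?V. measure lborel (?F v))"
    unfolding eq
  proof (rule measure_finite_Union)
    show "disjoint_family_on ?F ?V" by (auto simp: disjoint_family_on_def)
    fix v
    have "emeasure lborel (?F v) \<le> emeasure lborel {A..A + 1 / real T}"
      using fibre(1) by (intro emeasure_mono) auto
    also have "\<dots> < \<infinity>" by simp
    finally show "emeasure lborel (?F v) \<noteq> \<infinity>" by simp
  qed (use fin m in auto)
  thus "(\<Sum>v\<in>?V. wt v) = real T * measure lborel {a\<in>Iv. R a}"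
    by (simp add: wt_def sum_distrib_left)
qed

text \<open>\<open>g\<close> is constant on the fibres of \<open>\<sigma> \<kappa>\<close>, and on
  each of these intervals the residue error is at most \<open>M / A ^ (k - 1)\<close>. There are at
  most \<open>4 * T * A ^ \<kappa>\<close> fibres, so only \<open>A ^ (k - \<kappa>)\<close> has to
  be large against \<open>M\<close>.\<close>

lemma cells_error:
  assumes k: "\<kappa> < k" "k \<le> T" and M: "M > 0" "R \<subseteq> {..<M}"
    and past: "\<And>u v. u \<in> \<sigma> T ` Iv \<Longrightarrow> v \<in> \<sigma> T ` Iv \<Longrightarrow>
       (\<And>i. i \<le> \<kappa> \<Longrightarrow> fpow (rep u) i = fpow (rep v) i) \<Longrightarrow> g u = g v"
    and bd: "\<And>v. v \<in> \<sigma> T ` Iv \<Longrightarrow> 0 \<le> g v \<and> g v \<le> G"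
  shows "\<bar>(\<Sum>v\<in>\<sigma> T ` Iv. wt v * (g v * of_bool (fpow (rep v) k mod M \<in> R))) -
        real (card R) / real M * (\<Sum>v\<in>\<sigma> T ` Iv. wt v * g v)\<bar>
     \<le> G * (4 * (real T)\<^sup>2 * A * real M / A ^ (k - \<kappa>))"
proof -
  let ?\<Omega> = "\<sigma> T ` Iv"
  define s where "s v = \<sigma> \<kappa> (rep v)" for v
  define \<gamma> where "\<gamma> u = g (SOME v. v \<in> ?\<Omega> \<and> s v = u)" for u
  define c where "c = real (card R) / real M"
  define C where "C u = {a\<in>Iv. \<sigma> \<kappa> a = u}" for u
  have fin: "finite ?\<Omega>" by (rule finite_sigma_image)
  have g: "g v = \<gamma> (s v)" if "v \<in> ?\<Omega>" for v
  proof -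
    define v' where "v' = (SOME v'. v' \<in> ?\<Omega> \<and> s v' = s v)"
    have v': "v' \<in> ?\<Omega>" "s v' = s v" using someI_ex[of "\<lambda>v'. v' \<in> ?\<Omega> \<and> s v' = s v"] that
      unfolding v'_def[symmetric] by auto
    have "g v = g v'"
    proof (rule past[OF that v'(1)])
      fix i assume i: "i \<le> \<kappa>"
      show "fpow (rep v) i = fpow (rep v') i"
        by (rule sigma_eqD[OF Iv_pos[OF rep(1)[OF that]] Iv_pos[OF rep(1)[OF v'(1)]] _ i])
          (use v'(2) in \<open>simp only: s_def\<close>)
    qed
    thus ?thesis by (simp add: \<gamma>_def v'_def)
  qed
  have \<gamma>b: "0 \<le> \<gamma> u \<and> \<gamma> u \<le> G" if "u \<in> s ` ?\<Omega>" for u using that g bd by fastforce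
  \<comment> \<open>Cells are collected by their value of \<open>\<sigma> \<kappa>\<close>; each
    group is again the part of an interval \<open>C u\<close> where \<open>Z\<close> holds.\<close>
  have group: "(\<Sum>v\<in>?\<Omega>. wt v * (g v * of_bool (Z (rep v)))) =
      (\<Sum>u\<in>s ` ?\<Omega>. \<gamma> u * (real T * measure lborel {a\<in>C u. Z a}))"
    if Z: "\<And>a b. a \<in> Iv \<Longrightarrow> b \<in> Iv \<Longrightarrow> \<sigma> T a = \<sigma> T b \<Longrightarrow> Z a = Z b" for Z
  proof -
    have "(\<Sum>v\<in>?\<Omega>. wt v * (g v * of_bool (Z (rep v)))) =
       (\<Sum>u\<in>s ` ?\<Omega>. \<Sum>v | v \<in> ?\<Omega> \<and> s v = u. wt v * (g v * of_bool (Z (rep v))))"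
      using fin by (intro sum.group[symmetric]) auto
    also have "\<dots> = (\<Sum>u\<in>s ` ?\<Omega>. \<gamma> u * (real T * measure lborel {a\<in>C u. Z a}))"
    proof (intro sum.cong refl)
      fix u
      have "(\<Sum>v | v \<in> ?\<Omega> \<and> s v = u. wt v * (g v * of_bool (Z (rep v)))) =
        \<gamma> u * (\<Sum>v | v \<in> ?\<Omega> \<and> s v = u. if Z (rep v) then wt v else 0)"
        unfolding sum_distrib_left using g by (intro sum.cong) auto
      also have "(\<Sum>v | v \<in> ?\<Omega> \<and> s v = u. if Z (rep v) then wt v else 0) =
         (\<Sum>v | v \<in> ?\<Omega> \<and> (\<sigma> \<kappa> (rep v) = u \<and> Z (rep v)). wt v)"
      proof -
        have eq: "{v. v \<in> ?\<Omega> \<and> (\<sigma> \<kappa> (rep v) = u \<and> Z (rep v))} = {v \<in> {v. v \<in> ?\<Omega> \<and> s v = u}. Z (rep v)}"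
          unfolding s_def by blast
        have "finite {v. v \<in> ?\<Omega> \<and> s v = u}" by (rule finite_subset[OF _ fin]) blast
        thus ?thesis unfolding eq by (rule sum.inter_filter[symmetric])
      qed
      also have "\<dots> = real T * measure lborel {a\<in>Iv. \<sigma> \<kappa> a = u \<and> Z a}"
      proof (rule saturated(2))
        fix a b assume ab: "a \<in> Iv" "b \<in> Iv" "\<sigma> T a = \<sigma> T b"
        have "fpow a i = fpow b i" if "i \<le> \<kappa>" for i
          by (rule sigma_eqD[OF Iv_pos[OF ab(1)] Iv_pos[OF ab(2)] ab(3)]) (use that k in linarith)
        hence "\<sigma> \<kappa> a = \<sigma> \<kappa> b" by (rule sigma_cong)
        thus "(\<sigma> \<kappa> a = u \<and> Z a) = (\<sigma> \<kappa> b = u \<and> Z b)" using Z[OF ab] by presburger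
      qed
      finally show "(\<Sum>v | v \<in> ?\<Omega> \<and> s v = u. wt v * (g v * of_bool (Z (rep v)))) =
         \<gamma> u * (real T * measure lborel {a\<in>C u. Z a})" by (simp add: C_def conj_assoc)
    qed
    finally show ?thesis .
  qed
  have e1: "(\<Sum>v\<in>?\<Omega>. wt v * (g v * of_bool (fpow (rep v) k mod M \<in> R))) =
      (\<Sum>u\<in>s ` ?\<Omega>. \<gamma> u * (real T * measure lborel {a\<in>C u. fpow a k mod M \<in> R}))"
  proof (rule group)
    fix a b assume ab: "a \<in> Iv" "b \<in> Iv" "\<sigma> T a = \<sigma> T b"
    have "fpow a k = fpow b k" 
      by (rule sigma_eqD[OF Iv_pos[OF ab(1)] Iv_pos[OF ab(2)] ab(3) k(2)])
    thus "(fpow a k mod M \<in> R) = (fpow b k mod M \<in> R)" by simp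
  qed
  have e2: "(\<Sum>v\<in>?\<Omega>. wt v * g v) = (\<Sum>u\<in>s ` ?\<Omega>. \<gamma> u * (real T * measure lborel (C u)))"
    using group[of "\<lambda>a. True"] by simp
  have cardS: "real (card (s ` ?\<Omega>)) \<le> 4 * real T * A ^ \<kappa>"
  proof -
    have "s ` ?\<Omega> \<subseteq> \<sigma> \<kappa> ` Iv" using rep by (auto simp: s_def)
    hence "card (s ` ?\<Omega>) \<le> card (\<sigma> \<kappa> ` Iv)" by (intro card_mono finite_sigma_image)
    thus ?thesis using card_sigma_image[of \<kappa>] k by linarith
  qed
  have "\<bar>(\<Sum>v\<in>?\<Omega>. wt v * (g v * of_bool (fpow (rep v) k mod M \<in> R))) - c * (\<Sum>v\<in>?\<Omega>. wt v * g v)\<bar> =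
     \<bar>\<Sum>u\<in>s ` ?\<Omega>. \<gamma> u * real T * (measure lborel {a\<in>C u. fpow a k mod M \<in> R} - c * measure lborel (C u))\<bar>"
    unfolding e1 e2 by (simp add: sum_distrib_left sum_subtractf algebra_simps)
  also have "\<dots> \<le> (\<Sum>u\<in>s ` ?\<Omega>. \<bar>\<gamma> u * real T * (measure lborel {a\<in>C u. fpow a k mod M \<in> R} - c * measure lborel (C u))\<bar>)"
    by (rule sum_abs)
  also have "\<dots> \<le> (\<Sum>u\<in>s ` ?\<Omega>. G * real T * (real M / A ^ (k - 1)))"
  proof (intro sum_mono)
    fix u assume u: "u \<in> s ` ?\<Omega>"
    have "\<bar>measure lborel {a\<in>C u. fpow a k mod M \<in> R} - c * measure lborel (C u)\<bar> \<le> real M / A ^ (k - 1)"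
      unfolding c_def C_def using fibre A k M by (intro measure_residue_set_interval) auto
    thus "\<bar>\<gamma> u * real T * (measure lborel {a\<in>C u. fpow a k mod M \<in> R} - c * measure lborel (C u))\<bar>
       \<le> G * real T * (real M / A ^ (k - 1))"
      unfolding abs_mult using \<gamma>b[OF u] by (intro mult_mono) auto
  qed
  also have "\<dots> = real (card (s ` ?\<Omega>)) * (G * real T * (real M / A ^ (k - 1)))" by simp
  also have "\<dots> \<le> (4 * real T * A ^ \<kappa>) * (G * real T * (real M / A ^ (k - 1)))"
  proof (intro mult_right_mono cardS)
    have "?\<Omega> \<noteq> {}" using T by (auto simp: Iv_def)
    hence "0 \<le> G" using bd by force
    thus "0 \<le> G * real T * (real M / A ^ (k - 1))" using A by simp
  qed
  also have "\<dots> = G * (4 * (real T)\<^sup>2 * A * real M / A ^ (k - \<kappa>))"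
  proof -
    have "A ^ \<kappa> / A ^ (k - 1) = A / A ^ (k - \<kappa>)"
    proof -
      have "A ^ \<kappa> * A ^ (k - \<kappa>) = A * A ^ (k - 1)"
        using k by (simp flip: power_add power_Suc)
      thus ?thesis using A by (simp add: field_simps)
    qed
    hence *: "4 * real T * G * real T * real M * (A ^ \<kappa> / A ^ (k - 1)) =
       4 * real T * G * real T * real M * (A / A ^ (k - \<kappa>))" by (rule arg_cong)
    have "(4 * real T * A ^ \<kappa>) * (G * real T * (real M / A ^ (k - 1))) =
       4 * real T * G * real T * real M * (A ^ \<kappa> / A ^ (k - 1))" by simp
    also note *
    finally show ?thesis by (simp add: power2_eq_square)
  qed
  finally show ?thesis unfolding c_def .
qed

lemma fresh_space_cells:
  assumes "P > 0" "L > 0" "H > 0" "0 \<le> \<theta>"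
    and "4 * (real T)\<^sup>2 * A * (real P * real B) \<le> \<theta> * A ^ H"
    and "4 * (real T)\<^sup>2 * A * real B \<le> \<theta> * A ^ L"
  shows "fresh_space (\<sigma> T ` Iv) wt (\<lambda>k v. fpow (rep v) k) T H L P B \<theta>"
proof
  show "finite (\<sigma> T ` Iv)" by (rule finite_sigma_image)
  show "0 \<le> wt v" for v by (simp add: wt_def)
  show "(\<Sum>v\<in>\<sigma> T ` Iv. wt v) = 1"
  proof -
    have "measure lborel Iv = 1 / real T" by (simp add: Iv_def)
    moreover have "{v. v \<in> \<sigma> T ` Iv \<and> True} = \<sigma> T ` Iv" "{a\<in>Iv. True} = Iv" by auto
    ultimately show ?thesis using saturated(2)[of "\<lambda>_. True"] T by simp
  qed
  have aux: "G * (4 * (real T)\<^sup>2 * A * real M / A ^ (k - \<kappa>)) \<le> G * \<theta>"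
    if "0 \<le> G" "D \<le> k - \<kappa>" "real M \<le> M'" "4 * (real T)\<^sup>2 * A * M' \<le> \<theta> * A ^ D" for G M M' D k \<kappa>
  proof (intro mult_left_mono that)
    have "4 * (real T)\<^sup>2 * A * real M \<le> 4 * (real T)\<^sup>2 * A * M'" using that A by (intro mult_left_mono) auto
    also have "\<dots> \<le> \<theta> * A ^ D" by (rule that)
    also have "\<dots> \<le> \<theta> * A ^ (k - \<kappa>)" using that A assms(4) by (intro mult_left_mono power_increasing) auto
    finally show "4 * (real T)\<^sup>2 * A * real M / A ^ (k - \<kappa>) \<le> \<theta>" using A by (simp add: divide_le_eq)
  qed
  have ne: "\<sigma> T ` Iv \<noteq> {}" using T by (auto simp: Iv_def)
  {
    fix \<kappa> k M :: nat and g :: "nat \<Rightarrow> real" and G R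
    assume k: "k \<le> T" and g: "\<And>u v. u \<in> \<sigma> T ` Iv \<Longrightarrow> v \<in> \<sigma> T ` Iv \<Longrightarrow>
       (\<And>i. i \<le> \<kappa> \<Longrightarrow> fpow (rep u) i = fpow (rep v) i) \<Longrightarrow> g u = g v"
      and bd: "\<And>v. v \<in> \<sigma> T ` Iv \<Longrightarrow> 0 \<le> g v \<and> g v \<le> G"
      and M: "0 < M" "R \<subseteq> {..<M}"
    have G: "0 \<le> G" using ne bd by force
    let ?concl = "\<bar>(\<Sum>v\<in>\<sigma> T ` Iv. wt v * (g v * of_bool (fpow (rep v) k mod M \<in> R))) -
        real (card R) / real M * (\<Sum>v\<in>\<sigma> T ` Iv. wt v * g v)\<bar> \<le> G * \<theta>"
    have ce: "\<bar>(\<Sum>v\<in>\<sigma> T ` Iv. wt v * (g v * of_bool (fpow (rep v) k mod M \<in> R))) -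
        real (card R) / real M * (\<Sum>v\<in>\<sigma> T ` Iv. wt v * g v)\<bar>
       \<le> G * (4 * (real T)\<^sup>2 * A * real M / A ^ (k - \<kappa>))" if kk: "\<kappa> < k"
    proof (rule cells_error[OF kk k M])
      show "g u = g v" if "u \<in> \<sigma> T ` Iv" "v \<in> \<sigma> T ` Iv"
        "\<And>i. i \<le> \<kappa> \<Longrightarrow> fpow (rep u) i = fpow (rep v) i" for u v by (rule g[OF that])
      show "0 \<le> g v \<and> g v \<le> G" if "v \<in> \<sigma> T ` Iv" for v by (rule bd[OF that])
    qed
    show ?concl if "\<kappa> + H \<le> k" "M \<le> P * B"
    proof -
      have "real M \<le> real P * real B" using that(2) by (metis of_nat_le_iff of_nat_mult)
      hence "G * (4 * (real T)\<^sup>2 * A * real M / A ^ (k - \<kappa>)) \<le> G * \<theta>"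
        using that(1) G assms(5) by (intro aux[where D = H]) auto
      moreover have kk: "\<kappa> < k" using that(1) assms(3) by simp
      ultimately show ?thesis using ce[OF kk] by linarith
    qed
    show ?concl if "\<kappa> + L \<le> k" "M \<le> B"
    proof -
      have "real M \<le> real B" using that(2) by simp
      hence "G * (4 * (real T)\<^sup>2 * A * real M / A ^ (k - \<kappa>)) \<le> G * \<theta>"
        using that(1) G assms(6) by (intro aux[where D = L]) auto
      moreover have kk: "\<kappa> < k" using that(1) assms(2) by simp
      ultimately show ?thesis using ce[OF kk] by linarith
    qed
  }
qed (use assms in auto)

end

end

section \<open>Covering by few primes\<close>

text \<open>Chinese remainders with three prescriptions: 0 on \<open>\<P>\<close>, \<open>b\<close>
  on \<open>\<Q>\<close>, and on \<open>\<R>\<close> the value \<open>x k\<close> of the exponent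
  that the injection \<open>\<iota>\<close> sends to this prime.\<close>

lemma ex_cong_cover:
  fixes x :: "nat \<Rightarrow> nat" and \<P> \<Q> \<R> :: "nat set" and b :: "nat \<Rightarrow> nat"
  assumes fin: "finite \<P>" "finite \<Q>" "finite \<R>"
    and prime: "\<And>p. p \<in> \<P> \<union> \<Q> \<union> \<R> \<Longrightarrow> prime p"
    and disj: "\<P> \<inter> \<Q> = {}" "(\<P> \<union> \<Q>) \<inter> \<R> = {}"
    and U: "finite U" "card U \<le> card \<R>"
      "\<And>k. k \<in> I \<Longrightarrow> coprime (x k) (\<Prod>\<P>) \<Longrightarrow> (\<forall>q\<in>\<Q>. x k mod q \<noteq> b q) \<Longrightarrow> k \<in> U"
  shows "\<exists>c. \<forall>k\<in>I. \<exists>p\<in>\<P> \<union> \<Q> \<union> \<R>. [c = x k] (mod p)"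
proof -
  obtain \<iota> where \<iota>: "inj_on \<iota> U" "\<iota> ` U \<subseteq> \<R>"
    using card_le_inj[OF U(1) fin(3) U(2)] by auto
  define u where "u p = (if p \<in> \<P> then 0 else if p \<in> \<Q> then b p else x (inv_into U \<iota> p))" for p
  have "\<exists>c. \<forall>p\<in>\<P> \<union> \<Q> \<union> \<R>. [c = u p] (mod p)"
    using fin prime by (intro chinese_remainder_nat[of _ "\<lambda>p. p"]) (auto intro: primes_coprime)
  then obtain c where c: "\<And>p. p \<in> \<P> \<union> \<Q> \<union> \<R> \<Longrightarrow> [c = u p] (mod p)" by blast
  have "\<exists>p\<in>\<P> \<union> \<Q> \<union> \<R>. [c = x k] (mod p)" if k: "k \<in> I" for k
  proof (cases "coprime (x k) (\<Prod>\<P>)")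
    case False
    then obtain p where p: "p \<in> \<P>" "\<not> coprime (x k) p"
      using prod_coprime_right[of \<P> "x k" "\<lambda>p. p"] by auto
    hence "p dvd x k" using prime[of p] prime_imp_coprime_nat coprime_commute by blast
    hence "[c = x k] (mod p)" using c[of p] p by (simp add: u_def cong_def)
    thus ?thesis using p by blast
  next
    case coP: True
    show ?thesis
    proof (cases "\<forall>q\<in>\<Q>. x k mod q \<noteq> b q")
      case False
      then obtain q where q: "q \<in> \<Q>" "x k mod q = b q" by blast
      have "u q = b q" using q disj by (auto simp: u_def)
      hence "[c = b q] (mod q)" using c[of q] q by simp
      hence "[c = x k] (mod q)" unfolding q(2)[symmetric] by (simp add: cong_def)
      thus ?thesis using q by blast
    next
      case True
      hence kU: "k \<in> U" using U(3) k coP by blast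
      hence r: "\<iota> k \<in> \<R>" using \<iota> by blast
      hence "u (\<iota> k) = x k" using disj inv_into_f_f[OF \<iota>(1) kU] by (auto simp: u_def)
      hence "[c = x k] (mod (\<iota> k))" using c[of "\<iota> k"] r by simp
      thus ?thesis using r by blast
    qed
  qed
  thus ?thesis by blast
qed

section \<open>Combination of the residue classes of exponents\<close>

text \<open>Markov's inequality.\<close>

lemma ex_bad_set:
  fixes Y :: "'a \<Rightarrow> real"
  assumes "finite \<Omega>" "\<And>v. v \<in> \<Omega> \<Longrightarrow> 0 \<le> w v" "\<And>v. v \<in> \<Omega> \<Longrightarrow> 0 \<le> Y v" "Z > 0"
  shows "(\<Sum>v | v \<in> \<Omega> \<and> Y v > Z. w v) \<le> (\<Sum>v\<in>\<Omega>. w v * Y v) / Z"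
proof -
  have "Z * (\<Sum>v | v \<in> \<Omega> \<and> Y v > Z. w v) \<le> (\<Sum>v | v \<in> \<Omega> \<and> Y v > Z. w v * Y v)"
    unfolding sum_distrib_left
  proof (rule sum_mono)
    fix v assume v: "v \<in> {v. v \<in> \<Omega> \<and> Z < Y v}"
    have "w v * Z \<le> w v * Y v" using v assms by (intro mult_left_mono) auto
    thus "Z * w v \<le> w v * Y v" by (simp add: mult.commute)
  qed
  also have "\<dots> \<le> (\<Sum>v\<in>\<Omega>. w v * Y v)" using assms by (intro sum_mono2) auto
  finally show ?thesis using assms(4) by (simp add: field_simps)
qed

text \<open>Stated without the constants of the locale, so that the instances for the
  \<open>L\<close> different \<open>r\<close> can be combined.\<close>

lemma (in fresh_primes) ex_classes_explicit:
  defines "\<beta>' \<equiv> real m * (real (card {x. x < P \<and> coprime x P}) / real P)"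
  shows "\<exists>Y. (\<forall>v\<in>\<Omega>. 0 \<le> Y v) \<and> (\<Sum>v\<in>\<Omega>. w v * Y v) \<le> 74 * real J * \<beta>' * \<xi> \<and>
    (\<forall>v\<in>\<Omega>. \<exists>b. real (card {(j, i). j < J \<and> i < m \<and> coprime (X (j * S + H + r + L * i) v) P \<and>
        (\<forall>q\<in>Q. X (j * S + H + r + L * i) v mod q \<noteq> b q)})
      \<le> 2 * real J * \<beta>' * exp (- (real (card Q) / \<beta>') / 4) + Y v)"
proof -
  have \<beta>': "\<beta>' = \<beta>" by (simp add: \<beta>'_def \<beta>_def V_def)
  show ?thesis
    using E_Y ex_classes Y_nonneg unfolding \<beta>' E_def e_def \<mu>_def N_def by blast
qed

text \<open>The error functions of the \<open>L\<close> residue classes are added up and Markov's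
  inequality is applied to the sum. As the sets \<open>Qr r\<close> are disjoint, the choices of
  classes merge into one function \<open>b\<close>. The \<open>T - J * L * m\<close> exponents
  outside the segments are all counted as left over.\<close>

lemma ex_bad_cells:
  fixes \<Omega> :: "'a set" and w :: "'a \<Rightarrow> real" and X :: "nat \<Rightarrow> 'a \<Rightarrow> nat" and Qr :: "nat \<Rightarrow> nat set" and P m :: nat
  defines "\<beta> \<equiv> real m * (real (card {x. x < P \<and> coprime x P}) / real P)"
  assumes fp: "\<And>r. r < L \<Longrightarrow> fresh_primes \<Omega> w X T H L P B \<theta> S J m r (Qr r) \<Lambda> \<xi> Bd"
    and Q_disj: "\<And>r r'. r < L \<Longrightarrow> r' < L \<Longrightarrow> r \<noteq> r' \<Longrightarrow> Qr r \<inter> Qr r' = {}"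
    and N: "\<And>r. r < L \<Longrightarrow> card (Qr r) = N"
    and pos: "L > 0" "H > 0" "Z > 0"
  obtains bad where "bad \<subseteq> \<Omega>" "(\<Sum>v\<in>bad. w v) \<le> real L * (74 * real J * \<beta> * \<xi>) / Z"
    "\<And>v. v \<in> \<Omega> - bad \<Longrightarrow> \<exists>b. real (card {k \<in> {1..T}. coprime (X k v) P \<and> (\<forall>q\<in>(\<Union>r<L. Qr r). X k v mod q \<noteq> b q)})
       \<le> real (T - J * L * m) + real L * (2 * real J * \<beta> * exp (- (real N / \<beta>) / 4)) + Z"
proof -
  have fs: "fresh_space \<Omega> w X T H L P B \<theta>" and seg: "H + L * m \<le> S" "J * S \<le> T"
  proof -
    interpret fresh_primes \<Omega> w X T H L P B \<theta> S J m 0 "Qr 0" \<Lambda> \<xi> Bd by (rule fp[OF pos(1)])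
    show "fresh_space \<Omega> w X T H L P B \<theta>" by (rule fresh_space_axioms)
    show "H + L * m \<le> S" "J * S \<le> T" using fits by auto
  qed
  define e where "e r j i = j * S + H + r + L * i" for r j i
  define good where "good r Y \<longleftrightarrow> (\<forall>v\<in>\<Omega>. 0 \<le> Y v) \<and> (\<Sum>v\<in>\<Omega>. w v * Y v) \<le> 74 * real J * \<beta> * \<xi> \<and>
    (\<forall>v\<in>\<Omega>. \<exists>b. real (card {(j, i). j < J \<and> i < m \<and> coprime (X (e r j i) v) P \<and>
        (\<forall>q\<in>Qr r. X (e r j i) v mod q \<noteq> b q)})
      \<le> 2 * real J * \<beta> * exp (- (real N / \<beta>) / 4) + Y v)" for r Y
  have "\<forall>r\<in>{..<L}. \<exists>Y. good r Y"
  proof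
    fix r assume "r \<in> {..<L}"
    hence r: "r < L" by simp
    show "\<exists>Y. good r Y"
      using fresh_primes.ex_classes_explicit[OF fp[OF r]] unfolding good_def \<beta>_def e_def N[OF r] .
  qed
  then obtain Y where "\<forall>r\<in>{..<L}. good r (Y r)" unfolding bchoice_iff by blast
  hence Y: "\<And>r v. r < L \<Longrightarrow> v \<in> \<Omega> \<Longrightarrow> 0 \<le> Y r v"
    "\<And>r. r < L \<Longrightarrow> (\<Sum>v\<in>\<Omega>. w v * Y r v) \<le> 74 * real J * \<beta> * \<xi>"
    "\<And>r v. r < L \<Longrightarrow> v \<in> \<Omega> \<Longrightarrow> \<exists>b. real (card {(j, i). j < J \<and> i < m \<and> coprime (X (e r j i) v) P \<and>
        (\<forall>q\<in>Qr r. X (e r j i) v mod q \<noteq> b q)})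
      \<le> 2 * real J * \<beta> * exp (- (real N / \<beta>) / 4) + Y r v" unfolding good_def by auto
  define Yt where "Yt v = (\<Sum>r<L. Y r v)" for v
  define bad where "bad = {v. v \<in> \<Omega> \<and> Yt v > Z}"
  have "(\<Sum>v\<in>bad. w v) \<le> (\<Sum>v\<in>\<Omega>. w v * Yt v) / Z"
    unfolding bad_def
  proof (rule ex_bad_set[OF fresh_space.finite_Omega[OF fs] fresh_space.w_nonneg[OF fs] _ pos(3)])
    show "0 \<le> Yt v" if "v \<in> \<Omega>" for v unfolding Yt_def using Y(1) that by (intro sum_nonneg) simp
  qed
  also have "(\<Sum>v\<in>\<Omega>. w v * Yt v) = (\<Sum>r<L. \<Sum>v\<in>\<Omega>. w v * Y r v)"
    unfolding Yt_def sum_distrib_left by (rule sum.swap)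
  also have "\<dots> \<le> (\<Sum>r<L. 74 * real J * \<beta> * \<xi>)" using Y(2) by (intro sum_mono) auto
  finally have 1: "(\<Sum>v\<in>bad. w v) \<le> real L * (74 * real J * \<beta> * \<xi>) / Z"
    using pos by (simp add: divide_right_mono)
  have 2: "\<exists>b. real (card {k \<in> {1..T}. coprime (X k v) P \<and> (\<forall>q\<in>(\<Union>r<L. Qr r). X k v mod q \<noteq> b q)})
       \<le> real (T - J * L * m) + real L * (2 * real J * \<beta> * exp (- (real N / \<beta>) / 4)) + Z"
    if v: "v \<in> \<Omega> - bad" for v
  proof -
    let ?c = "2 * real J * \<beta> * exp (- (real N / \<beta>) / 4)"
    define D where "D r bb = {(j, i). j < J \<and> i < m \<and> coprime (X (e r j i) v) P \<and>
        (\<forall>q\<in>Qr r. X (e r j i) v mod q \<noteq> bb q)}" for r and bb :: "nat \<Rightarrow> nat"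
    have "\<forall>r\<in>{..<L}. \<exists>b. real (card (D r b)) \<le> ?c + Y r v" using Y(3) v unfolding D_def by auto
    then obtain bb where bb: "\<And>r. r < L \<Longrightarrow> real (card (D r (bb r))) \<le> ?c + Y r v"
      unfolding bchoice_iff by auto
    define b where "b q = bb (THE r. r < L \<and> q \<in> Qr r) q" for q
    have b: "b q = bb r q" if "r < L" "q \<in> Qr r" for r q
    proof -
      have "(THE r. r < L \<and> q \<in> Qr r) = r" using that Q_disj by (intro the_equality) auto
      thus ?thesis by (simp add: b_def)
    qed
    define E where "E = (\<lambda>(r, j, i). e r j i) ` ({..<L} \<times> {..<J} \<times> {..<m})"
    \<comment> \<open>After subtraction of \<open>H\<close>, division by \<open>S\<close> recovers
      \<open>j\<close>, and division of the remainder by \<open>L\<close> recovers \<open>r\<close>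
      and \<open>i\<close>.\<close>
    have inj: "inj_on (\<lambda>(r, j, i). e r j i) ({..<L} \<times> {..<J} \<times> {..<m})"
    proof (rule inj_onI)
      fix x y assume xy: "x \<in> {..<L} \<times> {..<J} \<times> {..<m}" "y \<in> {..<L} \<times> {..<J} \<times> {..<m}"
        "(case x of (r, j, i) \<Rightarrow> e r j i) = (case y of (r, j, i) \<Rightarrow> e r j i)"
      obtain r j i r' j' i' where eq: "x = (r, j, i)" "y = (r', j', i')" by (metis prod_cases3)
      have a: "r \<in> {..<L}" "r' \<in> {..<L}" "j \<in> {..<J}" "j' \<in> {..<J}" "i \<in> {..<m}" "i' \<in> {..<m}" "e r j i = e r' j' i'"
        using xy by (auto simp: eq)
      have lt: "r + L * i < L * m" if "r < L" "i < m" for r i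
      proof -
        have "L * i + L \<le> L * m" using that by (metis Suc_leI mult_Suc_right mult_le_mono2 add.commute)
        thus ?thesis using that by linarith
      qed
      define s s' where "s = r + L * i" and "s' = r' + L * i'"
      have s: "s < S" "s' < S" using lt[of r i] lt[of r' i'] a seg unfolding s_def s'_def by auto
      have "j * S + s = j' * S + s'" using a(7) by (simp add: e_def s_def s'_def)
      hence "(j * S + s) div S = (j' * S + s') div S" "(j * S + s) mod S = (j' * S + s') mod S" by simp_all
      hence js: "j = j'" "s = s'" using s by simp_all
      have "(r + L * i) mod L = (r' + L * i') mod L" "(r + L * i) div L = (r' + L * i') div L"
        using js(2) unfolding s_def s'_def by simp_all
      thus "x = y" using js(1) a by (simp add: eq)
    qed
    have ET: "E \<subseteq> {1..T}"
    proof
      fix k assume "k \<in> E"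
      then obtain r j i where k: "k = e r j i" "r < L" "j < J" "i < m" unfolding E_def by auto
      have "L * i + L \<le> L * m" using k by (metis Suc_leI mult_Suc_right mult_le_mono2 add.commute)
      hence "e r j i \<le> j * S + S" using k seg unfolding e_def by linarith
      also have "j * S + S \<le> J * S" using k by (metis Suc_leI mult_Suc mult_le_mono1 add.commute)
      also have "\<dots> \<le> T" by (rule seg)
      finally show "k \<in> {1..T}" using k pos by (simp add: e_def)
    qed
    have cE: "card E = J * L * m" unfolding E_def card_image[OF inj] by (simp add: card_cartesian_product)
    let ?U = "{k \<in> {1..T}. coprime (X k v) P \<and> (\<forall>q\<in>(\<Union>r<L. Qr r). X k v mod q \<noteq> b q)}"
    have "?U \<subseteq> ({1..T} - E) \<union> (\<Union>r<L. (\<lambda>(j, i). e r j i) ` D r (bb r))"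
    proof
      fix k assume k: "k \<in> ?U"
      show "k \<in> ({1..T} - E) \<union> (\<Union>r<L. (\<lambda>(j, i). e r j i) ` D r (bb r))"
      proof (cases "k \<in> E")
        case True
        then obtain r j i where kk: "k = e r j i" "r < L" "j < J" "i < m" unfolding E_def by auto
        have "\<forall>q\<in>Qr r. X k v mod q \<noteq> bb r q" using k kk(2) b by auto
        hence "(j, i) \<in> D r (bb r)" using k kk by (auto simp: D_def)
        thus ?thesis using kk by force
      qed (use k in auto)
    qed
    moreover have finD: "finite (D r (bb r))" for r
      by (rule finite_subset[of _ "{..<J} \<times> {..<m}"]) (auto simp: D_def)
    ultimately have "card ?U \<le> card (({1..T} - E) \<union> (\<Union>r<L. (\<lambda>(j, i). e r j i) ` D r (bb r)))"
      by (intro card_mono) auto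
    also have "\<dots> \<le> card ({1..T} - E) + card (\<Union>r<L. (\<lambda>(j, i). e r j i) ` D r (bb r))" by (rule card_Un_le)
    also have "card (\<Union>r<L. (\<lambda>(j, i). e r j i) ` D r (bb r)) \<le> (\<Sum>r<L. card ((\<lambda>(j, i). e r j i) ` D r (bb r)))"
      by (rule card_UN_le) simp
    also have "\<dots> \<le> (\<Sum>r<L. card (D r (bb r)))" using finD by (intro sum_mono card_image_le)
    also have "card ({1..T} - E) = T - J * L * m" using ET cE by (simp add: card_Diff_subset finite_subset)
    finally have "real (card ?U) \<le> real (T - J * L * m) + (\<Sum>r<L. real (card (D r (bb r))))"
      by (simp flip: of_nat_sum of_nat_add)
    also have "(\<Sum>r<L. real (card (D r (bb r)))) \<le> (\<Sum>r<L. ?c + Y r v)" using bb by (intro sum_mono) auto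
    also have "\<dots> = real L * ?c + Yt v" by (simp add: sum.distrib Yt_def)
    also have "Yt v \<le> Z" using v by (auto simp: bad_def)
    finally show ?thesis by (intro exI[of _ b]) simp
  qed
  show ?thesis by (rule that[OF _ 1 2]) (auto simp: bad_def)
qed

definition covered :: "nat \<Rightarrow> real \<Rightarrow> real \<Rightarrow> bool" where
  "covered K \<eta> a \<longleftrightarrow> (\<exists>Q c. finite Q \<and> (\<forall>p\<in>Q. prime p) \<and> real (\<Prod>Q) \<le> exp (\<eta> * real K) \<and>
     (\<forall>k\<in>{1..K}. \<exists>p\<in>Q. [c = fpow a k] (mod p)))"

lemma coprime_density_prod_primes:
  assumes "finite \<P>" "\<And>p. p \<in> \<P> \<Longrightarrow> prime (p::nat)"
  shows "real (card {x. x < \<Prod>\<P> \<and> coprime x (\<Prod>\<P>)}) / real (\<Prod>\<P>) = (\<Prod>p\<in>\<P>. 1 - 1 / real p)"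
  using assms
proof (induction rule: finite_induct)
  case (insert p F)
  define M where "M = \<Prod>F"
  have p: "prime p" using insert by simp
  have M0: "M > 0" unfolding M_def using insert.prems by (intro prod_pos) (auto dest: prime_gt_0_nat)
  have cop: "coprime p M" unfolding M_def using insert by (intro prod_coprime_right) (auto intro: primes_coprime)
  have "{x. x < p * M \<and> coprime x (p * M)} = {x. x < p * M \<and> coprime (x mod p) p \<and> coprime (x mod M) M}"
    using M0 prime_gt_0_nat[OF p] by auto
  hence "card {x. x < p * M \<and> coprime x (p * M)} = card {x. x < p \<and> coprime x p} * card {x. x < M \<and> coprime x M}"
    using card_residue_conditions[OF cop, of "\<lambda>x. coprime x p" "\<lambda>x. coprime x M"] M0 prime_gt_0_nat[OF p] by simp
  also have "{x. x < p \<and> coprime x p} = {1..<p}"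
  proof (intro Set.set_eqI iffI)
    fix x assume x: "x \<in> {x. x < p \<and> coprime x p}"
    have "x \<noteq> 0" using x prime_gt_1_nat[OF p] by (intro notI) simp
    thus "x \<in> {1..<p}" using x by auto
  next
    fix x assume x: "x \<in> {1..<p}"
    hence "\<not> p dvd x" by (auto dest: dvd_imp_le)
    thus "x \<in> {x. x < p \<and> coprime x p}" using x prime_imp_coprime_nat[OF p] coprime_commute by auto
  qed
  finally have c: "card {x. x < p * M \<and> coprime x (p * M)} = (p - 1) * card {x. x < M \<and> coprime x M}" by simp
  have "real (p - 1) / real p = 1 - 1 / real p" using prime_gt_0_nat[OF p] by (simp add: of_nat_diff field_simps)
  hence *: "real ((p - 1) * card {x. x < M \<and> coprime x M}) / real (p * M) =
     (1 - 1 / real p) * (real (card {x. x < M \<and> coprime x M}) / real M)"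
    unfolding of_nat_mult by (metis times_divide_times_eq)
  have PM: "\<Prod>(insert p F) = p * M" using insert.hyps by (simp add: M_def)
  have IH: "real (card {x. x < M \<and> coprime x M}) / real M = (\<Prod>p\<in>F. 1 - 1 / real p)"
    unfolding M_def using insert by blast
  show ?case unfolding PM c * IH using insert.hyps by simp
qed simp

text \<open>\<open>covered\<close> depends only on \<open>\<lfloor>a^k\<rfloor>\<close> for
  \<open>k \<le> K\<close> and holds at the representative of every good cell, so the uncovered
  \<open>a\<close> fill only bad cells. The division by \<open>K\<close> is the length of
  \<open>Iv A K\<close>.\<close>

lemma measure_not_covered:
  fixes A \<eta> \<xi> \<Lambda> Bd Z \<theta> :: real and K J L H S m N :: nat and Qr :: "nat \<Rightarrow> nat set" and \<P> \<R> :: "nat set"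
  defines "\<beta> \<equiv> real m * (\<Prod>p\<in>\<P>. 1 - 1 / real p)"
  assumes A: "1 \<le> A" and K: "K \<ge> 1"
    and fp: "\<And>r. r < L \<Longrightarrow> fresh_primes (\<sigma> K ` Iv A K) (wt A K) (\<lambda>k v. fpow (rep A K v) k)
       K H L (\<Prod>\<P>) B \<theta> S J m r (Qr r) \<Lambda> \<xi> Bd"
    and Q_disj: "\<And>r r'. r < L \<Longrightarrow> r' < L \<Longrightarrow> r \<noteq> r' \<Longrightarrow> Qr r \<inter> Qr r' = {}"
    and N: "\<And>r. r < L \<Longrightarrow> card (Qr r) = N"
    and pos: "L > 0" "H > 0" "Z > 0"
    and P: "finite \<P>" and R: "finite \<R>"
    and prime: "\<And>p. p \<in> \<P> \<union> (\<Union>r<L. Qr r) \<union> \<R> \<Longrightarrow> prime p"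
    and disj: "\<P> \<inter> (\<Union>r<L. Qr r) = {}" "(\<P> \<union> (\<Union>r<L. Qr r)) \<inter> \<R> = {}"
    and prod: "real (\<Prod>(\<P> \<union> (\<Union>r<L. Qr r) \<union> \<R>)) \<le> exp (\<eta> * real K)"
    and cR: "\<And>n. real n \<le> real (K - J * L * m) + real L * (2 * real J * \<beta> * exp (- (real N / \<beta>) / 4)) + Z \<Longrightarrow> n \<le> card \<R>"
  shows "{a\<in>Iv A K. \<not> covered K \<eta> a} \<in> sets borel \<and>
    measure lborel {a\<in>Iv A K. \<not> covered K \<eta> a} \<le> real L * (74 * real J * \<beta> * \<xi>) / Z / real K"
proof -
  have fs: "fresh_space (\<sigma> K ` Iv A K) (wt A K) (\<lambda>k v. fpow (rep A K v) k) K H L (\<Prod>\<P>) B \<theta>"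
    using fp[OF pos(1)] unfolding fresh_primes_def fresh_segments_def by blast
  have finQ: "finite (\<Union>r<L. Qr r)"
    using fp unfolding fresh_primes_def fresh_primes_axioms_def by blast
  have \<beta>: "\<beta> = real m * (real (card {x. x < \<Prod>\<P> \<and> coprime x (\<Prod>\<P>)}) / real (\<Prod>\<P>))"
    unfolding \<beta>_def using P prime by (subst coprime_density_prod_primes) auto
  obtain bad where bad: "bad \<subseteq> \<sigma> K ` Iv A K" "(\<Sum>v\<in>bad. wt A K v) \<le> real L * (74 * real J * \<beta> * \<xi>) / Z"
    and good: "\<And>v. v \<in> \<sigma> K ` Iv A K - bad \<Longrightarrow> \<exists>b. real (card {k \<in> {1..K}. coprime (fpow (rep A K v) k) (\<Prod>\<P>) \<and> (\<forall>q\<in>(\<Union>r<L. Qr r). fpow (rep A K v) k mod q \<noteq> b q)})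
       \<le> real (K - J * L * m) + real L * (2 * real J * \<beta> * exp (- (real N / \<beta>) / 4)) + Z"
    by (rule ex_bad_cells[OF fp Q_disj N pos, folded \<beta>]) blast+
  have cov: "covered K \<eta> (rep A K v)" if v: "v \<in> \<sigma> K ` Iv A K - bad" for v
  proof -
    obtain b where b: "real (card {k \<in> {1..K}. coprime (fpow (rep A K v) k) (\<Prod>\<P>) \<and> (\<forall>q\<in>(\<Union>r<L. Qr r). fpow (rep A K v) k mod q \<noteq> b q)})
       \<le> real (K - J * L * m) + real L * (2 * real J * \<beta> * exp (- (real N / \<beta>) / 4)) + Z"
      using good[OF v] by blast
    have "\<exists>c. \<forall>k\<in>{1..K}. \<exists>p\<in>\<P> \<union> (\<Union>r<L. Qr r) \<union> \<R>. [c = fpow (rep A K v) k] (mod p)"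
      by (rule ex_cong_cover[OF P finQ R prime disj _ cR[OF b]]) auto
    then obtain c where c: "\<forall>k\<in>{1..K}. \<exists>p\<in>\<P> \<union> (\<Union>r<L. Qr r) \<union> \<R>. [c = fpow (rep A K v) k] (mod p)" ..
    have "finite (\<P> \<union> (\<Union>r<L. Qr r) \<union> \<R>)" using P finQ R by blast
    moreover have "\<forall>p\<in>\<P> \<union> (\<Union>r<L. Qr r) \<union> \<R>. prime p" using prime by blast
    ultimately show ?thesis unfolding covered_def using prod c
      by (intro exI[of _ "\<P> \<union> (\<Union>r<L. Qr r) \<union> \<R>"] exI[of _ c] conjI)
  qed
  have sat: "(\<not> covered K \<eta> a) = (\<not> covered K \<eta> b)" if "a \<in> Iv A K" "b \<in> Iv A K" "\<sigma> K a = \<sigma> K b" for a b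
  proof -
    have "fpow a k = fpow b k" if "k \<in> {1..K}" for k
      using sigma_eqD[OF Iv_pos[OF A K \<open>a \<in> Iv A K\<close>] Iv_pos[OF A K \<open>b \<in> Iv A K\<close>] \<open>\<sigma> K a = \<sigma> K b\<close>] that by simp
    thus ?thesis unfolding covered_def by simp
  qed
  have "real K * measure lborel {a\<in>Iv A K. \<not> covered K \<eta> a} = (\<Sum>v | v \<in> \<sigma> K ` Iv A K \<and> \<not> covered K \<eta> (rep A K v). wt A K v)"
    by (rule saturated(2)[OF A K, where R = "\<lambda>a. \<not> covered K \<eta> a", OF sat, symmetric])
  also have "\<dots> \<le> (\<Sum>v\<in>bad. wt A K v)"
  proof (rule sum_mono2)
    show "finite bad" using bad(1) fresh_space.finite_Omega[OF fs] finite_subset by blast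
    show "{v. v \<in> \<sigma> K ` Iv A K \<and> \<not> covered K \<eta> (rep A K v)} \<subseteq> bad" using cov by blast
    show "0 \<le> wt A K b" if "b \<in> bad - {v. v \<in> \<sigma> K ` Iv A K \<and> \<not> covered K \<eta> (rep A K v)}" for b
      using that bad(1) fresh_space.w_nonneg[OF fs] by blast
  qed
  also note bad(2)
  finally have "measure lborel {a\<in>Iv A K. \<not> covered K \<eta> a} \<le> real L * (74 * real J * \<beta> * \<xi>) / Z / real K"
    using K by (subst pos_le_divide_eq) (auto simp: mult.commute)
  thus ?thesis using saturated(1)[OF A K, where R = "\<lambda>a. \<not> covered K \<eta> a", OF sat] by (rule conjI[rotated])
qed

section \<open>Choice of the parameters\<close>

lemma ln_2_ge_half: "ln (2::real) \<ge> 1 / 2"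
proof -
  have "exp (1/2 :: real) ^ 2 \<le> 2 ^ 2" using exp_le by (simp add: exp_double[symmetric])
  hence "exp (1/2 :: real) \<le> 2" by (rule power2_le_imp_le) simp
  thus ?thesis by (metis exp_gt_zero exp_le_cancel_iff exp_ln zero_less_numeral)
qed

text \<open>The inequalities needed in \<open>measure_not_covered_le\<close>, with
  \<open>x = K\<close>; there \<open>c0 * ln x + 1\<close> and \<open>c1 * sqrt x + 1\<close> are
  upper bounds for \<open>L\<close> and \<open>H\<close>.\<close>

definition large_enough :: "real \<Rightarrow> real \<Rightarrow> real \<Rightarrow> real \<Rightarrow> real \<Rightarrow> nat \<Rightarrow> real \<Rightarrow> bool" where
  "large_enough c0 c1 \<epsilon> \<eta> b J x \<longleftrightarrow> ln x \<ge> 4 \<and> x powr (1/4) * ln x \<le> sqrt x \<and>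
     4 * b * x ^ (2 * J + 12) \<le> exp (sqrt x) \<and> 4 * b \<le> x \<and>
     real J * (1 + (c1 * sqrt x + 1) + (c0 * ln x + 1)) \<le> \<epsilon> * x / ln x \<and>
     1 + (c1 * sqrt x + 1) + (c0 * ln x + 1) \<le> x / (2 * real J) \<and>
     c1 * sqrt x + 1 \<le> x \<and> 2 \<le> \<epsilon> * x / (ln x * (c0 * ln x + 1)) \<and>
     2 * real J * (2 * (c1 * sqrt x + 1) + 1) * (real J * (c0 * ln x + 1) * ln x / x) \<le> x powr (-1/8) \<and>
     1 + 3 * (real J * (c0 * ln x + 1) * ln x) \<le> x powr (1 / (4 * real J)) \<and>
     x powr (1/4) \<le> x powr (-1/8) * (\<epsilon> * x / (2 * (ln x * (c0 * ln x + 1)))) \<and>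
     8 * real J * 4 ^ J \<le> x\<^sup>2 * x powr (-1/8) * (2 / ln x) \<and>
     sqrt x + 4 * \<epsilon> * x \<le> \<eta> * x \<and>
     4 * \<epsilon> * x / ln x + 1 + sqrt x \<le> x * ln 2 / ln x"

lemma eventually_large_enough:
  fixes c0 c1 \<epsilon> \<eta> b :: real and J :: nat
  assumes "c0 > 0" "c1 > 0" "0 < \<epsilon>" "\<epsilon> \<le> 1 / 16" "4 * \<epsilon> < \<eta>" "J > 0" "b > 0"
  shows "eventually (large_enough c0 c1 \<epsilon> \<eta> b J) at_top"
  unfolding large_enough_def[abs_def]
proof (intro eventually_conj)
  have J: "real J > 0" using assms by simp
  show "eventually (\<lambda>x::real. ln x \<ge> 4) at_top" by real_asymp
  show "eventually (\<lambda>x::real. x powr (1/4) * ln x \<le> sqrt x) at_top" by real_asymp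
  show "eventually (\<lambda>x::real. 4 * b * x ^ (2 * J + 12) \<le> exp (sqrt x)) at_top"
  proof -
    have "eventually (\<lambda>x::real. 4 * b * x powr (real (2 * J + 12)) \<le> exp (sqrt x)) at_top"
      using assms J by real_asymp
    moreover have "eventually (\<lambda>x::real. x > 0) at_top" by real_asymp
    ultimately show ?thesis by eventually_elim (simp only: powr_realpow)
  qed
  show "eventually (\<lambda>x::real. 4 * b \<le> x) at_top" by real_asymp
  show "eventually (\<lambda>x::real. real J * (1 + (c1 * sqrt x + 1) + (c0 * ln x + 1)) \<le> \<epsilon> * x / ln x) at_top"
    using assms J by real_asymp
  show "eventually (\<lambda>x::real. 1 + (c1 * sqrt x + 1) + (c0 * ln x + 1) \<le> x / (2 * real J)) at_top"
    using assms J by real_asymp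
  show "eventually (\<lambda>x::real. c1 * sqrt x + 1 \<le> x) at_top" using assms by real_asymp
  show "eventually (\<lambda>x::real. 2 \<le> \<epsilon> * x / (ln x * (c0 * ln x + 1))) at_top" using assms by real_asymp
  show "eventually (\<lambda>x::real. 2 * real J * (2 * (c1 * sqrt x + 1) + 1) * (real J * (c0 * ln x + 1) * ln x / x) \<le> x powr (-1/8)) at_top"
    using assms J by real_asymp
  show "eventually (\<lambda>x::real. 1 + 3 * (real J * (c0 * ln x + 1) * ln x) \<le> x powr (1 / (4 * real J))) at_top"
    using assms J by real_asymp
  show "eventually (\<lambda>x::real. x powr (1/4) \<le> x powr (-1/8) * (\<epsilon> * x / (2 * (ln x * (c0 * ln x + 1))))) at_top"
    using assms by real_asymp
  have "8 * real J * 4 ^ J > 0" using J by simp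
  thus "eventually (\<lambda>x::real. 8 * real J * 4 ^ J \<le> x\<^sup>2 * x powr (-1/8) * (2 / ln x)) at_top"
    by real_asymp
  show "eventually (\<lambda>x::real. sqrt x + 4 * \<epsilon> * x \<le> \<eta> * x) at_top"
  proof -
    define d where "d = \<eta> - 4 * \<epsilon>"
    have d: "d > 0" using assms by (simp add: d_def)
    have "eventually (\<lambda>x::real. sqrt x \<le> d * x) at_top" using d by real_asymp
    thus ?thesis by eventually_elim (simp add: d_def algebra_simps)
  qed
  show "eventually (\<lambda>x::real. 4 * \<epsilon> * x / ln x + 1 + sqrt x \<le> x * ln 2 / ln x) at_top"
  proof -
    \<comment> \<open>Here \<open>\<epsilon> \<le> 1 / 16\<close> matters: the share
      \<open>4 * \<epsilon>\<close> of the primes to be used must stay below Chebyshev's constant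
      \<open>ln 2\<close>.\<close>
    have l2: "4 * \<epsilon> + 1 / 4 \<le> ln 2" using assms ln_2_ge_half by simp
    have "eventually (\<lambda>x::real. 1 + sqrt x \<le> x / 4 / ln x) at_top" by real_asymp
    moreover have "eventually (\<lambda>x::real. ln x > 0 \<and> x > 0) at_top" by (intro eventually_conj; real_asymp)
    ultimately show ?thesis
    proof eventually_elim
      case (elim x)
      have "4 * \<epsilon> * x / ln x + x / 4 / ln x = (4 * \<epsilon> + 1 / 4) * (x / ln x)" by (simp add: algebra_simps)
      also have "\<dots> \<le> ln 2 * (x / ln x)" using l2 elim by (intro mult_right_mono) auto
      finally show ?case using elim by (simp add: mult.commute)
    qed
  qed
qed

lemma measure_not_covered_le:
  fixes A0 B0 \<eta> :: real
  assumes A0: "A0 > 1" and \<eta>: "\<eta> > 0"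
  shows "\<exists>C K0. \<forall>K A. K0 \<le> K \<longrightarrow> even K \<longrightarrow> A0 \<le> A \<longrightarrow> A \<le> B0 \<longrightarrow>
     {a\<in>Iv A K. \<not> covered K \<eta> a} \<in> sets borel \<and>
     measure lborel {a\<in>Iv A K. \<not> covered K \<eta> a} \<le> C * real K powr (-1/8) / real K"
proof -
  \<comment> \<open>The primes will cost \<open>exp (sqrt K + 4 * \<epsilon> * K)\<close> in all:
    one \<open>\<epsilon>\<close> for the sets \<open>Qr r\<close>, three for the reserve
    \<open>\<R>\<close>, and \<open>sqrt K\<close> for the sieve.\<close>
  define \<epsilon> where "\<epsilon> = min \<eta> 1 / 16"
  have \<epsilon>: "0 < \<epsilon>" "\<epsilon> \<le> 1 / 16" "4 * \<epsilon> < \<eta>" using \<eta> by (auto simp: \<epsilon>_def)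
  \<comment> \<open>\<open>N / \<beta>\<close> will be at least \<open>\<epsilon> * J / 8\<close>,
    so this \<open>J\<close> makes \<open>exp (- (N / \<beta>) / 4)\<close> at most
    \<open>\<epsilon> / 8\<close>.\<close>
  define J where "J = nat \<lceil>32 / \<epsilon> * ln (8 / \<epsilon>)\<rceil> + 1"
  have J: "J > 0" "32 / \<epsilon> * ln (8 / \<epsilon>) \<le> real J" unfolding J_def by (simp, linarith)
  have lnA: "ln A0 > 0" using A0 by simp
  \<comment> \<open>With these constants \<open>A ^ L \<ge> K ^ (2 * J + 13)\<close> and
    \<open>A ^ H \<ge> exp (2 * sqrt K)\<close>, enough for moduli up to \<open>K\<^sup>2\<close>
    after a gap of \<open>L\<close> and up to \<open>K\<^sup>2\<close> times the sieve modulus after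
    a gap of \<open>H\<close>.\<close>
  define c0 where "c0 = (2 * real J + 13) / ln A0"
  define c1 where "c1 = 2 / ln A0"
  have c: "c0 > 0" "c1 > 0" using lnA by (auto simp: c0_def c1_def intro!: divide_pos_pos)
  define b where "b = max B0 1"
  have b: "b > 0" "B0 \<le> b" by (auto simp: b_def)
  obtain x0 where x0: "\<And>x. x \<ge> x0 \<Longrightarrow> large_enough c0 c1 \<epsilon> \<eta> b J x"
    using eventually_large_enough[OF c \<epsilon> J(1) b(1)] unfolding eventually_at_top_linorder by blast
  have main: "{a\<in>Iv A K. \<not> covered K \<eta> a} \<in> sets borel \<and>
     measure lborel {a\<in>Iv A K. \<not> covered K \<eta> a} \<le> 296 / \<epsilon> * real K powr (-1/8) / real K"
    if K0: "nat \<lceil>x0\<rceil> + 1 \<le> K" and ev: "even K" and A: "A0 \<le> A" "A \<le> B0" for K A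
  proof -
    define x where "x = real K"
    have "x \<ge> x0" using K0 unfolding x_def by linarith
    note par = x0[OF this, unfolded large_enough_def]
    define l where "l = ln x"
    define Lr where "Lr = c0 * l + 1"
    define Hr where "Hr = c1 * sqrt x + 1"
    \<comment> \<open>The exponent fits because the \<open>J\<close>-th powers are at most
      \<open>x powr (1/4)\<close>, while \<open>q \<ge> sqrt x\<close> and
      \<open>1/4 + 1/8 < 1/2\<close>.\<close>
    define \<xi> where "\<xi> = x powr (-1/8)"
    have p1: "l \<ge> 4" and p2: "x powr (1/4) * l \<le> sqrt x" and p3: "4 * b * x ^ (2 * J + 12) \<le> exp (sqrt x)"
      and p4: "4 * b \<le> x" and p5: "real J * (1 + Hr + Lr) \<le> \<epsilon> * x / l" and p6: "1 + Hr + Lr \<le> x / (2 * real J)"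
      and p7: "Hr \<le> x" and p8: "2 \<le> \<epsilon> * x / (l * Lr)"
      and p9: "2 * real J * (2 * Hr + 1) * (real J * Lr * l / x) \<le> \<xi>"
      and p10: "1 + 3 * (real J * Lr * l) \<le> x powr (1 / (4 * real J))"
      and p11: "x powr (1/4) \<le> \<xi> * (\<epsilon> * x / (2 * (l * Lr)))"
      and p12: "8 * real J * 4 ^ J \<le> x\<^sup>2 * \<xi> * (2 / l)"
      and p13: "sqrt x + 4 * \<epsilon> * x \<le> \<eta> * x" and p14: "4 * \<epsilon> * x / l + 1 + sqrt x \<le> x * ln 2 / l"
      using par unfolding l_def Lr_def Hr_def \<xi>_def by blast+
    have K1: "K \<ge> 1" using K0 by simp
    have x1: "x \<ge> 1" using K1 by (simp add: x_def)
    have A1: "1 \<le> A" using A0 A by simp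
    have l0: "l > 0" using p1 by simp
    have J1: "real J \<ge> 1" using J by simp
    have Lr0: "Lr > 0" unfolding Lr_def using c l0 by (simp add: add_pos_pos)
    have Hr0: "Hr > 0" unfolding Hr_def using c x1 by (simp add: add_pos_pos)
    have xi: "0 < \<xi>" "\<xi> \<le> 1" unfolding \<xi>_def using x1 powr_mono[of "-1/8" 0 x] by simp_all
    define L where "L = nat \<lceil>c0 * l\<rceil>"
    define H where "H = nat \<lceil>c1 * sqrt x\<rceil>"
    have cl: "c0 * l > 0" "c1 * sqrt x > 0" using c l0 x1 by auto
    have L: "L > 0" "c0 * l \<le> real L" "real L \<le> Lr" unfolding L_def Lr_def using cl(1) by (simp, linarith, linarith)
    have H: "H > 0" "c1 * sqrt x \<le> real H" "real H \<le> Hr" unfolding H_def Hr_def using cl(2) by (simp, linarith, linarith)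
    define S where "S = K div J"
    define m where "m = (S - H) div L"
    have JS: "J * S \<le> K" by (simp add: S_def)
    have S_lo: "x / real J - 1 \<le> real S"
    proof -
      have "x = real J * real S + real (K mod J)" unfolding x_def S_def by (metis mult_div_mod_eq of_nat_add of_nat_mult)
      moreover have "real (K mod J) \<le> real J" using J by (simp add: less_imp_le)
      ultimately have "x - real J \<le> real J * real S" by linarith
      thus ?thesis using J1 by (simp add: field_simps)
    qed
    have S_hi: "real S \<le> x / real J"
    proof -
      have "real J * real S \<le> x" using JS unfolding x_def by (metis of_nat_le_iff of_nat_mult)
      thus ?thesis using J1 by (simp add: field_simps)
    qed
    have xJ: "x / real J = 2 * (x / (2 * real J))" by simp
    have HS: "H \<le> S"
    proof -
      have "0 \<le> x / (2 * real J)" using x1 by simp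
      hence "real H \<le> real S" using S_lo H(3) p6 Lr0 xJ by linarith
      thus ?thesis by simp
    qed
    have Lm_hi: "L * m \<le> S - H" unfolding m_def by simp
    have seg: "H + L * m \<le> S" using Lm_hi HS by simp
    have Lm_lo: "x / real J - 1 - Hr - Lr \<le> real (L * m)"
    proof -
      have "S - H \<le> L * m + L"
        unfolding m_def using L(1) by (metis add_le_cancel_left less_imp_le mod_less_divisor mult_div_mod_eq)
      hence "real S - real H \<le> real (L * m) + real L" using HS by linarith
      thus ?thesis using S_lo H L by linarith
    qed
    have Lm_lo': "x / (2 * real J) \<le> real L * real m" using Lm_lo p6 xJ unfolding of_nat_mult by linarith
    have Lm_hi': "real L * real m \<le> x / real J"
    proof -
      have "L * m \<le> S" using Lm_hi by simp
      hence "real (L * m) \<le> real S" by (simp only: of_nat_le_iff)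
      thus ?thesis using S_hi by simp
    qed
    have "0 < x / (2 * real J)" using x1 J1 by (intro divide_pos_pos) auto
    hence "0 < real L * real m" using Lm_lo' by linarith
    hence m0: "m > 0" by (simp add: zero_less_mult_iff)
    have m_le: "real m \<le> x"
    proof -
      have "1 * real m \<le> real L * real m" using L(1) by (intro mult_right_mono) auto
      moreover have "x / real J \<le> x" using J1 x1 by (simp add: divide_le_eq mult_le_cancel_left1)
      ultimately show ?thesis using Lm_hi' by linarith
    qed
    \<comment> \<open>This sieve limit keeps the modulus below
      \<open>y ^ y \<le> exp (sqrt x)\<close>, matching gaps \<open>H\<close> of order
      \<open>sqrt x\<close>, while \<open>ln (y + 1) \<ge> l / 4\<close> allows the density
      \<open>4 / l\<close>.\<close>
    define y where "y = nat \<lfloor>x powr (1/4)\<rfloor>"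
    have xp: "1 \<le> x powr (1/4)" using x1 by (simp add: ge_one_powr_ge_zero)
    have y: "y \<ge> 1" "real y \<le> x powr (1/4)" "x powr (1/4) \<le> real y + 1"
      unfolding y_def using xp by (simp add: le_nat_iff le_floor_iff, linarith, linarith)
    have lny: "l / 4 \<le> ln (real y + 1)"
    proof -
      have "l / 4 = ln (x powr (1/4))" using x1 by (simp add: l_def ln_powr)
      also have "\<dots> \<le> ln (real y + 1)" using y xp by (subst ln_le_cancel_iff) auto
      finally show ?thesis .
    qed
    obtain \<P> where \<P>: "finite \<P>" "\<And>p. p \<in> \<P> \<Longrightarrow> prime p \<and> p \<le> y"
      "4 / l / 2 \<le> (\<Prod>p\<in>\<P>. 1 - 1 / real p)" "(\<Prod>p\<in>\<P>. 1 - 1 / real p) \<le> 4 / l"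
    proof (rule ex_prime_set_sieve_density[of "4 / l" y])
      show "1 \<le> 4 / l * ln (real y + 1)" using lny l0 by (simp add: field_simps)
    qed (use l0 p1 y in auto)
    define V where "V = (\<Prod>p\<in>\<P>. 1 - 1 / real p)"
    have V: "2 / l \<le> V" "V \<le> 4 / l" "0 < V" "V \<le> 1"
    proof -
      show a: "2 / l \<le> V" "V \<le> 4 / l" using \<P> by (auto simp: V_def)
      have "0 < 2 / l" using l0 by simp
      thus "0 < V" using a by linarith
      have "4 / l \<le> 1" using p1 by simp
      thus "V \<le> 1" using a by linarith
    qed
    have Vs: "fresh_space.V (\<Prod>\<P>) = V" if "fresh_space \<Omega> w X T H L (\<Prod>\<P>) B \<theta>" for \<Omega> :: "nat set" and w X T H L B \<theta>
      using coprime_density_prod_primes[OF \<P>(1)] \<P>(2) unfolding fresh_space.V_def[OF that] V_def by blast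
    have Ppos: "\<Prod>\<P> > 0" using \<P> by (auto intro!: prod_pos dest: prime_gt_0_nat)
    have P_le: "real (\<Prod>\<P>) \<le> exp (sqrt x)"
    proof -
      have "real (\<Prod>\<P>) \<le> real y ^ y" using \<P>(2) y(1) by (rule prod_primes_le_power)
      also have "\<dots> = exp (real y * ln (real y))" using y by (simp add: exp_of_nat_mult)
      also have "\<dots> \<le> exp (x powr (1/4) * l)"
      proof -
        have "x powr (1/4) \<le> x" using x1 powr_mono[of "1/4" 1 x] by simp
        hence "ln (real y) \<le> l" unfolding l_def using y x1 by (subst ln_le_cancel_iff) auto
        thus ?thesis using y l0 by (intro exp_le_cancel_iff[THEN iffD2] mult_mono) auto
      qed
      also have "\<dots> \<le> exp (sqrt x)" using p2 by simp
      finally show ?thesis .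
    qed
    define \<S> where "\<S> = {p. prime p \<and> p \<le> K \<and> \<not> real p \<le> sqrt x}"
    have finS: "finite \<S>" unfolding \<S>_def by simp
    have "K \<ge> 2" using ev K1 by (auto elim!: evenE)
    from card_primes_above_sqrt[OF ev this] have cardS: "4 * \<epsilon> * x / l \<le> real (card \<S>)"
      using p14 unfolding \<S>_def x_def l_def by linarith
    define w where "w = \<epsilon> * x / (l * real L)"
    define w' where "w' = \<epsilon> * x / (l * Lr)"
    define N where "N = nat \<lfloor>w\<rfloor>"
    \<comment> \<open>Room for three losses of at most \<open>\<epsilon> * x / l\<close> each:
      exponents outside the segments, survivors expected to escape, and the threshold
      \<open>Z\<close> for bad cells.\<close>
    define s where "s = nat \<lfloor>3 * (\<epsilon> * x / l)\<rfloor>"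
    have Lpos: "real L > 0" using L(1) by simp
    have w'2: "2 \<le> w'" using p8 by (simp add: w'_def)
    have w'_half: "\<epsilon> * x / (2 * (l * Lr)) = w' / 2" by (simp add: w'_def)
    have N_arg: "w' \<le> w" unfolding w_def w'_def
      using L Lpos l0 \<epsilon> x1 Lr0 by (intro divide_left_mono mult_left_mono) auto
    have N_hi: "real N \<le> w" unfolding N_def using w'2 N_arg by (intro of_nat_floor) simp
    have N_lo: "w / 2 \<le> real N" unfolding N_def using w'2 N_arg by linarith
    have "real N \<ge> 1" using N_lo N_arg w'2 by linarith
    hence N0: "N > 0" by simp
    have LN: "real L * real N \<le> \<epsilon> * x / l"
    proof -
      have "real L * real N \<le> real L * w" using N_hi by (intro mult_left_mono) auto
      thus ?thesis using Lpos by (simp add: w_def)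
    qed
    have s_hi: "real s \<le> 3 * (\<epsilon> * x / l)" unfolding s_def using \<epsilon> x1 l0 by (intro of_nat_floor) simp
    have tot: "real (L * N + s) \<le> 4 * \<epsilon> * x / l" using LN s_hi by simp
    hence tot': "L * N + s \<le> card \<S>" using cardS by linarith
    obtain Qr \<R> where Q: "\<And>r. r < L \<Longrightarrow> Qr r \<subseteq> \<S> \<and> card (Qr r) = N"
      and Q_disj: "\<And>r r'. r < L \<Longrightarrow> r' < L \<Longrightarrow> r \<noteq> r' \<Longrightarrow> Qr r \<inter> Qr r' = {}"
      and R: "\<R> \<subseteq> \<S>" "card \<R> = s" and QR_disj: "(\<Union>r<L. Qr r) \<inter> \<R> = {}"
      and QR_card: "card ((\<Union>r<L. Qr r) \<union> \<R>) \<le> L * N + s"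
      by (rule ex_disjoint_subsets[OF finS tot']) blast
    have Q_card: "\<And>r. r < L \<Longrightarrow> card (Qr r) = N" and Q_in: "\<And>q r. r < L \<Longrightarrow> q \<in> Qr r \<Longrightarrow> q \<in> \<S>"
      and R_in: "\<And>q. q \<in> \<R> \<Longrightarrow> q \<in> \<S>" and R_card: "card \<R> = s"
      using Q R by auto
    have P_small: "real p \<le> sqrt x" if "p \<in> \<P>" for p
    proof -
      have "real p \<le> x powr (1/4)" using \<P>(2)[OF that] y by linarith
      also have "\<dots> \<le> x powr (1/2)" using x1 by (intro powr_mono) auto
      finally show ?thesis using x1 by (simp add: powr_half_sqrt)
    qed
    have P_notin: "p \<notin> \<S>" if "p \<in> \<P>" for p using P_small[OF that] by (simp add: \<S>_def)
    define \<beta> where "\<beta> = real m * V"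
    have b_hi: "\<beta> \<le> 4 * x / (real J * real L * l)"
    proof -
      have "real L * \<beta> = (real L * real m) * V" by (simp add: \<beta>_def)
      also have "\<dots> \<le> x / real J * (4 / l)" using Lm_hi' V x1 J1 by (intro mult_mono) auto
      finally have "real L * \<beta> \<le> x / real J * (4 / l)" .
      thus ?thesis using Lpos J1 l0 by (simp add: field_simps)
    qed
    have b_lo: "x / (real J * real L * l) \<le> \<beta>"
    proof -
      have "x / (2 * real J) * (2 / l) \<le> (real L * real m) * V"
        using Lm_lo' V x1 J1 l0 by (intro mult_mono) auto
      also have "\<dots> = real L * \<beta>" by (simp add: \<beta>_def)
      finally have "x / (2 * real J) * (2 / l) \<le> real L * \<beta>" .
      thus ?thesis using Lpos J1 l0 by (simp add: field_simps)
    qed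
    have b0: "\<beta> > 0" using m0 V by (simp add: \<beta>_def)
    have b_m: "\<beta> \<le> real m" using V by (simp add: \<beta>_def mult_left_le)
    have xb: "x / \<beta> \<le> real J * Lr * l"
    proof -
      have "x \<le> \<beta> * (real J * real L * l)" using b_lo Lpos J1 l0 by (simp add: field_simps)
      also have "\<dots> \<le> \<beta> * (real J * Lr * l)" using b0 L l0 J1 by (intro mult_left_mono mult_right_mono) auto
      finally show ?thesis using b0 by (simp add: field_simps)
    qed
    have pJ: "(x powr (1 / (4 * real J))) ^ J = x powr (1/4)" using J x1 by (simp add: powr_power)
    have x14: "x powr (1/4) \<le> x" using x1 powr_mono[of "1/4" 1 x] by simp
    have Jl: "0 \<le> real J * Lr * l" using Lr0 l0 by simp
    \<comment> \<open>The factors \<open>Bd ^ J\<close>, \<open>m\<^sup>2\<close>,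
      \<open>\<beta>\<^sup>2\<close> and \<open>\<Lambda>\<^sup>2\<close> in \<open>err\<close> are
      together of order \<open>x ^ (2 * J + 6)\<close>; this leaves \<open>1 / x\<^sup>2\<close>,
      which is below \<open>\<xi> * V\<close>.\<close>
    define \<theta> where "\<theta> = 1 / x ^ (2 * J + 8)"
    have \<theta>0: "\<theta> \<ge> 0" using x1 by (simp add: \<theta>_def)
    have fs: "fresh_space (\<sigma> K ` Iv A K) (wt A K) (\<lambda>k v. fpow (rep A K v) k) K H L (\<Prod>\<P>) (K\<^sup>2) \<theta>"
    proof (rule fresh_space_cells[OF A1 K1 Ppos L(1) H(1) \<theta>0])
      have AH: "exp (2 * sqrt x) \<le> A ^ H"
      proof -
        have "2 * sqrt x = c1 * sqrt x * ln A0" using lnA by (simp add: c1_def)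
        also have "\<dots> \<le> real H * ln A" using H(2) A A0 lnA cl by (intro mult_mono) auto
        finally have "exp (2 * sqrt x) \<le> exp (real H * ln A)" by simp
        also have "\<dots> = A ^ H" using A1 by (simp add: exp_of_nat_mult)
        finally show ?thesis .
      qed
      have "4 * x\<^sup>2 * A * (real (\<Prod>\<P>) * x\<^sup>2) = 4 * A * x ^ 4 * real (\<Prod>\<P>)" by (simp add: power_numeral_reduce)
      also have "\<dots> \<le> 4 * b * x ^ 4 * exp (sqrt x)" using A A1 b P_le x1 by (intro mult_mono) (auto intro: prod_nonneg)
      also have "4 * b * x ^ 4 = \<theta> * (4 * b * x ^ (2 * J + 12))"
        unfolding \<theta>_def using x1 by (simp add: field_simps flip: power_add)
      also have "\<dots> \<le> \<theta> * exp (sqrt x)" using p3 \<theta>0 by (intro mult_left_mono) auto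
      also have "\<theta> * exp (sqrt x) * exp (sqrt x) = \<theta> * exp (2 * sqrt x)" by (simp flip: exp_add)
      also have "\<dots> \<le> \<theta> * A ^ H" using AH \<theta>0 by (intro mult_left_mono)
      finally show "4 * (real K)\<^sup>2 * A * (real (\<Prod>\<P>) * real (K\<^sup>2)) \<le> \<theta> * A ^ H" by (simp add: x_def mult_right_mono)
      have AL: "x ^ (2 * J + 13) \<le> A ^ L"
      proof -
        have "(2 * real J + 13) * l = c0 * l * ln A0" using lnA by (simp add: c0_def)
        also have "\<dots> \<le> real L * ln A" using L(2) A A0 lnA cl by (intro mult_mono) auto
        finally have "exp (real (2 * J + 13) * l) \<le> exp (real L * ln A)" by simp
        thus ?thesis using A1 x1 unfolding exp_of_nat_mult l_def by simp
      qed
      have "4 * x\<^sup>2 * A * x\<^sup>2 \<le> (4 * b) * x ^ 4" using A A1 b x1 by (simp add: power_numeral_reduce)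
      also have "\<dots> \<le> x * x ^ 4" using p4 x1 by (intro mult_right_mono) auto
      also have "\<dots> = \<theta> * x ^ (2 * J + 13)"
        unfolding \<theta>_def using x1 by (simp add: field_simps flip: power_add power_Suc)
      also have "\<dots> \<le> \<theta> * A ^ L" using AL \<theta>0 by (intro mult_left_mono)
      finally show "4 * (real K)\<^sup>2 * A * real (K\<^sup>2) \<le> \<theta> * A ^ L" by (simp add: x_def)
    qed
    have fseg: "fresh_segments (\<sigma> K ` Iv A K) (wt A K) (\<lambda>k v. fpow (rep A K v) k) K H L (\<Prod>\<P>) (K\<^sup>2) \<theta> S J m r"
      if "r < L" for r
      using fs seg that JS m0 V Vs[OF fs] by (simp add: fresh_segments_def fresh_segments_axioms_def)
    have fp: "fresh_primes (\<sigma> K ` Iv A K) (wt A K) (\<lambda>k v. fpow (rep A K v) k) K H L (\<Prod>\<P>) (K\<^sup>2) \<theta> S J m r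
      (Qr r) x \<xi> (4 * x\<^sup>2)" if r: "r < L" for r
    proof -
      have bb: "fresh_segments.\<beta> (\<Prod>\<P>) m = \<beta>"
        using fresh_segments.\<beta>_def[OF fseg[OF r]] Vs[OF fs] by (simp add: \<beta>_def)
      have VV: "fresh_space.V (\<Prod>\<P>) = V" by (rule Vs[OF fs])
      have q: "prime q" "real q \<le> x" "sqrt x \<le> real q" "q \<le> K" if "q \<in> Qr r" for q
        using Q_in[OF r that] by (auto simp: \<S>_def x_def)
      have Dq: "(1 + (2 * real H + real q) / \<beta>) ^ J \<le> x powr (1/4)" if "q \<in> Qr r" for q
      proof -
        have "(2 * real H + real q) / \<beta> \<le> (3 * x) / \<beta>"
          using H(3) p7 q(2)[OF that] b0 by (intro divide_right_mono) auto
        hence "1 + (2 * real H + real q) / \<beta> \<le> x powr (1 / (4 * real J))" using xb p10 by simp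
        hence "(1 + (2 * real H + real q) / \<beta>) ^ J \<le> (x powr (1 / (4 * real J))) ^ J"
          using b0 by (intro power_mono) auto
        thus ?thesis using pJ by simp
      qed
      have "fresh_primes_axioms H (\<Prod>\<P>) (K\<^sup>2) \<theta> J m (Qr r) x \<xi> (4 * x\<^sup>2)"
        unfolding fresh_primes_axioms_def bb VV
      proof (intro conjI allI impI)
        show "finite (Qr r)" using Q[OF r] finS finite_subset by blast
        show "Qr r \<noteq> {}" using N0 Q_card[OF r] by auto
        show "0 < J" by (rule J)
        show "0 < q" if "q \<in> Qr r" for q using q[OF that] prime_gt_0_nat by blast
        show "q * q' \<le> K\<^sup>2" if "q \<in> Qr r" "q' \<in> Qr r" for q q'
          unfolding power2_eq_square using q(4) that by (intro mult_le_mono) auto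
        show "coprime (\<Prod>\<P>) q" if "q \<in> Qr r" for q
        proof (intro prod_coprime_left)
          fix p assume p: "p \<in> \<P>"
          hence "p \<noteq> q" using P_notin[OF p] Q_in[OF r that] by auto
          thus "coprime p q" using \<P>(2)[OF p] q(1)[OF that] primes_coprime by blast
        qed
        show "coprime q q'" if "q \<in> Qr r" "q' \<in> Qr r" "q \<noteq> q'" for q q'
          using q(1) that primes_coprime by blast
        have "(real m)\<^sup>2 \<le> x\<^sup>2" using m_le by (intro power_mono) auto
        also have "\<dots> \<le> 4 * x\<^sup>2" by simp
        finally show "(real m)\<^sup>2 \<le> 4 * x\<^sup>2" .
        show "\<beta>\<^sup>2 * (1 + (2 * real H + real q) / \<beta>) \<le> 4 * x\<^sup>2" if "q \<in> Qr r" for q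
        proof -
          have "\<beta>\<^sup>2 * (1 + (2 * real H + real q) / \<beta>) = \<beta> * (\<beta> + (2 * real H + real q))"
            using b0 by (simp add: field_simps power2_eq_square)
          also have "\<dots> \<le> x * (x + 3 * x)"
            using b_m m_le b0 H(3) p7 q(2)[OF that] by (intro mult_mono add_mono) auto
          finally show ?thesis by (simp add: power2_eq_square)
        qed
        show "(1 + (2 * real H + 1) / \<beta>) ^ J \<le> 1 + \<xi>"
        proof -
          define u where "u = (2 * real H + 1) / \<beta>"
          have u0: "u \<ge> 0" using b0 by (simp add: u_def)
          have "u \<le> (2 * Hr + 1) / \<beta>" unfolding u_def using H b0 by (intro divide_right_mono) auto
          also have "\<dots> = (2 * Hr + 1) * (x / \<beta> / x)" using x1 by simp
          also have "\<dots> \<le> (2 * Hr + 1) * (real J * Lr * l / x)"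
            using xb x1 Hr0 by (intro mult_left_mono divide_right_mono) auto
          finally have "2 * real J * u \<le> 2 * real J * ((2 * Hr + 1) * (real J * Lr * l / x))"
            by (intro mult_left_mono) auto
          hence Ju: "2 * (real J * u) \<le> \<xi>" using p9 by (simp add: mult.assoc)
          have "(1 + u) ^ J \<le> exp u ^ J" using u0 by (intro power_mono) auto
          also have "\<dots> = exp (real J * u)" by (simp add: exp_of_nat_mult)
          also have "\<dots> \<le> 1 + real J * u + (real J * u)\<^sup>2"
            using Ju xi u0 by (intro exp_bound) auto
          also have "(real J * u)\<^sup>2 \<le> 1 * (real J * u)"
            unfolding power2_eq_square using Ju xi u0 by (intro mult_right_mono) auto
          finally show ?thesis using Ju unfolding u_def[symmetric] by linarith
        qed
        show "(1 + (2 * real H + real q) / \<beta>) ^ J \<le> \<xi> * real q" if "q \<in> Qr r" for q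
        proof -
          have "x powr (1/4) \<le> x powr (3/8)" using x1 by (intro powr_mono) auto
          also have "\<dots> = \<xi> * x powr (1/2)" unfolding \<xi>_def by (simp flip: powr_add)
          also have "\<dots> \<le> \<xi> * real q" using q(3)[OF that] xi x1 by (simp add: powr_half_sqrt)
          finally show ?thesis using Dq[OF that] by linarith
        qed
        show "(1 + (2 * real H + real q) / \<beta>) ^ J \<le> \<xi> * real (card (Qr r))" if "q \<in> Qr r" for q
        proof -
          have "\<epsilon> * x / (2 * (l * Lr)) \<le> real N" unfolding w'_half using N_lo N_arg by simp
          hence "\<xi> * (\<epsilon> * x / (2 * (l * Lr))) \<le> \<xi> * real N" using xi by (intro mult_left_mono) auto
          thus ?thesis using Dq[OF that] p11 Q_card[OF r] by simp
        qed
        show "(real q / \<beta>) ^ J \<le> x" if "q \<in> Qr r" for q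
        proof -
          have "real q / \<beta> \<le> x / \<beta>" using q(2)[OF that] b0 by (intro divide_right_mono) auto
          hence "real q / \<beta> \<le> x powr (1 / (4 * real J))" using xb p10 Jl by linarith
          hence "(real q / \<beta>) ^ J \<le> (x powr (1 / (4 * real J))) ^ J" using b0 by (intro power_mono) auto
          thus ?thesis using pJ x14 by simp
        qed
        show "1 \<le> x" by (rule x1)
        show "1 \<le> \<beta>"
        proof -
          have "x powr (1 / (4 * real J)) \<le> x powr 1" using x1 J1 by (intro powr_mono) (auto simp: divide_le_eq)
          hence "real J * Lr * l \<le> x" using p10 Jl x1 by simp
          moreover have "real J * real L * l \<le> real J * Lr * l" using L l0 by (intro mult_right_mono mult_left_mono) auto
          moreover have "real J * real L * l > 0" using J1 Lpos l0 by simp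
          ultimately have "1 \<le> x / (real J * real L * l)" by (simp add: le_divide_eq)
          thus ?thesis using b_lo by linarith
        qed
        show "4 * (real J * (4 * x\<^sup>2) ^ J * (2 * (real m)\<^sup>2 * \<theta>)) * (\<beta>\<^sup>2 * x\<^sup>2) \<le> \<xi> * V"
        proof -
          have "4 * (real J * (4 * x\<^sup>2) ^ J * (2 * (real m)\<^sup>2 * \<theta>)) * (\<beta>\<^sup>2 * x\<^sup>2) \<le>
             4 * (real J * (4 * x\<^sup>2) ^ J * (2 * x\<^sup>2 * \<theta>)) * (x\<^sup>2 * x\<^sup>2)"
            using m_le b_m b0 x1 \<theta>0 by (intro mult_mono power_mono) auto
          also have "\<dots> = 8 * real J * 4 ^ J * (x ^ (2 * J + 6) * \<theta>)"
          proof -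
            have "(4 * x\<^sup>2) ^ J = 4 ^ J * x ^ (2 * J)" by (simp add: power_mult_distrib power_mult)
            moreover have "x ^ (2 * J + 6) = x ^ (2 * J) * (x\<^sup>2 * (x\<^sup>2 * x\<^sup>2))" by (simp flip: power_add)
            ultimately show ?thesis by (simp only: mult_ac)
          qed
          also have "x ^ (2 * J + 6) * \<theta> = 1 / x\<^sup>2"
            unfolding \<theta>_def using x1 by (simp add: field_simps flip: power_add)
          also have "8 * real J * 4 ^ J * (1 / x\<^sup>2) \<le> (x\<^sup>2 * \<xi> * (2 / l)) * (1 / x\<^sup>2)"
            using p12 by (intro mult_right_mono) auto
          also have "\<dots> = \<xi> * (2 / l)" using x1 by simp
          also have "\<dots> \<le> \<xi> * V" using V xi by (intro mult_left_mono) auto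
          finally show ?thesis .
        qed
      qed
      thus ?thesis using fseg[OF r] by (simp add: fresh_primes_def)
    qed
    have fin: "finite (\<Union>r<L. Qr r)" "finite \<R>"
      using Q_in R_in by (auto intro: finite_subset[OF _ finS])
    define Z where "Z = \<epsilon> * x / l"
    have Z: "Z > 0" using \<epsilon> x1 l0 by (simp add: Z_def)
    have res: "{a\<in>Iv A K. \<not> covered K \<eta> a} \<in> sets borel \<and>
       measure lborel {a\<in>Iv A K. \<not> covered K \<eta> a} \<le> real L * (74 * real J * (real m * (\<Prod>p\<in>\<P>. 1 - 1 / real p)) * \<xi>) / Z / real K"
    proof (rule measure_not_covered[OF A1 K1 fp Q_disj Q_card L(1) H(1) Z \<P>(1) fin(2)])
      show "prime p" if "p \<in> \<P> \<union> (\<Union>r<L. Qr r) \<union> \<R>" for p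
        using that \<P>(2) Q_in R_in by (auto simp: \<S>_def)
      show "\<P> \<inter> (\<Union>r<L. Qr r) = {}" using P_notin Q_in by blast
      show "(\<P> \<union> (\<Union>r<L. Qr r)) \<inter> \<R> = {}" using P_notin R_in QR_disj by blast
      show "real (\<Prod>(\<P> \<union> (\<Union>r<L. Qr r) \<union> \<R>)) \<le> exp (\<eta> * real K)"
      proof -
        let ?Q = "(\<Union>r<L. Qr r) \<union> \<R>"
        have "real (\<Prod>(\<P> \<union> (\<Union>r<L. Qr r) \<union> \<R>)) = real (\<Prod>\<P>) * real (\<Prod>?Q)"
        proof -
          have "\<Prod>(\<P> \<union> ?Q) = \<Prod>\<P> * \<Prod>?Q"
            using \<P>(1) fin P_notin Q_in R_in by (intro prod.union_disjoint) blast+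
          thus ?thesis by (simp add: Un_assoc)
        qed
        also have "\<dots> \<le> exp (sqrt x) * exp (4 * \<epsilon> * x)"
        proof (intro mult_mono P_le)
          have "real (\<Prod>?Q) \<le> x ^ (L * N + s)"
        proof -
          have "real (\<Prod>?Q) = (\<Prod>q\<in>?Q. real q)" by simp
          also have "\<dots> \<le> (\<Prod>q\<in>?Q. x)" using Q_in R_in by (intro prod_mono) (auto simp: \<S>_def x_def)
          also have "\<dots> = x ^ card ?Q" by simp
          also have "\<dots> \<le> x ^ (L * N + s)"
            using QR_card x1 by (intro power_increasing)
          finally show ?thesis .
          qed
          also have "x ^ (L * N + s) = exp (real (L * N + s) * l)" using x1 unfolding exp_of_nat_mult l_def by simp
          also have "\<dots> \<le> exp (4 * \<epsilon> * x)"
          proof -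
            have "real (L * N + s) * l \<le> 4 * \<epsilon> * x / l * l" using tot l0 by (intro mult_right_mono) auto
            thus ?thesis using l0 by simp
          qed
          finally show "real (\<Prod>?Q) \<le> exp (4 * \<epsilon> * x)" .
        qed (auto intro: prod_nonneg)
        also have "\<dots> = exp (sqrt x + 4 * \<epsilon> * x)" by (simp add: exp_add)
        also have "\<dots> \<le> exp (\<eta> * x)" using p13 by simp
        finally show ?thesis by (simp only: x_def)
      qed
      fix n
      assume n: "real n \<le> real (K - J * L * m) + real L * (2 * real J * (real m * (\<Prod>p\<in>\<P>. 1 - 1 / real p)) *
          exp (- (real N / (real m * (\<Prod>p\<in>\<P>. 1 - 1 / real p))) / 4)) + Z"
      have 1: "real (K - J * L * m) \<le> \<epsilon> * x / l"
      proof -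
        have "J * (L * m) \<le> J * S" using seg by (intro mult_le_mono2) simp
        hence "J * (L * m) \<le> K" using JS by (rule le_trans)
        hence "J * L * m \<le> K" by (simp only: mult.assoc)
        hence "real (K - J * L * m) = x - real J * real (L * m)" by (simp add: x_def of_nat_diff mult.assoc)
        also have "\<dots> \<le> x - real J * (x / real J - 1 - Hr - Lr)" using Lm_lo by (intro diff_left_mono mult_left_mono) auto
        also have "\<dots> = real J * (1 + Hr + Lr)" using J1 by (simp add: algebra_simps)
        finally show ?thesis using p5 by linarith
      qed
      have "exp (- (real N / \<beta>) / 4) \<le> \<epsilon> / 8"
      proof -
        have "\<epsilon> * real J / 8 \<le> real N / \<beta>"
        proof -
          have "\<epsilon> * real J / 8 * \<beta> \<le> \<epsilon> * real J / 8 * (4 * x / (real J * real L * l))"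
            using b_hi \<epsilon> by (intro mult_left_mono) auto
          also have "\<dots> = w / 2" unfolding w_def using J1 Lpos l0 by (simp add: field_simps)
          also have "\<dots> \<le> real N" by (rule N_lo)
          finally show ?thesis using b0 by (simp add: le_divide_eq)
        qed
        moreover have "32 * ln (8 / \<epsilon>) \<le> \<epsilon> * real J" using J(2) \<epsilon> by (simp add: field_simps)
        moreover define nb where "nb = real N / \<beta>"
        ultimately have "- nb / 4 \<le> - ln (8 / \<epsilon>)" by linarith
        hence "- (real N / \<beta>) / 4 \<le> - ln (8 / \<epsilon>)" unfolding nb_def .
        hence "exp (- (real N / \<beta>) / 4) \<le> exp (- ln (8 / \<epsilon>))" by (simp only: exp_le_cancel_iff)
        also have "\<dots> = \<epsilon> / 8" using \<epsilon> by (simp add: exp_minus)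
        finally show ?thesis .
      qed
      hence "real L * (2 * real J * \<beta> * exp (- (real N / \<beta>) / 4)) \<le> real L * (2 * real J * (4 * x / (real J * real L * l)) * (\<epsilon> / 8))"
        using b_hi b0 x1 l0 by (intro mult_left_mono mult_mono) (auto intro!: divide_nonneg_nonneg)
      also have "\<dots> = \<epsilon> * x / l" using J1 Lpos l0 by (simp add: field_simps)
      finally have 2: "real L * (2 * real J * \<beta> * exp (- (real N / \<beta>) / 4)) \<le> \<epsilon> * x / l" .
      have "real n \<le> 3 * (\<epsilon> * x / l)" using n 1 2 unfolding V_def[symmetric] \<beta>_def[symmetric] Z_def by linarith
      thus "n \<le> card \<R>" unfolding R_card s_def by (simp add: le_nat_floor)
    qed
    \<comment> \<open>\<open>L * J * \<beta>\<close> is at most \<open>4 * x / l\<close> and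
      \<open>Z\<close> is \<open>\<epsilon> * x / l\<close>, so Markov's bound is a constant times
      \<open>\<xi>\<close>; 296 is \<open>4 * 74\<close>.\<close>
    have "real L * (74 * real J * \<beta> * \<xi>) / Z / real K \<le> 296 / \<epsilon> * \<xi> / real K"
    proof (intro divide_right_mono)
      have "real L * (74 * real J * \<beta> * \<xi>) \<le> real L * (74 * real J * (4 * x / (real J * real L * l)) * \<xi>)"
        using b_hi xi by (intro mult_left_mono mult_right_mono) auto
      also have "\<dots> = 296 / \<epsilon> * \<xi> * Z" using J1 Lpos l0 \<epsilon> by (simp add: Z_def field_simps)
      finally show "real L * (74 * real J * \<beta> * \<xi>) / Z \<le> 296 / \<epsilon> * \<xi>" using Z by (simp add: divide_le_eq)
    qed auto
    thus ?thesis using res unfolding V_def[symmetric] \<beta>_def[symmetric] \<xi>_def x_def by linarith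
  qed
  show ?thesis by (intro exI[of _ "296 / \<epsilon>"] exI[of _ "nat \<lceil>x0\<rceil> + 1"]) (use main in blast)
qed

section \<open>Exceptional numbers\<close>

text \<open>For \<open>K = 2 ^ i\<close> the range of \<open>a\<close> is cut into pieces of length
  \<open>1 / K\<close>. Their number is of order \<open>K\<close>, so the \<open>1 / K\<close> in
  the bound for a single piece cancels and \<open>K powr (-1/8)\<close> remains, which is summable
  over \<open>i\<close>.\<close>

lemma AE_eventually_covered:
  fixes A0 B0 \<eta> :: real
  assumes A0: "A0 > 1" and \<eta>: "\<eta> > 0" and B0: "A0 \<le> B0"
  shows "AE a in lborel. a \<in> {A0..<B0} \<longrightarrow> eventually (\<lambda>i. covered (2 ^ i) \<eta> a) sequentially"
proof -
  obtain C' K0 where C': "\<And>K A. K0 \<le> K \<Longrightarrow> even K \<Longrightarrow> A0 \<le> A \<Longrightarrow> A \<le> B0 \<Longrightarrow>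
     {a\<in>Iv A K. \<not> covered K \<eta> a} \<in> sets borel \<and>
     measure lborel {a\<in>Iv A K. \<not> covered K \<eta> a} \<le> C' * real K powr (-1/8) / real K"
    using measure_not_covered_le[OF A0 \<eta>] by blast
  define C where "C = max C' 0"
  \<comment> \<open>\<open>i \<ge> K0\<close> gives \<open>2 ^ i \<ge> K0\<close>, and
    \<open>i \<ge> 1\<close> makes \<open>2 ^ i\<close> even.\<close>
  define i0 where "i0 = K0 + 1"
  have K: "K0 \<le> 2 ^ i \<and> even ((2::nat) ^ i)" if "i0 \<le> i" for i
  proof -
    have "i < (2::nat) ^ i" by (rule less_exp)
    hence "K0 \<le> 2 ^ i" using that unfolding i0_def by linarith
    thus ?thesis using that by (simp add: i0_def)
  qed
  define pt where "pt i j = A0 + real j / 2 ^ i" for i j :: nat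
  define n where "n i = nat \<lceil>(B0 - A0) * 2 ^ i\<rceil>" for i :: nat
  define bad where "bad i j = {a\<in>Iv (pt i j) (2 ^ i). \<not> covered (2 ^ i) \<eta> a}" for i j
  define D where "D i = (if i0 \<le> i then \<Union>j<n i. bad i j else {})" for i
  have pt: "A0 \<le> pt i j \<and> pt i j \<le> B0" if "j < n i" for i j
  proof -
    have "real j \<le> (B0 - A0) * 2 ^ i" using that unfolding n_def by linarith
    hence "real j / 2 ^ i \<le> B0 - A0" by (simp add: divide_le_eq)
    thus ?thesis by (simp add: pt_def)
  qed
  have bad: "bad i j \<in> sets borel \<and> measure lborel (bad i j) \<le> C * (2 ^ i) powr (-1/8) / 2 ^ i"
    if "i0 \<le> i" "j < n i" for i j
  proof -
    have "C' * (2 ^ i) powr (-1/8) / 2 ^ i \<le> C * (2 ^ i) powr (-1/8) / (2::real) ^ i"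
      unfolding C_def by (intro divide_right_mono mult_right_mono) auto
    thus ?thesis using C'[of "2 ^ i" "pt i j"] K[OF that(1)] pt[OF that(2)] unfolding bad_def by (auto intro: order.trans)
  qed
  have bad_sub: "bad i j \<subseteq> {pt i j..pt i j + 1}" for i j
  proof -
    define d where "d = 1 / real (2 ^ i)"
    have "d \<le> 1" by (simp add: d_def)
    thus ?thesis unfolding bad_def Iv_def d_def[symmetric] by auto
  qed
  have Dm: "D i \<in> sets lborel" for i unfolding D_def using bad by auto
  have bad_fm: "bad i j \<in> fmeasurable lborel" if "i0 \<le> i" "j < n i" for i j
  proof (rule fmeasurableI2)
    show "{pt i j..pt i j + 1} \<in> fmeasurable lborel" by (simp add: fmeasurable_compact)
    show "bad i j \<in> sets lborel" using bad[OF that] by simp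
  qed (rule bad_sub)
  have D_fm: "D i \<in> fmeasurable lborel" for i
    unfolding D_def using bad_fm by (auto intro!: fmeasurable.finite_UN)
  have D_meas: "measure lborel (D i) \<le> (B0 - A0 + 1) * C * (2 powr (-1/8)) ^ i" for i
  proof (cases "i0 \<le> i")
    case False
    thus ?thesis using B0 by (simp add: D_def C_def)
  next
    case True
    have "measure lborel (D i) \<le> (\<Sum>j<n i. measure lborel (bad i j))"
      using True bad by (simp add: D_def) (intro measure_UNION_le, auto)
    also have "\<dots> \<le> (\<Sum>j<n i. C * (2 ^ i) powr (-1/8) / 2 ^ i)" using bad True by (intro sum_mono) auto
    also have "\<dots> = real (n i) * (C * (2 ^ i) powr (-1/8) / 2 ^ i)" by simp
    also have "\<dots> \<le> ((B0 - A0 + 1) * 2 ^ i) * (C * (2 ^ i) powr (-1/8) / 2 ^ i)"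
    proof (intro mult_right_mono)
      have "0 \<le> (B0 - A0) * 2 ^ i" using B0 by simp
      hence "real (n i) \<le> (B0 - A0) * 2 ^ i + 1" unfolding n_def by linarith
      also have "(1::real) \<le> 2 ^ i" by simp
      finally show "real (n i) \<le> (B0 - A0 + 1) * 2 ^ i" by (simp add: algebra_simps)
    qed (auto simp: C_def)
    also have "\<dots> = (B0 - A0 + 1) * C * (2 ^ i) powr (-1/8)" by simp
    also have "(2 ^ i :: real) powr (-1/8) = (2 powr (-1/8)) ^ i"
      by (simp add: powr_power powr_powr flip: powr_realpow)
    finally show ?thesis .
  qed
  have "AE a in lborel. eventually (\<lambda>i. a \<in> space lborel - D i) sequentially"
  proof (rule borel_cantelli_AE1)
    show "D i \<in> sets lborel" for i by (rule Dm)
    show "emeasure lborel (D i) < \<infinity>" for i using D_fm[of i] by (simp add: fmeasurable_def)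
    have "summable (\<lambda>i. (B0 - A0 + 1) * C * (2 powr (-1/8)) ^ i)"
      using powr_less_mono[of "-1/8" 0 2] by (intro summable_mult summable_geometric) auto
    thus "summable (\<lambda>i. measure lborel (D i))"
      by (rule summable_comparison_test'[where N = 0]) (use D_meas in auto)
  qed
  thus ?thesis
  proof eventually_elim
    case (elim a)
    show ?case
    proof
      assume a: "a \<in> {A0..<B0}"
      have "eventually (\<lambda>i. i0 \<le> i) sequentially" by (rule eventually_ge_at_top)
      with elim show "eventually (\<lambda>i. covered (2 ^ i) \<eta> a) sequentially"
      proof eventually_elim
        case (elim i)
        define j where "j = nat \<lfloor>(a - A0) * 2 ^ i\<rfloor>"
        have nn: "0 \<le> (a - A0) * 2 ^ i" using a by simp
        have j: "real j \<le> (a - A0) * 2 ^ i" "(a - A0) * 2 ^ i < real j + 1"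
          unfolding j_def using nn by linarith+
        have "(a - A0) * 2 ^ i < (B0 - A0) * 2 ^ i" using a by (intro mult_strict_right_mono) auto
        hence "real j < (B0 - A0) * 2 ^ i" using j by linarith
        hence jn: "j < n i" unfolding n_def by linarith
        have "pt i j \<le> a" "a < pt i j + 1 / 2 ^ i"
          unfolding pt_def using j by (simp_all add: field_simps)
        hence "a \<in> Iv (pt i j) (2 ^ i)" by (simp add: Iv_def)
        thus ?case using elim jn by (auto simp: D_def bad_def)
      qed
    qed
  qed
qed

text \<open>Countably many values of \<open>\<eta>\<close> and ranges of \<open>a\<close> lead to a
  single null set, which then serves all \<open>\<eta>\<close> at once.\<close>

lemma AE_all_eventually_covered:
  "AE a in lborel. 1 < a \<longrightarrow> (\<forall>n. eventually (\<lambda>i. covered (2 ^ i) (1 / real (Suc n)) a) sequentially)"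
proof -
  have "AE a in lborel. \<forall>N n. a \<in> {1 + 1 / real (Suc N)..<real N + 2} \<longrightarrow>
     eventually (\<lambda>i. covered (2 ^ i) (1 / real (Suc n)) a) sequentially"
    unfolding AE_all_countable
  proof (intro allI AE_eventually_covered)
    fix N :: nat
    have "1 / real (Suc N) \<le> 1" by simp
    thus "1 + 1 / real (Suc N) \<le> real N + 2" by linarith
  qed auto
  thus ?thesis
  proof eventually_elim
    case (elim a)
    show ?case
    proof (intro impI allI)
      fix n assume a: "1 < a"
      obtain N1 where N1: "1 / real (Suc N1) < a - 1" using a by (metis diff_gt_0_iff_gt nat_approx_posE)
      obtain N2 :: nat where N2: "a < real N2" using reals_Archimedean2 by blast
      define N where "N = max N1 N2"
      have "1 / real (Suc N) \<le> 1 / real (Suc N1)" by (intro divide_left_mono) (auto simp: N_def)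
      moreover have "a < real N + 2" using N2 by (simp add: N_def)
      ultimately have "a \<in> {1 + 1 / real (Suc N)..<real N + 2}" using N1 by simp
      thus "eventually (\<lambda>i. covered (2 ^ i) (1 / real (Suc n)) a) sequentially" using elim by blast
    qed
  qed
qed

section \<open>From coverings to exceptional numbers\<close>

text \<open>The index \<open>j = 0\<close> is left out because it might give \<open>n = 0\<close>;
  this costs the \<open>+ 1\<close>.\<close>

lemma card_residue_class_ge:
  fixes M c X :: nat
  assumes "M > 0"
  shows "X div M \<le> card {n \<in> {1..X}. [n = c] (mod M)} + 1"
proof -
  let ?f = "\<lambda>j. M * j + c mod M"
  have "?f ` {1..<X div M} \<subseteq> {n \<in> {1..X}. [n = c] (mod M)}"
  proof
    fix n assume "n \<in> ?f ` {1..<X div M}"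
    then obtain j where "j \<in> {1..<X div M}" and j1: "n = ?f j" by blast
    hence j: "1 \<le> j" "j < X div M" by auto
    have "M * Suc j \<le> M * (X div M)" using j by (intro mult_le_mono2) auto
    also have "\<dots> \<le> X" by simp
    finally have "M * j + M \<le> X" by simp
    moreover have "c mod M < M" using assms by simp
    moreover have "1 * 1 \<le> M * j" using j assms by (intro mult_le_mono) auto
    ultimately have "1 \<le> n" "n \<le> X" unfolding j1 by linarith+
    thus "n \<in> {n \<in> {1..X}. [n = c] (mod M)}" by (simp add: j1 cong_def)
  qed
  hence "card (?f ` {1..<X div M}) \<le> card {n \<in> {1..X}. [n = c] (mod M)}" by (intro card_mono) auto
  moreover have "card (?f ` {1..<X div M}) = X div M - 1"
    using assms by (subst card_image) (auto simp: inj_on_def)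
  ultimately show ?thesis by linarith
qed

text \<open>If \<open>n\<close> is congruent to \<open>c\<close> modulo \<open>M\<close> and
  \<open>n = p + \<lfloor>a^k\<rfloor>\<close>, then some \<open>q \<in> Q\<close> divides
  \<open>p\<close>, so \<open>p = q\<close>. Such \<open>n\<close> lie in \<open>B\<close>, which
  has at most \<open>card Q * K\<close> elements, and \<open>card Q \<le> 2 * K\<close> because
  \<open>2 ^ card Q\<close> is at most the product. The 3 collects three roundings.\<close>

lemma exceptional_count_ge:
  assumes a: "1 < a" and t: "0 < t" "t \<le> 1" and cov: "covered K t a" and x: "x \<ge> 1"
    and K: "ln (x + 1) / ln a \<le> real K"
  shows "x / exp (t * real K) - 3 - 2 * (real K)\<^sup>2 \<le> real (exceptional_count a x)"
proof -
  obtain Q c where finQ: "finite Q" and primeQ: "\<forall>p\<in>Q. prime p" and prodQ: "real (\<Prod>Q) \<le> exp (t * real K)"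
    and c: "\<forall>k\<in>{1..K}. \<exists>p\<in>Q. [c = fpow a k] (mod p)"
    using cov unfolding covered_def by (elim exE conjE)
  note Q = finQ bspec[OF primeQ] prodQ
  define M where "M = \<Prod>Q"
  have M0: "M > 0" unfolding M_def using Q(2) by (intro prod_pos) (auto dest: prime_gt_0_nat)
  define X where "X = nat \<lfloor>x\<rfloor>"
  define good where "good = {n \<in> {1..X}. [n = c] (mod M)}"
  define B where "B = (\<lambda>(p, k). p + fpow a k) ` (Q \<times> {1..K})"
  have lna: "ln a > 0" using a by simp
  have cardQ: "real (card Q) \<le> 2 * real K"
  proof -
    have "(\<Prod>p\<in>Q. 2) \<le> (\<Prod>p\<in>Q. p)" using Q(2) by (intro prod_mono) (auto dest: prime_ge_2_nat)
    hence "real (2 ^ card Q) \<le> real (\<Prod>Q)" by (simp only: prod_constant of_nat_le_iff)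
    hence "2 ^ card Q \<le> exp (t * real K)" using Q(3) by simp
    moreover have "t * real K \<le> 1 * real K" using t by (intro mult_right_mono) auto
    ultimately have "2 ^ card Q \<le> exp (1 * real K)" using exp_le_cancel_iff[of "t * real K" "1 * real K"] by linarith
    hence "ln (2 ^ card Q) \<le> ln (exp (1 * real K))" by (subst ln_le_cancel_iff) auto
    hence "real (card Q) * ln 2 \<le> real K" by (simp add: ln_realpow)
    moreover have "real (card Q) * (1 / 2) \<le> real (card Q) * ln 2"
      using ln_2_ge_half by (intro mult_left_mono) auto
    ultimately show ?thesis by linarith
  qed
  have cardB: "real (card B) \<le> 2 * (real K)\<^sup>2"
  proof -
    have "card B \<le> card (Q \<times> {1..K})" unfolding B_def using Q(1) by (intro card_image_le) auto
    hence "card B \<le> card Q * K" by (simp add: card_cartesian_product)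
    hence "real (card B) \<le> real (card Q) * real K" by (metis of_nat_le_iff of_nat_mult)
    also have "\<dots> \<le> 2 * real K * real K" using cardQ by (intro mult_right_mono) auto
    finally show ?thesis by (simp add: power2_eq_square)
  qed
  have sub: "good - B \<subseteq> {n. 1 \<le> n \<and> real n \<le> x \<and> int n \<notin> prime_plus_floor_power a}"
  proof
    fix n assume n: "n \<in> good - B"
    have nx: "real n \<le> x" "1 \<le> n" using n x by (auto simp: good_def X_def le_nat_iff le_floor_iff)
    have "int n \<notin> prime_plus_floor_power a"
    proof
      assume "int n \<in> prime_plus_floor_power a"
      then obtain p k where pk: "int n = int p + \<lfloor>a ^ k\<rfloor>" "prime p" "1 \<le> k"
        unfolding prime_plus_floor_power_def by auto
      have ak: "0 \<le> \<lfloor>a ^ k\<rfloor>" using a by simp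
      have np: "n = p + fpow a k" using pk(1) ak by linarith
      have "real_of_int \<lfloor>a ^ k\<rfloor> \<le> real n" using pk(1) by linarith
      hence "a ^ k < x + 1" using nx by linarith
      hence "ln (a ^ k) < ln (x + 1)" using a x by (subst ln_less_cancel_iff) auto
      hence "real k * ln a < ln (x + 1)" using a by (simp add: ln_realpow)
      hence "real k < ln (x + 1) / ln a" using lna by (simp add: less_divide_eq)
      hence "k \<in> {1..K}" using K pk(3) by simp
      from bspec[OF c this] obtain q where q: "q \<in> Q" "[c = fpow a k] (mod q)" ..
      have "q dvd M" unfolding M_def using Q(1) q(1) by (rule dvd_prodI)
      moreover have "[n = c] (mod M)" using n by (simp add: good_def)
      ultimately have "[n = c] (mod q)" by (rule cong_dvd_modulus_nat[rotated])
      hence "[p + fpow a k = 0 + fpow a k] (mod q)" using q(2) unfolding np by (simp add: cong_def)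
      hence "[p = 0] (mod q)" by (simp only: cong_add_rcancel_nat)
      hence "q dvd p" by (simp add: cong_0_iff)
      hence "q = p" using Q(2)[OF q(1)] pk(2) primes_dvd_imp_eq by blast
      hence "n \<in> B" unfolding B_def np using q(1) \<open>k \<in> {1..K}\<close> by auto
      thus False using n by blast
    qed
    thus "n \<in> {n. 1 \<le> n \<and> real n \<le> x \<and> int n \<notin> prime_plus_floor_power a}" using nx by blast
  qed
  have "finite {n. 1 \<le> n \<and> real n \<le> x \<and> int n \<notin> prime_plus_floor_power a}"
    by (rule finite_subset[of _ "{..X}"]) (auto simp: X_def intro: le_nat_floor)
  hence "card (good - B) \<le> exceptional_count a x" unfolding exceptional_count_def using sub by (rule card_mono)
  moreover have "card good - card B \<le> card (good - B)"
    by (rule diff_card_le_card_Diff) (simp add: B_def Q(1))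
  ultimately have 1: "real (card good) - real (card B) \<le> real (exceptional_count a x)" by linarith
  have "X div M \<le> card good + 1" unfolding good_def using M0 by (rule card_residue_class_ge)
  moreover have "real X / real M \<le> real (X div M) + 1"
  proof -
    have "X < M * (X div M + 1)" using M0 by (metis Suc_eq_plus1 dividend_less_times_div mult_Suc_right add.commute)
    hence "real X \<le> real M * (real (X div M) + 1)" by (metis less_imp_le of_nat_1 of_nat_add of_nat_le_iff of_nat_mult)
    thus ?thesis using M0 by (simp add: divide_le_eq mult.commute)
  qed
  moreover have "x / real M \<le> real X / real M + 1"
  proof -
    have "x / real M \<le> (real X + 1) / real M" unfolding X_def using M0 x by (intro divide_right_mono) linarith+
    also have "\<dots> \<le> real X / real M + 1" using M0 by (simp add: add_divide_distrib)
    finally show ?thesis .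
  qed
  moreover have "x / exp (t * real K) \<le> x / real M"
  proof (intro divide_left_mono)
    show "real M \<le> exp (t * real K)" unfolding M_def by (rule Q(3))
  qed (use M0 x in auto)
  ultimately show ?thesis using 1 cardB by linarith
qed

lemma exceptional_count_powr:
  assumes a: "1 < a" and cov: "\<And>n. eventually (\<lambda>i. covered (2 ^ i) (1 / real (Suc n)) a) sequentially"
    and \<eta>: "0 < \<eta>"
  shows "\<exists>x0. \<forall>x\<ge>x0. x powr (1 - \<eta>) \<le> real (exceptional_count a x)"
proof -
  \<comment> \<open>A larger \<open>\<eta>\<close> makes the claim weaker; the cap keeps all
    exponents of \<open>x\<close> positive, so that the logarithmic terms are negligible.\<close>
  define \<eta>' where "\<eta>' = min \<eta> (1/2)"
  have \<eta>': "0 < \<eta>'" "\<eta>' \<le> 1/2" "\<eta>' \<le> \<eta>" using \<eta> by (auto simp: \<eta>'_def)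
  have lna: "ln a > 0" using a by simp
  \<comment> \<open>Rounding \<open>\<kappa> x\<close> up to a power of 2 at most doubles it, so
    \<open>exp (t * 2 ^ i)\<close> is at most a constant times
    \<open>(x + 1) powr (2 * t / ln a)\<close>; the choice of \<open>n\<close> makes this exponent
    at most \<open>\<eta>' / 4\<close>.\<close>
  obtain n where n: "1 / real (Suc n) < \<eta>' * ln a / 8" using nat_approx_posE[of "\<eta>' * ln a / 8"] \<eta>' lna by auto
  define t where "t = 1 / real (Suc n)"
  have t: "0 < t" "t \<le> 1" by (auto simp: t_def)
  have "2 * t \<le> \<eta>' / 4 * ln a" using n by (simp add: t_def)
  hence t2: "2 * t / ln a \<le> \<eta>' / 4" using lna by (simp add: divide_le_eq)
  obtain i0 where i0: "\<And>i. i0 \<le> i \<Longrightarrow> covered (2 ^ i) t a"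
    using cov[of n] unfolding eventually_sequentially t_def by blast
  define \<kappa> where "\<kappa> x = ln (x + 1) / ln a + 1" for x
  have "eventually (\<lambda>x. 2 ^ i0 \<le> \<kappa> x) at_top" unfolding \<kappa>_def using lna by real_asymp
  moreover have "eventually (\<lambda>x. x powr (1 - \<eta>') \<le> x / (exp 2 * (x + 1) powr (\<eta>' / 4)) - 3 - 8 * (\<kappa> x)\<^sup>2) at_top"
  proof -
    have "eventually (\<lambda>x::real. x powr (1 - \<eta>') + 3 + 8 * (\<kappa> x)\<^sup>2 \<le> x / (exp 2 * (x + 1) powr (\<eta>' / 4))) at_top"
      unfolding \<kappa>_def using \<eta>' lna by real_asymp
    thus ?thesis by eventually_elim simp
  qed
  moreover have "eventually (\<lambda>x::real. 1 \<le> x) at_top" by (rule eventually_ge_at_top)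
  ultimately have "eventually (\<lambda>x. x powr (1 - \<eta>) \<le> real (exceptional_count a x)) at_top"
  proof eventually_elim
    case (elim x)
    define i where "i = nat \<lceil>log 2 (\<kappa> x)\<rceil>"
    have k1: "1 \<le> \<kappa> x" unfolding \<kappa>_def using elim lna by simp
    have lo: "\<kappa> x \<le> 2 ^ i"
    proof -
      have "log 2 (\<kappa> x) \<le> real i" unfolding i_def by linarith
      thus ?thesis using k1 by (simp add: log_le_iff powr_realpow)
    qed
    have hi: "2 ^ i \<le> 2 * \<kappa> x"
    proof -
      have "0 \<le> log 2 (\<kappa> x)" using k1 by simp
      hence "real i \<le> log 2 (\<kappa> x) + 1" unfolding i_def by linarith
      hence "2 powr real i \<le> 2 powr (log 2 (\<kappa> x) + 1)" by simp
      also have "\<dots> = 2 * \<kappa> x" using k1 by (simp add: powr_add)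
      finally show ?thesis by (simp add: powr_realpow)
    qed
    have "(2::real) ^ i0 \<le> 2 ^ i" using elim lo by linarith
    hence "i0 \<le> i" by simp
    hence "covered (2 ^ i) t a" by (rule i0)
    moreover have "ln (x + 1) / ln a \<le> real (2 ^ i)" using lo unfolding \<kappa>_def by simp
    ultimately have "x / exp (t * real (2 ^ i)) - 3 - 2 * (real (2 ^ i))\<^sup>2 \<le> real (exceptional_count a x)"
      using a t elim by (intro exceptional_count_ge) auto
    moreover have "x / (exp 2 * (x + 1) powr (\<eta>' / 4)) \<le> x / exp (t * real (2 ^ i))"
    proof (intro divide_left_mono)
      have "t * real (2 ^ i) \<le> t * (2 * \<kappa> x)" using hi t by (intro mult_left_mono) auto
      also have "\<dots> = 2 * t + 2 * t / ln a * ln (x + 1)" unfolding \<kappa>_def using lna by (simp add: field_simps)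
      also have "\<dots> \<le> 2 + \<eta>' / 4 * ln (x + 1)" using t t2 elim by (intro add_mono mult_right_mono) auto
      finally have "exp (t * real (2 ^ i)) \<le> exp (2 + \<eta>' / 4 * ln (x + 1))" by simp
      also have "\<dots> = exp 2 * (x + 1) powr (\<eta>' / 4)" using elim by (simp add: exp_add powr_def)
      finally show "exp (t * real (2 ^ i)) \<le> exp 2 * (x + 1) powr (\<eta>' / 4)" .
    qed (use elim in auto)
    moreover have "2 * (real (2 ^ i))\<^sup>2 \<le> 8 * (\<kappa> x)\<^sup>2"
      using power_mono[OF hi, of 2] by (simp add: power_mult_distrib)
    ultimately have "x powr (1 - \<eta>') \<le> real (exceptional_count a x)" using elim by linarith
    moreover have "x powr (1 - \<eta>) \<le> x powr (1 - \<eta>')" using elim \<eta>' by (intro powr_mono) auto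
    ultimately show ?case by linarith
  qed
  thus ?thesis unfolding eventually_at_top_linorder .
qed

lemma infinite_exceptions:
  assumes "\<forall>x\<ge>x0. x powr (1 - 1 / 2) \<le> real (exceptional_count a x)"
  shows "infinite {n :: nat. 1 \<le> n \<and> int n \<notin> prime_plus_floor_power a}"
proof
  assume fin: "finite {n :: nat. 1 \<le> n \<and> int n \<notin> prime_plus_floor_power a}"
  define N where "N = real (card {n :: nat. 1 \<le> n \<and> int n \<notin> prime_plus_floor_power a})"
  define x where "x = max x0 ((N + 1)\<^sup>2)"
  have "exceptional_count a x \<le> card {n :: nat. 1 \<le> n \<and> int n \<notin> prime_plus_floor_power a}"
    unfolding exceptional_count_def using fin by (intro card_mono) auto
  hence "real (exceptional_count a x) \<le> N" by (simp add: N_def)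
  moreover have "x powr (1 - 1 / 2) \<le> real (exceptional_count a x)" using assms by (simp add: x_def)
  moreover have "N + 1 \<le> x powr (1 - 1 / 2)"
  proof -
    have "N + 1 = ((N + 1)\<^sup>2) powr (1 / 2)" by (simp add: powr_half_sqrt N_def)
    also have "\<dots> \<le> x powr (1 / 2)" by (intro powr_mono2) (auto simp: x_def)
    finally show ?thesis by simp
  qed
  ultimately show False by linarith
qed

theorem theorem1p4:
  shows "(AE a in lebesgue. (1::real) < a \<longrightarrow>
            (\<forall>\<eta>::real. 0 < \<eta> \<longrightarrow>
              (\<exists>x0::real. \<forall>x\<ge>x0. x powr (1 - \<eta>) \<le> real (exceptional_count a x)))) \<and>
         (\<forall>\<epsilon>::real. 0 < \<epsilon> \<longrightarrow>
            (AE a in lebesgue. a \<in> {1<..<1 + \<epsilon>} \<longrightarrow>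
              infinite {n :: nat. 1 \<le> n \<and> int n \<notin> prime_plus_floor_power a}))"
proof -
  have main: "AE a in lebesgue. (1::real) < a \<longrightarrow>
            (\<forall>\<eta>::real. 0 < \<eta> \<longrightarrow>
              (\<exists>x0::real. \<forall>x\<ge>x0. x powr (1 - \<eta>) \<le> real (exceptional_count a x)))"
    by (rule AE_completion, use AE_all_eventually_covered in eventually_elim)
      (blast intro: exceptional_count_powr)
  moreover have "AE a in lebesgue. a \<in> {1<..<1 + \<epsilon>} \<longrightarrow>
              infinite {n :: nat. 1 \<le> n \<and> int n \<notin> prime_plus_floor_power a}" for \<epsilon> :: real
    using main
  proof eventually_elim
    case (elim a)
    show ?case
    proof
      assume "a \<in> {1<..<1 + \<epsilon>}"
      then obtain x0 where "\<forall>x\<ge>x0. x powr (1 - 1 / 2) \<le> real (exceptional_count a x)"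
        using elim by (metis greaterThanLessThan_iff half_gt_zero zero_less_one)
      thus "infinite {n :: nat. 1 \<le> n \<and> int n \<notin> prime_plus_floor_power a}" by (rule infinite_exceptions)
    qed
  qed
  ultimately show ?thesis by blast
qed

end
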